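(* Let $d\ge 2$, $\epsilon>0$, $C=5\pi$ and $\tau(\epsilon,d)=\log\!\left(\tfrac{6C}{\epsilon}\right)^{1/2}\sqrt{\tfrac{1}{32}\log\!\left(\tfrac{6C}{\epsilon}\right)^{1/2}+\log\!\left(\tfrac{d}{\epsilon}\log\!\left(\tfrac{6C}{\epsilon}\right)^{1/2}\right)}$. Suppose a probability measure $\nu$ on $\mathrm{U}(d)$ is a $\delta$-approximate unitary $t$-expander with $$t\ge 5\frac{d^{5/2}}{\epsilon}\tau(\epsilon,d),\qquad \delta\le\frac{1}{32}\left(\frac{\epsilon^{3/2}}{4C\log\left(\frac{6C}{\epsilon}\right)^{1/2}d}\right)^{d^2-1}.$$ Then the set of unitary channels $\{\mathcal{V}:V\in\mathrm{supp}(\nu)\}$ forms an $\epsilon$-net in $\mathcal{U}(d)$ with respect to the distance $\mathrm{D}$.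
   Context: $\mathcal{U}(d)$ is the set of unitary channels $\rho\mapsto U\rho U^\dagger$ on $\mathbb{C}^d$; $\mathcal{V}$ is the channel of $V$. $\mathrm{D}(\mathcal{U},\mathcal{V})=\min_{\varphi\in[0,2\pi)}\|U-e^{i\varphi}V\|_\infty$. $S\subset\mathcal{U}(d)$ is an $\epsilon$-net if every channel is within $\mathrm{D}$-distance $\epsilon$ of some element of $S$. For a probability measure $\nu$ on $\mathrm{U}(d)$ the moment operator is $T_{\nu,t}=\int\mathrm{d}\nu(U)\,U^{\otimes t}\otimes\bar U^{\otimes t}$; with $\mu$ the Haar probability measure, $\nu$ is a $\delta$-approximate $t$-expander if $\|T_{\nu,t}-T_{\mu,t}\|_\infty\le\delta$. $\log$ is the natural logarithm. *)

theory Defs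
  imports "HOL-Analysis.Analysis" "HOL-Probability.Probability"
begin

text \<open>Matrices on C^d are represented as complex^'n^'n with d = CARD('n).\<close>

definition cadj :: "complex^'n^'n \<Rightarrow> complex^'n^'n" where
  "cadj U = (\<chi> i j. cnj (U $ j $ i))"

definition unitary :: "complex^'n^'n \<Rightarrow> bool" where
  "unitary U \<longleftrightarrow> U ** cadj U = mat 1 \<and> cadj U ** U = mat 1"

definition opnorm :: "'i set \<Rightarrow> ('i \<Rightarrow> 'i \<Rightarrow> complex) \<Rightarrow> real" where
  "opnorm I M = Sup {sqrt (\<Sum>i\<in>I. (cmod (\<Sum>j\<in>I. M i j * v j))^2) | v.
                       (\<Sum>j\<in>I. (cmod (v j))^2) \<le> 1}"

definition Dch :: "complex^'n^'n \<Rightarrow> complex^'n^'n \<Rightarrow> real" where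
  "Dch U V = (INF \<phi>\<in>{0..<2*pi}.
      opnorm UNIV (\<lambda>i j. U $ i $ j - exp (\<i> * complex_of_real \<phi>) * V $ i $ j))"

text \<open>Index set of (C^d)^{\<otimes>t} \<otimes> (C^d)^{\<otimes>t}: pairs of words of length t.\<close>
definition tidx :: "nat \<Rightarrow> ('n::finite list \<times> 'n list) set" where
  "tidx t = {(is, js). length is = t \<and> length js = t}"

text \<open>Moment operator T_{\<nu>,t} = \<integral> U^{\<otimes>t} \<otimes> conj(U)^{\<otimes>t} d\<nu>, entrywise.\<close>
definition moment_op :: "(complex^'n^'n) measure \<Rightarrow> nat \<Rightarrow>
    ('n list \<times> 'n list) \<Rightarrow> ('n list \<times> 'n list) \<Rightarrow> complex" where
  "moment_op \<nu> t = (\<lambda>(is, js) (ks, ls). \<integral>U. (\<Prod>k<t. U $ (is!k) $ (ks!k)) *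
                         (\<Prod>k<t. cnj (U $ (js!k) $ (ls!k))) \<partial>\<nu>)"

definition prob_on_unitaries :: "(complex^'n^'n) measure \<Rightarrow> bool" where
  "prob_on_unitaries \<nu> \<longleftrightarrow> prob_space \<nu> \<and> sets \<nu> = sets borel \<and>
     emeasure \<nu> {U. unitary U} = 1"

definition haar_unitary :: "(complex^'n^'n) measure \<Rightarrow> bool" where
  "haar_unitary \<mu> \<longleftrightarrow> prob_on_unitaries \<mu> \<and>
     (\<forall>V. unitary V \<longrightarrow> distr \<mu> borel (\<lambda>U. V ** U) = \<mu>)"

definition approx_expander :: "(complex^'n::finite^'n) measure \<Rightarrow> (complex^'n^'n) measure
    \<Rightarrow> real \<Rightarrow> nat \<Rightarrow> bool" where
  "approx_expander \<mu> \<nu> \<delta> t \<longleftrightarrow>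
     opnorm (tidx t) (\<lambda>a b. moment_op \<nu> t a b - moment_op \<mu> t a b) \<le> \<delta>"

definition msupp :: "('a::topological_space) measure \<Rightarrow> 'a set" where
  "msupp \<nu> = {x. \<forall>S. open S \<and> x \<in> S \<longrightarrow> emeasure \<nu> S > 0}"

definition Cconst :: real where "Cconst = 5 * pi"

definition tau :: "real \<Rightarrow> nat \<Rightarrow> real" where
  "tau \<epsilon> d = (let L = sqrt (ln (6 * Cconst / \<epsilon>)) in
      L * sqrt (L / 32 + ln (real d / \<epsilon> * L)))"

end

theory Submission
  imports Defs
begin

text \<open>
  Let \<open>T\<^sub>\<nu>\<close> and \<open>T\<^sub>\<mu>\<close> be the moment operators. Convolution by \<open>\<nu> - \<mu>\<close> has norm at most
  \<open>\<delta>\<close> on the functions spanned by the entries of \<open>U\<^sup>\<otimes>\<^sup>t \<otimes> cnj U\<^sup>\<otimes>\<^sup>t\<close>, in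
  \<open>L\<^sup>2(\<mu>)\<close>: the powers of the associated positive operator grow no faster than those of
  \<open>(T\<^sub>\<nu> - T\<^sub>\<mu>)(T\<^sub>\<nu> - T\<^sub>\<mu>)\<^sup>*\<close>. Apply this to \<open>g\<close>, the Chebyshev expansion of
  \<open>f(U) = \<bar>tr U / d\<bar>\<^bsup>2 m\<^esup>\<close> truncated at degree \<open>2 t\<close>, which is a bump at the identity.
  If the support of \<open>\<nu>\<close> misses the \<open>\<epsilon>\<close>-ball around \<open>W\<close>, then \<open>\<nu> * g\<close> is much smaller than
  the mean of \<open>g\<close> on the ball \<open>B\<close> of radius \<open>\<epsilon> / 6\<close> around \<open>W\<close>, which forces
  \<open>\<mu>(B) (\<integral> f) \<le> 4 \<delta>\<^sup>2\<close>. This contradicts two lower bounds: \<open>\<mu>(B)\<close> is bounded below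
  by packing, using the Cayley chart, and \<open>\<integral> f\<close> by the inverse of the dimension
  of the space of homogeneous polynomials of degree \<open>m\<close> in the \<open>d\<^sup>2\<close> matrix entries.
\<close>

section \<open>Unitary matrices and their norms\<close>

text \<open>The expander hypothesis bounds a matrix acting on coefficients, whereas the argument
  happens in L2(\<mu>), a possibly degenerate seminorm on coefficients. Comparing the two costs a
  factor depending on \<open>d\<close> and \<open>t\<close>, which only the passage to high powers
  removes.

  The degree \<open>m\<close> faces two demands. Across the gap 5/6 \<epsilon> left between the ball
  and the support, \<open>f\<close> is at most exp(- m (5/6 \<epsilon>)^2 / d), and truncation costs
  2 exp(- t^2 / m). Both must beat the mean of \<open>f\<close>, which is at least roughly exp(- d^2
  log(m / d^2)). So m is of order d^3 / \<epsilon>^2 up to logarithms and t^2 of order d^2 m, which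
  explains d^(5/2) / \<epsilon>.

  The power d^2 - 1 in the bound on \<delta> arises twice: polynomials of degree m in d^2 variables
  form a space of dimension about m^(d^2 - 1), and balls taken modulo phases gain a factor 1 /
  \<epsilon> over the d^2-dimensional volume.\<close>

lemma cadj_nth [simp]: "cadj A $ i $ j = cnj (A $ j $ i)"
  by (simp add: cadj_def)

lemma cadj_cadj [simp]: "cadj (cadj A) = A"
  by (simp add: vec_eq_iff)

lemma cadj_mult: "cadj (A ** B) = cadj B ** cadj A"
  by (simp add: vec_eq_iff matrix_matrix_mult_def mult.commute)

lemma cadj_add: "cadj (A + B) = cadj A + cadj B"
  by (simp add: vec_eq_iff)

lemma cadj_mat [simp]: "cadj (mat z) = mat (cnj z)"
  by (simp add: vec_eq_iff mat_def)

lemma unitary_cadj [simp]: "unitary (cadj U) \<longleftrightarrow> unitary U"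
  by (auto simp: unitary_def)

lemma unitaryD: "unitary U \<Longrightarrow> U ** cadj U = mat 1" "unitary U \<Longrightarrow> cadj U ** U = mat 1"
  by (auto simp: unitary_def)

lemma unitary_mult: "unitary U \<Longrightarrow> unitary V \<Longrightarrow> unitary (U ** V)"
  unfolding unitary_def cadj_mult
  by (metis matrix_mul_assoc matrix_mul_lid)

lemma mat_mult_nth: "(mat z ** A) $ i $ j = z * A $ i $ j"
  for A :: "complex^'n::finite^'n"
by (simp add: matrix_matrix_mult_def mat_def mult_delta_left)

lemma mat_mult_mat: "mat z ** mat w = (mat (z * w) :: complex^'n::finite^'n)"
  by (simp add: vec_eq_iff mat_mult_nth) (simp add: mat_def)

lemma unitary_mat: "cmod z = 1 \<Longrightarrow> unitary (mat z :: complex^'n::finite^'n)"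
  by (simp add: unitary_def mat_mult_mat complex_norm_square[symmetric] mult.commute)

lemma unitary_mat1 [simp]: "unitary (mat 1 :: complex^'n::finite^'n)"
  by (simp add: unitary_mat)

lemma unitary_mat_mult: "cmod z = 1 \<Longrightarrow> unitary U \<Longrightarrow> unitary (mat z ** U)"
  by (simp add: unitary_mat unitary_mult)

lemma mat_commute: "mat z ** A = A ** mat z" for A :: "complex^'n::finite^'n"
proof -
  have "(A ** mat z) $ i $ j = z * A $ i $ j" for i j
    by (simp add: matrix_matrix_mult_def mat_def mult_delta_right)
  thus ?thesis by (simp add: vec_eq_iff mat_mult_nth)
qed

lemma trace_mat_mult: "trace (mat z ** A) = z * trace A" for A :: "complex^'n::finite^'n"
  by (simp add: trace_def mat_mult_nth sum_distrib_left)

lemma matrix_mul_diff_distrib: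
  fixes A B :: "complex^'n::finite^'n"
  shows "A ** (B - C) = A ** B - A ** C" "(B - C) ** A = B ** A - C ** A"
  by (simp_all add: vec_eq_iff matrix_matrix_mult_def sum_subtractf algebra_simps)

lemma norm_matrix_sq: "(norm A)\<^sup>2 = (\<Sum>i\<in>UNIV. \<Sum>j\<in>UNIV. (cmod (A $ i $ j))\<^sup>2)"
  for A :: "complex^'n::finite^'n"
  by (simp add: norm_vec_def L2_set_def sum_nonneg)

lemma row_norm_unitary:
  assumes "unitary (U :: complex^'n::finite^'n)"
  shows "(\<Sum>j\<in>UNIV. U $ i $ j * cnj (U $ i $ j)) = 1"
  using arg_cong[OF unitaryD(1)[OF assms], of "\<lambda>A. A $ i $ i"]
  by (simp add: matrix_matrix_mult_def mat_def)

lemma cmod_entry_unitary: "unitary (U :: complex^'n::finite^'n) \<Longrightarrow> cmod (U $ i $ j) \<le> 1"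
proof -
  assume "unitary U"
  from row_norm_unitary[OF this, of i] have "(\<Sum>j\<in>UNIV. complex_of_real ((cmod (U $ i $ j))\<^sup>2)) = 1"
    by (simp add: complex_norm_square[symmetric])
  hence "(\<Sum>j\<in>UNIV. (cmod (U $ i $ j))\<^sup>2) = 1"
    by (metis of_real_sum of_real_eq_1_iff)
  moreover have "(cmod (U $ i $ j))\<^sup>2 \<le> (\<Sum>j\<in>UNIV. (cmod (U $ i $ j))\<^sup>2)"
    by (intro member_le_sum) auto
  ultimately show ?thesis by (simp add: power_le_one_iff abs_square_le_1)
qed

lemma norm_diff_unitary:
  fixes U V :: "complex^'n::finite^'n"
  assumes "unitary U" "unitary V"
  shows "(norm (U - V))\<^sup>2 = 2 * real CARD('n) - 2 * Re (trace (cadj U ** V))"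
proof -
  have *: "(cmod (a - b))\<^sup>2 = Re (a * cnj a) + Re (b * cnj b) - 2 * Re (cnj a * b)" for a b
    unfolding cmod_power2 by (simp add: power2_eq_square algebra_simps)
  have r: "(\<Sum>i\<in>UNIV. \<Sum>j\<in>UNIV. Re (W $ i $ j * cnj (W $ i $ j))) = real CARD('n)"
    if "unitary W" for W :: "complex^'n^'n"
    using row_norm_unitary[OF that] by (simp add: Re_sum[symmetric] del: times_complex.sel)
  have t: "(\<Sum>i\<in>UNIV. \<Sum>j\<in>UNIV. Re (cnj (U $ i $ j) * V $ i $ j)) = Re (trace (cadj U ** V))"
    unfolding trace_def matrix_matrix_mult_def
    by (subst sum.swap) (simp add: Re_sum)
  show ?thesis
    unfolding norm_matrix_sq
    by (simp add: * sum.distrib sum_subtractf r[OF assms(1)] r[OF assms(2)] t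
        sum_distrib_left[symmetric] del: times_complex.sel)
qed

lemma cmod_trace_unitary:
  fixes U :: "complex^'n::finite^'n"
  assumes "unitary U" shows "cmod (trace U) \<le> real CARD('n)"
proof -
  have "cmod (trace U) \<le> (\<Sum>i\<in>(UNIV::'n set). 1)"
    unfolding trace_def by (rule sum_norm_le) (simp add: cmod_entry_unitary assms)
  thus ?thesis by simp
qed

lemma phase_exists: "\<exists>z. cmod z = 1 \<and> z * w = complex_of_real (cmod w)"
proof (cases "w = 0")
  case True thus ?thesis by (intro exI[of _ 1]) simp
next
  case False
  moreover have "w * cnj w = complex_of_real (cmod w) * complex_of_real (cmod w)"
    by (metis complex_norm_square power2_eq_square of_real_mult)
  ultimately show ?thesis
    by (intro exI[of _ "cnj w / cmod w"]) (simp add: norm_divide field_simps)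
qed

text \<open>The phase that turns the trace into its modulus is optimal, so the Hilbert-Schmidt
  distance modulo phases depends on the modulus of the trace alone. \<open>hsdist\<close> rests on
  this.\<close>

lemma norm_diff_phase_exists:
  fixes U V :: "complex^'n::finite^'n"
  assumes "unitary U" "unitary V"
  shows "\<exists>z. cmod z = 1 \<and>
    (norm (U - mat z ** V))\<^sup>2 = 2 * real CARD('n) - 2 * cmod (trace (cadj U ** V))"
proof -
  obtain z where z: "cmod z = 1" "z * trace (cadj U ** V) = cmod (trace (cadj U ** V))"
    using phase_exists by blast
  have "cadj U ** (mat z ** V) = mat z ** (cadj U ** V)"
    by (metis mat_commute matrix_mul_assoc)
  hence "trace (cadj U ** (mat z ** V)) = cmod (trace (cadj U ** V))"
    by (simp add: trace_mat_mult z)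
  thus ?thesis
    using norm_diff_unitary[OF assms(1) unitary_mat_mult[OF z(1) assms(2)]] z(1) by auto
qed

text \<open>The spectral norm, taken as an \<open>onorm\<close> so that the library on bounded
  linear maps applies; \<open>opnorm_le_nrm\<close> links it to the \<open>Sup\<close> in
  \<open>opnorm\<close>.\<close>

definition nrm :: "complex^'n::finite^'n \<Rightarrow> real" where
  "nrm A = onorm ((*v) A)"

lemma norm_mult_vec_le: "norm (A *v x) \<le> nrm A * norm x"
  unfolding nrm_def by (rule onorm) simp

lemma nrm_leI: "(\<And>x. norm (A *v x) \<le> b * norm x) \<Longrightarrow> nrm A \<le> b"
  unfolding nrm_def by (rule onorm_le)

lemma nrm_nonneg [simp]: "0 \<le> nrm A"
  unfolding nrm_def by (simp add: onorm_pos_le)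

lemma nrm_triangle: "nrm (A + B) \<le> nrm A + nrm B"
proof (rule nrm_leI)
  fix x
  have "norm ((A + B) *v x) \<le> norm (A *v x) + norm (B *v x)"
    by (simp add: matrix_vector_mult_add_rdistrib norm_triangle_ineq)
  also have "\<dots> \<le> (nrm A + nrm B) * norm x"
    using norm_mult_vec_le[of A x] norm_mult_vec_le[of B x] by (simp add: distrib_right)
  finally show "norm ((A + B) *v x) \<le> (nrm A + nrm B) * norm x" .
qed

lemma nrm_mult: "nrm (A ** B) \<le> nrm A * nrm B"
proof (rule nrm_leI)
  fix x
  have "norm ((A ** B) *v x) \<le> nrm A * norm (B *v x)"
    using norm_mult_vec_le[of A "B *v x"] by (simp add: matrix_vector_mul_assoc)
  also have "\<dots> \<le> nrm A * (nrm B * norm x)"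
    by (intro mult_left_mono norm_mult_vec_le) simp
  finally show "norm ((A ** B) *v x) \<le> nrm A * nrm B * norm x" by (simp add: mult.assoc)
qed

lemma nrm_mat_mult: "nrm (mat z ** A) = cmod z * nrm A" for A :: "complex^'n::finite^'n"
proof -
  have sm: "norm (mat z *v x) = cmod z * norm x" for z and x :: "complex^'n"
  proof -
    have "mat z *v x = (\<chi> i. z * x $ i)"
    proof -
      have "(\<Sum>j\<in>UNIV. (if i = j then z else 0) * x $ j) = (\<Sum>j\<in>UNIV. if j = i then z * x $ j else 0)" for i
        by (intro sum.cong) auto
      thus ?thesis by (simp add: vec_eq_iff matrix_vector_mult_def mat_def)
    qed
    thus ?thesis by (simp add: norm_vec_def norm_mult L2_set_right_distrib)
  qed
  have le: "nrm (mat z ** A) \<le> cmod z * nrm A" for z and A :: "complex^'n^'n"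
  proof (rule nrm_leI)
    fix x
    show "norm ((mat z ** A) *v x) \<le> cmod z * nrm A * norm x"
      using mult_left_mono[OF norm_mult_vec_le[of A x], of "cmod z"]
      by (simp add: matrix_vector_mul_assoc[symmetric] sm mult.assoc)
  qed
  show ?thesis
  proof (cases "z = 0")
    case True
    thus ?thesis using le[of z A] by (simp add: order.antisym)
  next
    case False
    have "nrm A = nrm (mat (1/z) ** (mat z ** A))"
      using False by (simp add: matrix_mul_assoc mat_mult_mat)
    also have "\<dots> \<le> cmod (1/z) * nrm (mat z ** A)" by (rule le)
    finally have "cmod z * nrm A \<le> cmod z * (cmod (1/z) * nrm (mat z ** A))"
      by (intro mult_left_mono) auto
    also have "\<dots> = nrm (mat z ** A)"
      using False by (simp add: norm_divide)
    finally show ?thesis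
      using le[of z A] by linarith
  qed
qed

lemma nrm_minus [simp]: "nrm (- A) = nrm A"
proof -
  have "- A = mat (-1) ** A" by (simp add: vec_eq_iff mat_mult_nth)
  thus ?thesis using nrm_mat_mult[of "-1" A] by simp
qed

lemma nrm_minus_commute: "nrm (A - B) = nrm (B - A)"
  using nrm_minus[of "A - B"] by simp

lemma nrm_scaleR: "nrm (c *\<^sub>R A) = \<bar>c\<bar> * nrm A"
proof -
  have "c *\<^sub>R A = mat (complex_of_real c) ** A"
    by (simp add: vec_eq_iff mat_mult_nth) (simp add: scaleR_conv_of_real)
  thus ?thesis using nrm_mat_mult[of "complex_of_real c" A] by simp
qed

lemma nrm_zero [simp]: "nrm (0 :: complex^'n::finite^'n) = 0"
  using nrm_scaleR[of 0 "0 :: complex^'n^'n"] by simp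

lemma nrm_triangle_diff: "nrm (A - C) \<le> nrm (A - B) + nrm (B - C)"
  using nrm_triangle[of "A - B" "B - C"] by simp

lemma nrm_le_norm: "nrm A \<le> norm A" for A :: "complex^'n::finite^'n"
proof (rule nrm_leI)
  fix x :: "complex^'n"
  have *: "cmod ((A *v x) $ i) \<le> norm (A $ i) * norm x" for i
  proof -
    have "cmod ((A *v x) $ i) \<le> (\<Sum>j\<in>UNIV. \<bar>cmod (A $ i $ j)\<bar> * \<bar>cmod (x $ j)\<bar>)"
      unfolding matrix_vector_mult_def by (simp add: sum_norm_le norm_mult)
    also have "\<dots> \<le> norm (A $ i) * norm x"
      unfolding norm_vec_def by (rule L2_set_mult_ineq)
    finally show ?thesis .
  qed
  have "norm (A *v x) \<le> L2_set (\<lambda>i. norm (A $ i) * norm x) UNIV"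
    unfolding norm_vec_def[of "A *v x"] by (rule L2_set_mono) (use * in auto)
  also have "\<dots> = norm A * norm x"
    by (simp add: norm_vec_def[of A] L2_set_left_distrib)
  finally show "norm (A *v x) \<le> norm A * norm x" .
qed

lemma cmod_entry_le_nrm: "cmod (A $ i $ j) \<le> nrm A" for A :: "complex^'n::finite^'n"
proof -
  have "(A *v axis j 1) $ i = A $ i $ j"
    by (simp add: matrix_vector_mult_def axis_def mult_delta_right)
  hence "cmod (A $ i $ j) \<le> norm (A *v axis j 1)"
    by (metis Finite_Cartesian_Product.norm_nth_le)
  also have "\<dots> \<le> nrm A * norm (axis j (1::complex) :: complex^'n)" by (rule norm_mult_vec_le)
  also have "norm (axis j (1::complex) :: complex^'n) = 1" by (simp add: norm_axis_1)
  finally show ?thesis by simp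
qed

text \<open>\<open>nrm\<close> is 1-Lipschitz for the Frobenius norm. This makes the balls
  \<open>pball\<close> open, hence Borel.\<close>

lemma continuous_on_nrm: "continuous_on S (nrm :: complex^'n::finite^'n \<Rightarrow> real)"
proof -
  have 1: "nrm A \<le> nrm B + norm (A - B)" for A B :: "complex^'n^'n"
    using nrm_triangle[of "A - B" B] nrm_le_norm[of "A - B"] by simp
  have "\<bar>nrm A - nrm B\<bar> \<le> norm (A - B)" for A B :: "complex^'n^'n"
    using 1[of A B] 1[of B A] by (simp add: norm_minus_commute)
  hence "dist (nrm A) (nrm B) < e" if "dist A B < e" for A B :: "complex^'n^'n" and e
    using that by (metis dist_norm le_less_trans real_norm_def)
  thus ?thesis
    unfolding continuous_on_iff by (metis dist_commute)
qed

lemma nrm_unitary_le: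
  fixes U :: "complex^'n::finite^'n"
  assumes "unitary U" shows "nrm U \<le> 1"
proof (rule nrm_leI)
  fix x
  have in_eq: "(norm y)\<^sup>2 = Re (\<Sum>i\<in>UNIV. cnj (y $ i) * y $ i)" for y :: "complex^'n"
    by (simp add: norm_vec_def L2_set_def sum_nonneg Re_sum cmod_power2) (simp add: power2_eq_square)
  have "(\<Sum>i\<in>UNIV. cnj ((U *v x) $ i) * (U *v x) $ i)
      = (\<Sum>i\<in>UNIV. \<Sum>j\<in>UNIV. \<Sum>k\<in>UNIV. cnj (x $ j) * (cnj (U $ i $ j) * U $ i $ k) * x $ k)"
    unfolding matrix_vector_mult_def vec_lambda_beta cnj_sum sum_product
    by (simp add: mult_ac)
  also have "\<dots> = (\<Sum>j\<in>UNIV. \<Sum>i\<in>UNIV. \<Sum>k\<in>UNIV. cnj (x $ j) * (cnj (U $ i $ j) * U $ i $ k) * x $ k)"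
    by (rule sum.swap)
  also have "\<dots> = (\<Sum>j\<in>UNIV. \<Sum>k\<in>UNIV. \<Sum>i\<in>UNIV. cnj (x $ j) * (cnj (U $ i $ j) * U $ i $ k) * x $ k)"
    by (intro sum.cong refl sum.swap)
  also have "\<dots> = (\<Sum>j\<in>UNIV. \<Sum>k\<in>UNIV. cnj (x $ j) * ((cadj U ** U) $ j $ k) * x $ k)"
    by (simp add: matrix_matrix_mult_def sum_distrib_left sum_distrib_right)
  also have "\<dots> = (\<Sum>j\<in>UNIV. \<Sum>k\<in>UNIV. if k = j then cnj (x $ j) * x $ k else 0)"
    using unitaryD(2)[OF assms] by (intro sum.cong) (auto simp: mat_def)
  also have "\<dots> = (\<Sum>i\<in>UNIV. cnj (x $ i) * x $ i)" by simp
  finally have "(norm (U *v x))\<^sup>2 = (norm x)\<^sup>2" unfolding in_eq by simp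
  thus "norm (U *v x) \<le> 1 * norm x" by simp
qed

lemma nrm_unitary_mult:
  fixes A :: "complex^'n::finite^'n"
  assumes "unitary U" shows "nrm (U ** A) = nrm A" "nrm (A ** U) = nrm A"
proof -
  have 1: "nrm (V ** B) \<le> nrm B" "nrm (B ** V) \<le> nrm B" if "unitary V" for V B :: "complex^'n^'n"
    using nrm_mult[of V B] nrm_mult[of B V] nrm_unitary_le[OF that]
      mult_right_mono[of "nrm V" 1 "nrm B"] mult_left_mono[of "nrm V" 1 "nrm B"] by auto
  show "nrm (U ** A) = nrm A"
    using 1(1)[of U A] 1(1)[of "cadj U" "U ** A"] assms
    by (simp add: matrix_mul_assoc unitaryD)
  show "nrm (A ** U) = nrm A"
    using 1(2)[of U A] 1(2)[of "cadj U" "A ** U"] assms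
    by (simp add: matrix_mul_assoc[symmetric] unitaryD)
qed

lemma opnorm_le_nrm: "opnorm UNIV (\<lambda>i j. A $ i $ j) \<le> nrm A"
  unfolding opnorm_def
proof (rule cSup_least)
  show "{sqrt (\<Sum>i\<in>UNIV. (cmod (\<Sum>j\<in>UNIV. A $ i $ j * v j))\<^sup>2) |v. (\<Sum>j\<in>UNIV. (cmod (v j))\<^sup>2) \<le> 1} \<noteq> {}"
    by (auto intro!: exI[of _ "\<lambda>_. 0"])
next
  fix x assume "x \<in> {sqrt (\<Sum>i\<in>UNIV. (cmod (\<Sum>j\<in>UNIV. A $ i $ j * v j))\<^sup>2) |v. (\<Sum>j\<in>UNIV. (cmod (v j))\<^sup>2) \<le> 1}"
  then obtain v where v: "x = sqrt (\<Sum>i\<in>UNIV. (cmod (\<Sum>j\<in>UNIV. A $ i $ j * v j))\<^sup>2)"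
    "(\<Sum>j\<in>UNIV. (cmod (v j))\<^sup>2) \<le> 1" by auto
  define w where "w = (\<chi> j. v j)"
  have "x = norm (A *v w)" using v(1)
    by (simp add: norm_vec_def L2_set_def matrix_vector_mult_def w_def)
  also have "\<dots> \<le> nrm A * norm w" by (rule norm_mult_vec_le)
  also have "norm w \<le> 1" using v(2) by (simp add: norm_vec_def L2_set_def w_def)
  hence "nrm A * norm w \<le> nrm A" using mult_left_mono[of "norm w" 1 "nrm A"] by simp
  finally show "x \<le> nrm A" .
qed

section \<open>Packing bounds in the unitary group\<close>

lemma matrix_mul_add_distrib_right: "(B + C) ** A = B ** A + C ** A" for A :: "complex^'n::finite^'n"
  by (simp add: vec_eq_iff matrix_matrix_mult_def sum.distrib algebra_simps)

text \<open>Volume comparison: the \<open>p\<close>-balls of radius \<open>\<rho>/2\<close> about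
  the points of \<open>S\<close> are disjoint and lie in the ball of radius
  \<open>R + \<rho>/2\<close>. The norm \<open>p\<close> is left abstract because the bound is used
  for \<open>nrm\<close>, for \<open>nrm\<close> pulled back along a chart, and for the Frobenius
  norm.\<close>

lemma packing_bound:
  fixes p :: "'a::euclidean_space \<Rightarrow> real"
  assumes tri: "\<And>x y. p (x + y) \<le> p x + p y" and scale: "\<And>c x. p (c *\<^sub>R x) = \<bar>c\<bar> * p x"
    and le: "\<And>x. p x \<le> C * norm x" and ge: "\<And>x. norm x \<le> C' * p x"
    and S: "finite S" "\<And>x. x \<in> S \<Longrightarrow> p x \<le> R" and "\<rho> > 0" "R \<ge> 0"
    and sep: "\<And>x y. x \<in> S \<Longrightarrow> y \<in> S \<Longrightarrow> x \<noteq> y \<Longrightarrow> \<rho> \<le> p (x - y)"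
  shows "real (card S) \<le> (1 + 2 * R / \<rho>) ^ DIM('a)"
proof -
  define B where "B x h = {y. p (y - x) < h}" for x :: 'a and h :: real
  have p0: "p 0 = 0" using scale[of 0 0] by simp
  have pm: "p (- x) = p x" for x using scale[of "-1" x] by simp
  have lip: "\<bar>p x - p y\<bar> \<le> \<bar>C\<bar> * norm (x - y)" for x y
  proof -
    have "p (x - y) \<le> \<bar>C\<bar> * norm (x - y)" 
      using le[of "x - y"] by (meson abs_ge_self mult_right_mono norm_ge_zero order_trans)
    thus ?thesis using tri[of "x - y" y] tri[of "y - x" x] pm[of "x - y"] by simp
  qed
  have "\<bar>C\<bar>-lipschitz_on UNIV p"
    by (rule lipschitz_onI) (use lip in \<open>auto simp: dist_norm\<close>)
  hence cont: "continuous_on UNIV p" by (rule lipschitz_on_continuous_on)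
  have opn: "open (B x h)" for x h
    unfolding B_def by (intro open_Collect_less continuous_on_compose2[OF cont] continuous_intros) auto
  have bdd: "bounded (B x h)" for x h
  proof -
    have "norm y \<le> norm x + \<bar>C'\<bar> * h" if "y \<in> B x h" for y
    proof -
      have pn: "0 \<le> p z" for z using tri[of z "-z"] by (simp add: p0 pm)
      have "norm (y - x) \<le> \<bar>C'\<bar> * p (y - x)"
        using ge[of "y - x"] mult_right_mono[OF abs_ge_self pn, of C' "y - x"] by linarith
      also have "\<dots> \<le> \<bar>C'\<bar> * h" using that by (intro mult_left_mono) (auto simp: B_def)
      finally show ?thesis using norm_triangle_ineq2[of y x] by linarith
    qed
    thus ?thesis by (auto simp: bounded_iff)
  qed
  have meas: "B x h \<in> lmeasurable" for x h
    by (rule lmeasurable_open) (use opn bdd in auto)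
  define m where "m = measure lebesgue (B 0 1)"
  have msr: "measure lebesgue (B x h) = h ^ DIM('a) * m" if "h > 0" for x h
  proof -
    \<comment> \<open>Every ball is an affine image of the unit ball, so its volume scales with the
      dimension-th power of \<open>h\<close>.\<close>
    have "B x h = (\<lambda>y. h *\<^sub>R y + x) ` B 0 1"
    proof (intro equalityI subsetI)
      fix y assume y: "y \<in> B x h"
      hence "p ((1/h) *\<^sub>R (y - x)) < 1" using that by (simp only: scale) (simp add: B_def)
      moreover have "y = h *\<^sub>R ((1/h) *\<^sub>R (y - x)) + x" using that by simp
      ultimately show "y \<in> (\<lambda>y. h *\<^sub>R y + x) ` B 0 1" by (force simp: B_def)
    next
      fix y assume "y \<in> (\<lambda>y. h *\<^sub>R y + x) ` B 0 1"
      thus "y \<in> B x h" using that by (auto simp: B_def scale)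
    qed
    thus ?thesis using that measure_lebesgue_affine[of h x "B 0 1"] by (simp add: m_def)
  qed
  have "0 \<in> B 0 1" by (simp add: B_def p0)
  hence "\<not> negligible (B 0 1)" using open_not_negligible[OF opn, of 0 1] by blast
  hence "m \<noteq> 0" unfolding m_def using meas[of 0 1] negligible_iff_measure by blast
  hence "m > 0" unfolding m_def using zero_less_measure_iff by blast
  have "real (card S) * ((\<rho>/2) ^ DIM('a) * m) = (\<Sum>x\<in>S. measure lebesgue (B x (\<rho>/2)))"
    using \<open>\<rho> > 0\<close> by (simp add: msr)
  also have "\<dots> = measure lebesgue (\<Union>x\<in>S. B x (\<rho>/2))"
  proof (rule measure_UNION'[symmetric])
    show "pairwise (\<lambda>x y. disjnt (B x (\<rho>/2)) (B y (\<rho>/2))) S"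
    proof (rule pairwiseI)
      fix x y assume xy: "x \<in> S" "y \<in> S" "x \<noteq> y"
      have False if "z \<in> B x (\<rho>/2)" "z \<in> B y (\<rho>/2)" for z
        using sep[OF xy] tri[of "x - z" "z - y"] pm[of "x - z"] that by (simp add: B_def)
      thus "disjnt (B x (\<rho>/2)) (B y (\<rho>/2))" by (auto simp: disjnt_iff)
    qed
  qed (use S meas in auto)
  also have "\<dots> \<le> measure lebesgue (B 0 (R + \<rho>/2))"
  proof (rule measure_mono_fmeasurable)
    have "p y < R + \<rho>/2" if "x \<in> S" "p (y - x) < \<rho>/2" for x y
      using tri[of "y - x" x] S(2)[OF that(1)] that(2) by simp
    thus "(\<Union>x\<in>S. B x (\<rho>/2)) \<subseteq> B 0 (R + \<rho>/2)" by (auto simp: B_def)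
  qed (use meas S in \<open>auto intro!: fmeasurableD\<close>)
  also have "\<dots> = (R + \<rho>/2) ^ DIM('a) * m" using \<open>\<rho> > 0\<close> \<open>R \<ge> 0\<close> by (simp add: msr)
  finally have "real (card S) * (\<rho>/2) ^ DIM('a) \<le> (R + \<rho>/2) ^ DIM('a)"
    using \<open>m > 0\<close> by (simp add: mult.assoc[symmetric])
  also have "R + \<rho>/2 = (1 + 2 * R / \<rho>) * (\<rho>/2)" using \<open>\<rho> > 0\<close> by (simp add: field_simps)
  finally have "real (card S) * (\<rho>/2) ^ DIM('a) \<le> (1 + 2 * R / \<rho>) ^ DIM('a) * (\<rho>/2) ^ DIM('a)"
    by (simp only: power_mult_distrib)
  thus ?thesis by (rule mult_right_le_imp_le) (use \<open>\<rho> > 0\<close> in simp)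
qed

text \<open>A uniform cardinality bound takes the place of compactness: a separated set of largest
  cardinality exists, and by maximality it is a covering net. Turning packing bounds into coverings
  this way yields all volume bounds below.\<close>

lemma maximal_separated:
  fixes N :: real
  assumes bound: "\<And>T. finite T \<Longrightarrow> T \<subseteq> X \<Longrightarrow> pairwise sep T \<Longrightarrow> real (card T) \<le> N"
    and sym: "\<And>x y. sep x y \<Longrightarrow> sep y x"
  obtains T where "finite T" "T \<subseteq> X" "pairwise sep T" "\<And>x. x \<in> X \<Longrightarrow> x \<in> T \<or> (\<exists>t\<in>T. \<not> sep t x)"
proof -
  define P where "P k \<longleftrightarrow> (\<exists>T. finite T \<and> T \<subseteq> X \<and> pairwise sep T \<and> card T = k)" for k
  have "P 0" unfolding P_def by (intro exI[of _ "{}"]) auto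
  moreover have "\<forall>k. P k \<longrightarrow> k < Suc (nat \<lfloor>N\<rfloor>)"
    using bound unfolding P_def by (metis le_nat_floor less_Suc_eq_le)
  ultimately obtain k where k: "P k" "\<And>j. P j \<Longrightarrow> j \<le> k"
    using ex_has_greatest_nat[of P 0 "\<lambda>x. x" "Suc (nat \<lfloor>N\<rfloor>)"] by auto
  from k(1) obtain T where T: "finite T" "T \<subseteq> X" "pairwise sep T" "card T = k" unfolding P_def by blast
  have "\<exists>t\<in>T. \<not> sep t x" if "x \<in> X" "x \<notin> T" for x
  proof (rule ccontr)
    assume *: "\<not> ?thesis"
    hence "pairwise sep (insert x T)" using T(3) sym by (auto simp: pairwise_insert)
    hence "P (Suc k)" unfolding P_def using T that by (intro exI[of _ "insert x T"]) auto
    from k(2)[OF this] show False by simp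
  qed
  thus thesis using that T by blast
qed

text \<open>The Cayley transform \<open>U \<mapsto> 2 (1 + U)\<^sup>-\<^sup>1 - 1\<close> is a chart of the unitary group near the
  identity with values in the skew-Hermitian matrices, a space of real dimension \<open>d\<^sup>2\<close>.\<close>

lemma cayley_chart:
  fixes U :: "complex^'n::finite^'n"
  assumes U: "unitary U" and near: "nrm (mat 1 - U) < 1"
  obtains Q R where "R ** (mat 1 + U) = mat 1" "(mat 1 + U) ** R = mat 1" "Q = R + R - mat 1"
    "cadj Q = - Q" "nrm Q \<le> 1"
proof -
  \<comment> \<open>Write 1 + U = 2 - (1 - U) with \<open>nrm (mat 1 - U) < 1\<close>: the map
    expands norms, so it is invertible with inverse of norm at most 1.\<close>
  have low: "norm x \<le> norm ((mat 1 + U) *v x)" for x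
  proof -
    have "(mat 1 + U) *v x = x + x - (mat 1 - U) *v x"
      by (simp add: matrix_vector_mult_add_rdistrib matrix_vector_mult_diff_rdistrib)
    moreover have "norm ((mat 1 - U) *v x) \<le> norm x"
      using norm_mult_vec_le[of "mat 1 - U" x] near mult_right_mono[of "nrm (mat 1 - U)" 1 "norm x"] by simp
    moreover have "norm (x + x) = 2 * norm x" by (metis norm_scaleR scaleR_2 abs_numeral)
    ultimately show ?thesis using norm_triangle_ineq2[of "x + x" "(mat 1 - U) *v x"] by simp
  qed
  have "inj ((*v) (mat 1 + U))"
  proof (rule injI)
    fix x y assume "(mat 1 + U) *v x = (mat 1 + U) *v y"
    hence "(mat 1 + U) *v (x - y) = 0" by (simp add: matrix_vector_mult_diff_distrib)
    thus "x = y" using low[of "x - y"] by simp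
  qed
  then obtain R where R: "R ** (mat 1 + U) = mat 1"
    using matrix_left_invertible_injective by blast
  hence R': "(mat 1 + U) ** R = mat 1" by (simp add: matrix_left_right_inverse)
  define Q where "Q = R + R - mat 1"
  have nR: "nrm R \<le> 1"
  proof (rule nrm_leI)
    fix x
    have "(mat 1 + U) *v (R *v x) = x" by (simp add: matrix_vector_mul_assoc R')
    thus "norm (R *v x) \<le> 1 * norm x" using low[of "R *v x"] by simp
  qed
  \<comment> \<open>Adjoining the inverse of 1 + U and using unitarity; together with R + R U = 1
    this gives \<open>cadj R = mat 1 - R\<close>, so R - 1/2 is skew-Hermitian.\<close>
  have "cadj R = R ** U"
  proof -
    have "cadj R ** (mat 1 + cadj U) = mat 1"
      using arg_cong[OF R', of cadj] by (simp add: cadj_mult cadj_add)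
    moreover have "(mat 1 + cadj U) ** (U ** R) = (mat 1 + U) ** R"
      using unitaryD(2)[OF U] by (simp add: matrix_mul_assoc matrix_mul_add_distrib_right)
    ultimately have "cadj R = U ** R"
      using R' by (metis matrix_mul_assoc matrix_mul_lid matrix_mul_rid)
    moreover have "U ** R = R ** U"
    proof -
      have "R + U ** R = R + R ** U" using R R' by (simp add: matrix_mul_add_distrib_right matrix_add_ldistrib)
      thus ?thesis by simp
    qed
    ultimately show ?thesis by simp
  qed
  moreover have RU: "R ** U = mat 1 - R" using R by (simp add: matrix_add_ldistrib algebra_simps)
  ultimately have cR: "cadj R = mat 1 - R" by simp
  have cm: "cadj (A - B) = cadj A - cadj B" for A B :: "complex^'n^'n" by (simp add: vec_eq_iff)
  have "cadj Q = - Q" unfolding Q_def cm cadj_add cR by simp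
  moreover have "nrm Q \<le> 1"
  proof -
    have "Q = R ** (mat 1 - U)" unfolding Q_def by (simp add: matrix_mul_diff_distrib RU)
    hence "nrm Q \<le> nrm R * nrm (mat 1 - U)" by (simp add: nrm_mult)
    also have "\<dots> \<le> 1 * 1" using nR near by (intro mult_mono) auto
    finally show ?thesis by simp
  qed
  ultimately show thesis using that R R' Q_def by blast
qed

lemma norm_le_nrm: "norm A \<le> real CARD('n) * real CARD('n) * nrm A" for A :: "complex^'n::finite^'n"
proof -
  have "norm (A $ i) \<le> real CARD('n) * nrm A" for i
  proof -
    have "norm (A $ i) \<le> (\<Sum>j\<in>UNIV. cmod (A $ i $ j))"
      unfolding norm_vec_def by (rule L2_set_le_sum) simp
    also have "\<dots> \<le> (\<Sum>j\<in>(UNIV::'n set). nrm A)" by (intro sum_mono cmod_entry_le_nrm)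
    finally show ?thesis by simp
  qed
  hence "(\<Sum>i\<in>UNIV. norm (A $ i)) \<le> (\<Sum>i\<in>(UNIV::'n set). real CARD('n) * nrm A)" by (intro sum_mono)
  moreover have "norm A \<le> (\<Sum>i\<in>UNIV. norm (A $ i))"
    unfolding norm_vec_def[of A] by (rule L2_set_le_sum) simp
  ultimately show ?thesis by simp
qed

text \<open>Counts in the full matrix space, of real dimension 2 d^2. The doubled exponent is
  harmless because this is applied only at the fixed scale 1, to count charts.\<close>

lemma card_separated_ambient:
  fixes S :: "(complex^'n::finite^'n) set"
  assumes "finite S" "\<And>U. U \<in> S \<Longrightarrow> unitary U"
    and "\<And>U V. U \<in> S \<Longrightarrow> V \<in> S \<Longrightarrow> U \<noteq> V \<Longrightarrow> \<rho> \<le> nrm (U - V)" and "\<rho> > 0"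
  shows "real (card S) \<le> (1 + 2 / \<rho>) ^ (2 * CARD('n)\<^sup>2)"
proof -
  have "real (card S) \<le> (1 + 2 * 1 / \<rho>) ^ DIM(complex^'n^'n)"
    using assms nrm_le_norm norm_le_nrm
    by (intro packing_bound[where p = nrm and C = 1])
       (auto intro: nrm_triangle nrm_unitary_le simp: nrm_scaleR)
  thus ?thesis by (simp add: power2_eq_square mult_ac)
qed

text \<open>The chart at most halves distances: U - V = (1 + U) (R V - R U) (1 + V), the outer
  factors have norm at most 2, and Q differs from 2 R by a constant. So the images are
  \<open>\<rho>/2\<close>-separated in a unit ball of real dimension d^2.\<close>

lemma card_separated_local:
  fixes S :: "(complex^'n::finite^'n) set"
  assumes S: "finite S" "\<And>U. U \<in> S \<Longrightarrow> unitary U" "\<And>U. U \<in> S \<Longrightarrow> nrm (mat 1 - U) < 1"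
    and sep: "\<And>U V. U \<in> S \<Longrightarrow> V \<in> S \<Longrightarrow> U \<noteq> V \<Longrightarrow> \<rho> \<le> nrm (U - V)" and "\<rho> > 0"
  shows "real (card S) \<le> (1 + 4 / \<rho>) ^ (CARD('n)\<^sup>2)"
proof -
  define P where "P U Q R \<longleftrightarrow> R ** (mat 1 + U) = mat 1 \<and> (mat 1 + U) ** R = mat 1 \<and>
    Q = R + R - mat 1 \<and> cadj Q = - Q \<and> nrm Q \<le> 1" for U Q R :: "complex^'n^'n"
  have "\<exists>Q R. P U Q R" if "U \<in> S" for U
    by (rule cayley_chart[OF S(2)[OF that] S(3)[OF that]]) (unfold P_def, blast)
  then obtain Q R where "\<And>U. U \<in> S \<Longrightarrow> P U (Q U) (R U)" by metis
  hence QR: "\<And>U. U \<in> S \<Longrightarrow> R U ** (mat 1 + U) = mat 1"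
    "\<And>U. U \<in> S \<Longrightarrow> (mat 1 + U) ** R U = mat 1" "\<And>U. U \<in> S \<Longrightarrow> Q U = R U + R U - mat 1"
    "\<And>U. U \<in> S \<Longrightarrow> cadj (Q U) = - Q U" "\<And>U. U \<in> S \<Longrightarrow> nrm (Q U) \<le> 1"
    unfolding P_def by blast+
  have Qsep: "\<rho> / 2 \<le> nrm (Q U - Q V)" if UV: "U \<in> S" "V \<in> S" "U \<noteq> V" for U V
  proof -
    have n2: "nrm (mat 1 + W) \<le> 2" if "W \<in> S" for W
      using nrm_triangle[of "mat 1" W] nrm_unitary_le[of "mat 1 :: complex^'n^'n"]
        nrm_unitary_le[OF S(2)[OF that]] by simp
    have "(mat 1 + U) ** (R V - R U) ** (mat 1 + V) = U - V"
    proof -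
      have "(mat 1 + U) ** (R V - R U) ** (mat 1 + V)
          = (mat 1 + U) ** (R V ** (mat 1 + V)) - ((mat 1 + U) ** R U) ** (mat 1 + V)"
        by (simp only: matrix_mul_diff_distrib matrix_mul_assoc)
      thus ?thesis by (simp add: QR(1)[OF UV(2)] QR(2)[OF UV(1)])
    qed
    hence "nrm (U - V) \<le> nrm ((mat 1 + U) ** (R V - R U)) * nrm (mat 1 + V)"
      using nrm_mult[of "(mat 1 + U) ** (R V - R U)" "mat 1 + V"] by simp
    also have "\<dots> \<le> (nrm (mat 1 + U) * nrm (R V - R U)) * nrm (mat 1 + V)"
      by (intro mult_right_mono nrm_mult) simp
    also have "\<dots> \<le> (2 * nrm (R V - R U)) * 2"
      using n2 UV by (intro mult_mono mult_nonneg_nonneg) auto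
    also have "2 * nrm (R V - R U) = nrm (Q U - Q V)"
    proof -
      have "Q V - Q U = 2 *\<^sub>R (R V - R U)" using QR(3) UV by (simp add: scaleR_2)
      hence "nrm (Q V - Q U) = 2 * nrm (R V - R U)" by (simp only: nrm_scaleR)
      thus ?thesis by (simp add: nrm_minus_commute)
    qed
    finally show ?thesis using sep[OF UV] by simp
  qed
  \<comment> \<open>\<open>K\<close> identifies real matrices with skew-Hermitian ones, the
    antisymmetric part becoming the real part and the symmetric part the imaginary part;
    \<open>J\<close> is its inverse. This supplies a Euclidean space of dimension d^2 to pack
    in.\<close>
  define K :: "real^'n^'n \<Rightarrow> complex^'n^'n" where
    "K A = (\<chi> i j. Complex ((A $ i $ j - A $ j $ i) / 2) ((A $ i $ j + A $ j $ i) / 2))" for A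
  define J :: "complex^'n^'n \<Rightarrow> real^'n^'n" where "J B = (\<chi> i j. Re (B $ i $ j) + Im (B $ i $ j))" for B
  have KJ: "K (J B) = B" if "cadj B = - B" for B
  proof -
    have *: "cnj (B $ j $ i) = - (B $ i $ j)" for i j
      using arg_cong[OF that, of "\<lambda>A. A $ i $ j"] by simp
    have "K (J B) $ i $ j = B $ i $ j" for i j
      using arg_cong[OF *[of j i], of Re] arg_cong[OF *[of j i], of Im]
      by (simp add: K_def J_def complex_eq_iff)
    thus ?thesis by (simp add: vec_eq_iff)
  qed
  have Kadd: "K (A + B) = K A + K B" for A B
    by (simp add: vec_eq_iff K_def complex_eq_iff field_simps)
  have Kscale: "K (c *\<^sub>R A) = c *\<^sub>R K A" for c A
    by (simp add: vec_eq_iff K_def complex_eq_iff algebra_simps)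
  have Kdiff: "K (A - B) = K A - K B" for A B
    by (simp add: vec_eq_iff K_def complex_eq_iff field_simps)
  obtain C where C: "\<And>A. norm (K A) \<le> C * norm A"
  proof -
    have "linear K" by (rule linearI) (simp_all add: Kadd Kscale)
    thus thesis using that linear_bounded by blast
  qed
  obtain C' where ge: "\<And>A. norm A \<le> C' * nrm (K A)"
  proof -
    have "linear J" by (rule linearI) (simp_all add: vec_eq_iff J_def algebra_simps)
    then obtain b where b: "0 < b" "\<And>B. norm (J B) \<le> b * norm B" using linear_bounded_pos by blast
    have JK: "J (K A) = A" for A by (simp add: vec_eq_iff J_def K_def field_simps)
    have "norm A \<le> b * (real CARD('n) * real CARD('n)) * nrm (K A)" for A
      using b(2)[of "K A"] mult_left_mono[OF norm_le_nrm[of "K A"] less_imp_le[OF b(1)]]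
      unfolding JK mult.assoc by (rule order_trans)
    thus thesis by (rule that)
  qed
  have inj: "inj_on (J \<circ> Q) S"
  proof (rule inj_onI, rule ccontr)
    fix U V assume UV: "U \<in> S" "V \<in> S" "(J \<circ> Q) U = (J \<circ> Q) V" "U \<noteq> V"
    hence "Q U = Q V" using KJ QR(4) by (metis comp_apply)
    thus False using Qsep[OF UV(1,2,4)] \<open>\<rho> > 0\<close> by simp
  qed
  have "real (card ((J \<circ> Q) ` S)) \<le> (1 + 2 * 1 / (\<rho>/2)) ^ DIM(real^'n^'n)"
  proof (rule packing_bound[where p = "\<lambda>A. nrm (K A)"])
    show "nrm (K (x + y)) \<le> nrm (K x) + nrm (K y)" for x y by (simp add: Kadd nrm_triangle)
    show "nrm (K (c *\<^sub>R x)) = \<bar>c\<bar> * nrm (K x)" for c x by (simp add: Kscale nrm_scaleR)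
    show "nrm (K x) \<le> C * norm x" for x using nrm_le_norm C order_trans by blast
    show "norm A \<le> C' * nrm (K A)" for A by (rule ge)
    show "nrm (K x) \<le> 1" if "x \<in> (J \<circ> Q) ` S" for x using that QR(4,5) KJ by auto
    show "\<rho>/2 \<le> nrm (K (x - y))" if xy: "x \<in> (J \<circ> Q) ` S" "y \<in> (J \<circ> Q) ` S" "x \<noteq> y" for x y
    proof -
      obtain U V where UV: "U \<in> S" "V \<in> S" "x = J (Q U)" "y = J (Q V)" using xy(1,2) by auto
      with xy(3) have "U \<noteq> V" by auto
      thus ?thesis using Qsep[OF UV(1,2)] by (simp add: Kdiff UV KJ QR(4))
    qed
  qed (use S \<open>\<rho> > 0\<close> in auto)
  thus ?thesis unfolding card_image[OF inj] by (simp add: power2_eq_square)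
qed

text \<open>Unit balls about a maximal 1-separated subset are charts after translation to the
  identity. Their number is at most 3^(2 d^2) = 9^(d^2), the source of the factor 9.\<close>

lemma card_separated_unitary:
  fixes S :: "(complex^'n::finite^'n) set"
  assumes S: "finite S" "\<And>U. U \<in> S \<Longrightarrow> unitary U"
    and sep: "\<And>U V. U \<in> S \<Longrightarrow> V \<in> S \<Longrightarrow> U \<noteq> V \<Longrightarrow> \<rho> \<le> nrm (U - V)" and "\<rho> > 0"
  shows "real (card S) \<le> (9 * (1 + 4 / \<rho>)) ^ (CARD('n)\<^sup>2)"
proof -
  have sym: "1 \<le> nrm (U - V) \<Longrightarrow> 1 \<le> nrm (V - U)" for U V :: "complex^'n^'n"
    by (simp add: nrm_minus_commute)
  obtain T where T: "finite T" "T \<subseteq> S" "pairwise (\<lambda>U V. 1 \<le> nrm (U - V)) T"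
    "\<And>U. U \<in> S \<Longrightarrow> U \<in> T \<or> (\<exists>V\<in>T. \<not> 1 \<le> nrm (V - U))"
    by (rule maximal_separated[where X = S and sep = "\<lambda>U V. 1 \<le> nrm (U - V)" and N = "real (card S)"])
       (use S sym in \<open>auto intro: card_mono\<close>)
  have cT: "real (card T) \<le> 9 ^ (CARD('n)\<^sup>2)"
    using card_separated_ambient[of T 1] T(1-3) S(2) by (simp add: power_mult pairwise_def subset_iff)
  define L where "L V = {U\<in>S. nrm (V - U) < 1}" for V
  have cL: "real (card (L V)) \<le> (1 + 4 / \<rho>) ^ (CARD('n)\<^sup>2)" if "V \<in> T" for V
  proof -
    have V: "unitary V" using that T(2) S(2) by auto
    have inj: "inj_on (\<lambda>U. cadj V ** U) (L V)"
      by (rule inj_onI) (metis V matrix_mul_assoc matrix_mul_lid unitaryD(1))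
    have shift: "nrm (cadj V ** A - cadj V ** B) = nrm (A - B)" for A B
      using nrm_unitary_mult(1)[of "cadj V" "A - B"] V by (simp add: matrix_mul_diff_distrib)
    have "real (card ((\<lambda>U. cadj V ** U) ` L V)) \<le> (1 + 4 / \<rho>) ^ (CARD('n)\<^sup>2)"
    proof (rule card_separated_local)
      show "nrm (mat 1 - W) < 1" if "W \<in> (\<lambda>U. cadj V ** U) ` L V" for W
        using that shift[of V] V by (auto simp: L_def unitaryD)
      show "\<rho> \<le> nrm (A - B)" if AB: "A \<in> (\<lambda>U. cadj V ** U) ` L V" "B \<in> (\<lambda>U. cadj V ** U) ` L V" "A \<noteq> B" for A B
      proof -
        obtain x y where xy: "x \<in> S" "y \<in> S" "A = cadj V ** x" "B = cadj V ** y"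
          using AB(1,2) unfolding L_def by blast
        with AB(3) have "x \<noteq> y" by auto
        thus ?thesis using sep[OF xy(1,2)] by (simp add: xy(3,4) shift)
      qed
    qed (use S V \<open>\<rho> > 0\<close> in \<open>auto simp: L_def unitary_mult\<close>)
    thus ?thesis by (simp add: card_image[OF inj])
  qed
  have "S \<subseteq> (\<Union>V\<in>T. L V)" using T(4) by (force simp: L_def)
  hence "card S \<le> card (\<Union>V\<in>T. L V)" by (rule card_mono[rotated]) (use T S in \<open>auto simp: L_def\<close>)
  also have "\<dots> \<le> (\<Sum>V\<in>T. card (L V))" by (rule card_UN_le) (rule T)
  finally have "real (card S) \<le> (\<Sum>V\<in>T. real (card (L V)))" by (metis of_nat_le_iff of_nat_sum)
  also have "\<dots> \<le> (\<Sum>V\<in>T. (1 + 4 / \<rho>) ^ (CARD('n)\<^sup>2))" by (intro sum_mono cL)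
  finally have 1: "real (card S) \<le> real (card T) * (1 + 4 / \<rho>) ^ (CARD('n)\<^sup>2)" by simp
  have "0 \<le> (1 + 4 / \<rho>) ^ (CARD('n)\<^sup>2)"
    using \<open>\<rho> > 0\<close> by (intro zero_le_power add_nonneg_nonneg) auto
  from order_trans[OF 1 mult_right_mono[OF cT this]]
  show ?thesis unfolding power_mult_distrib .
qed

section \<open>The moment operator as a contraction\<close>

locale unitary_measure = prob_space M for M :: "(complex^'n::finite^'n) measure" +
  assumes sets_eq [measurable_cong, simp]: "sets M = sets borel"
    and AE_unitary: "AE U in M. unitary U"
begin

text \<open>The measure lives on all matrices, where polynomials in the entries are unbounded; a
  bound at unitary matrices suffices because these carry the measure.\<close>

lemma integrable_bounded:
  fixes f :: "complex^'n^'n \<Rightarrow> 'b::{banach, second_countable_topology}"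
  assumes [measurable]: "f \<in> borel_measurable borel" and "\<And>U. unitary U \<Longrightarrow> norm (f U) \<le> B"
  shows "integrable M f"
  by (rule integrable_const_bound[of _ B]) (use AE_unitary assms(2) in auto)

lemma integrable_indicat [simp, intro]: "A \<in> sets borel \<Longrightarrow> integrable M (indicat_real A)"
  by (rule integrable_bounded[where B = 1]) (auto simp: indicator_def)

lemma integral_cong_unitary:
  fixes f g :: "complex^'n^'n \<Rightarrow> 'b::{banach, second_countable_topology}"
  assumes "f \<in> borel_measurable borel" "g \<in> borel_measurable borel"
    and "\<And>U. unitary U \<Longrightarrow> f U = g U"
  shows "integral\<^sup>L M f = integral\<^sup>L M g"
  by (rule integral_cong_AE) (use AE_unitary assms in auto)

end

lemma unitary_measureI:
  assumes "prob_on_unitaries M" shows "unitary_measure M"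
proof -
  interpret prob_space M using assms by (simp add: prob_on_unitaries_def)
  have e: "emeasure M {U. unitary U} = 1" using assms by (simp add: prob_on_unitaries_def)
  \<comment> \<open>A set outside the sigma-algebra has \<open>emeasure\<close> 0, so the value 1
    already certifies measurability.\<close>
  hence "{U. unitary U} \<in> sets M" using emeasure_notin_sets[of "{U. unitary U}" M] by fastforce
  hence "AE U in M. U \<in> {U. unitary U}" using e by (subst AE_in_set_eq_1) (auto simp: measure_def)
  thus ?thesis
    using assms by unfold_locales (auto simp: prob_on_unitaries_def)
qed

locale haar_measure = unitary_measure M for M :: "(complex^'n::finite^'n) measure" +
  assumes left_inv: "\<And>V. unitary V \<Longrightarrow> distr M borel (\<lambda>U. V ** U) = M"

lemma continuous_on_cadj [continuous_intros]:
  fixes f :: "'a::topological_space \<Rightarrow> complex^'n::finite^'n"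
  assumes "continuous_on S f" shows "continuous_on S (\<lambda>x. cadj (f x))"
  unfolding cadj_def by (intro continuous_intros assms)

lemma continuous_on_matrix_mult [continuous_intros]:
  fixes f g :: "'a::topological_space \<Rightarrow> complex^'n::finite^'n"
  assumes "continuous_on S f" "continuous_on S g" shows "continuous_on S (\<lambda>x. f x ** g x)"
  unfolding matrix_matrix_mult_def by (intro continuous_intros assms)

lemma measurable_matrix_mult [measurable]:
  fixes V :: "complex^'n::finite^'n"
  shows "(\<lambda>U :: complex^'n^'n. V ** U) \<in> borel \<rightarrow>\<^sub>M borel"
  using continuous_on_matrix_mult[of UNIV "\<lambda>_. V" "\<lambda>x. x"] continuous_on_const continuous_on_id
  by (intro borel_measurable_continuous_onI) simp

lemma measurable_cadj [measurable]:
  "(cadj :: complex^'n::finite^'n \<Rightarrow> _) \<in> borel \<rightarrow>\<^sub>M borel"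
  by (intro borel_measurable_continuous_onI continuous_intros continuous_on_id)

context haar_measure
begin

lemma integral_shift:
  fixes f :: "complex^'n^'n \<Rightarrow> 'b::{banach, second_countable_topology}"
  assumes [measurable]: "f \<in> borel_measurable borel" and "unitary V"
  shows "(\<integral>U. f (V ** U) \<partial>M) = integral\<^sup>L M f"
proof -
  have "integral\<^sup>L M f = integral\<^sup>L (distr M borel (\<lambda>U. V ** U)) f" using left_inv[OF assms(2)] by simp
  also have "\<dots> = (\<integral>U. f (V ** U) \<partial>M)" by (rule integral_distr) measurable
  finally show ?thesis by simp
qed

end

lemma haar_measureI: "haar_unitary M \<Longrightarrow> haar_measure M"
  by (simp add: haar_measure_def haar_measure_axioms_def haar_unitary_def unitary_measureI)

section \<open>Tensor powers of a matrix as arrays indexed by pairs of words\<close>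

type_synonym 'n tensor = "'n list \<times> 'n list \<Rightarrow> 'n list \<times> 'n list \<Rightarrow> complex"

definition tmat :: "nat \<Rightarrow> complex^'n^'n \<Rightarrow> 'n tensor" where
  "tmat t U a b = (\<Prod>k<t. U $ (fst a ! k) $ (fst b ! k)) * (\<Prod>k<t. cnj (U $ (snd a ! k) $ (snd b ! k)))"

lemma moment_op_tmat: "moment_op M t a b = (\<integral>U. tmat t U a b \<partial>M)"
  by (simp add: moment_op_def tmat_def split: prod.splits)

lemma tidx_eq: "tidx t = {is. length is = t} \<times> {js. length js = t}"
  by (auto simp: tidx_def)

lemma finite_words [simp]: "finite {is :: 'n::finite list. length is = t}"
  using finite_lists_length_eq[of "UNIV :: 'n set" t] by simp

lemma finite_tidx [simp]: "finite (tidx t)"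
  by (simp add: tidx_eq)

lemma sum_words_prod:
  fixes f :: "nat \<Rightarrow> 'n::finite \<Rightarrow> complex"
  shows "(\<Sum>ks | length ks = t. \<Prod>k<t. f k (ks ! k)) = (\<Prod>k<t. \<Sum>j\<in>UNIV. f k j)"
proof (induction t arbitrary: f)
  case 0
  have "{ks :: 'n list. length ks = 0} = {[]}" by auto
  thus ?case by simp
next
  case (Suc t)
  have eq: "{ks :: 'n list. length ks = Suc t} = (\<lambda>(x, xs). x # xs) ` (UNIV \<times> {ks. length ks = t})"
    by (auto simp: length_Suc_conv image_iff)
  have inj: "inj_on (\<lambda>(x, xs). x # xs) (UNIV \<times> {ks :: 'n list. length ks = t})"
    by (auto simp: inj_on_def)
  have "(\<Sum>ks | length ks = Suc t. \<Prod>k<Suc t. f k (ks ! k))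
      = (\<Sum>(x, xs)\<in>UNIV \<times> {ks. length ks = t}. f 0 x * (\<Prod>k<t. f (Suc k) (xs ! k)))"
    unfolding eq by (subst sum.reindex[OF inj]) (simp add: case_prod_unfold prod.lessThan_Suc_shift del: prod.lessThan_Suc)
  also have "\<dots> = (\<Sum>x\<in>UNIV. f 0 x) * (\<Sum>xs | length xs = t. \<Prod>k<t. f (Suc k) (xs ! k))"
    by (simp add: sum.cartesian_product[symmetric] sum_product)
  also have "\<dots> = (\<Prod>k<Suc t. \<Sum>j\<in>UNIV. f k j)"
    by (simp add: Suc.IH[of "\<lambda>k. f (Suc k)"] prod.lessThan_Suc_shift del: prod.lessThan_Suc)
  finally show ?case .
qed

text \<open>With \<open>tmat_cadj\<close> this makes \<open>tmat t\<close> a star-representation.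
  Sums over words factor letter by letter through \<open>sum_words_prod\<close>.\<close>

lemma tmat_mult: "tmat t (U ** V) a b = (\<Sum>c\<in>tidx t. tmat t U a c * tmat t V c b)"
proof -
  have 1: "(\<Prod>k<t. (U ** V) $ (i ! k) $ (j ! k))
      = (\<Sum>c | length c = t. (\<Prod>k<t. U $ (i ! k) $ (c ! k)) * (\<Prod>k<t. V $ (c ! k) $ (j ! k)))" for i j
    by (simp add: matrix_matrix_mult_def prod.distrib[symmetric]
        sum_words_prod[where t = t and f = "\<lambda>k c. U $ (i ! k) $ c * V $ c $ (j ! k)"])
  have 2: "(\<Prod>k<t. cnj ((U ** V) $ (i ! k) $ (j ! k)))
      = (\<Sum>c | length c = t. (\<Prod>k<t. cnj (U $ (i ! k) $ (c ! k))) * (\<Prod>k<t. cnj (V $ (c ! k) $ (j ! k))))" for i j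
    using arg_cong[OF 1[of i j], of cnj] by (simp del: vec_lambda_beta)
  show ?thesis
    unfolding tmat_def 1 2 tidx_eq
    by (simp add: sum_product sum.cartesian_product case_prod_unfold mult_ac)
qed

lemma tmat_cadj: "tmat t (cadj U) a b = cnj (tmat t U b a)"
  by (simp add: tmat_def mult.commute)

lemma cmod_tmat_le: "unitary U \<Longrightarrow> cmod (tmat t U a b) \<le> 1"
  unfolding tmat_def norm_mult prod_norm[symmetric]
  by (intro mult_le_one prod_le_1 prod_nonneg) (auto simp: cmod_entry_unitary)

lemma continuous_on_tmat: "continuous_on S (\<lambda>U. tmat t U a b)"
  unfolding tmat_def by (intro continuous_intros)

lemma measurable_tmat [measurable]: "(\<lambda>U. tmat t U a b) \<in> borel_measurable borel"
  by (intro borel_measurable_continuous_onI continuous_on_tmat)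

subsection \<open>Operator norm\<close>

lemma opnorm_bound:
  assumes "finite I" "opnorm I A \<le> \<delta>"
  shows "L2_set (\<lambda>i. cmod (\<Sum>j\<in>I. A i j * v j)) I \<le> \<delta> * L2_set (\<lambda>j. cmod (v j)) I"
proof -
  define X where "X = {sqrt (\<Sum>i\<in>I. (cmod (\<Sum>j\<in>I. A i j * v j))^2) | v. (\<Sum>j\<in>I. (cmod (v j))^2) \<le> 1}"
  \<comment> \<open>\<open>Sup\<close> dominates its elements only for a bounded set; the sum of all
    entry moduli is a crude bound.\<close>
  have bdd: "bdd_above X"
  proof (rule bdd_aboveI)
    fix x assume "x \<in> X"
    then obtain v where v: "x = L2_set (\<lambda>i. cmod (\<Sum>j\<in>I. A i j * v j)) I" "(\<Sum>j\<in>I. (cmod (v j))^2) \<le> 1"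
      by (auto simp: X_def L2_set_def)
    have vj: "cmod (v j) \<le> 1" if "j \<in> I" for j
    proof -
      have "(cmod (v j))\<^sup>2 \<le> (\<Sum>j\<in>I. (cmod (v j))^2)" using that assms(1) by (intro member_le_sum) auto
      hence "(cmod (v j))\<^sup>2 \<le> 1" using v(2) by simp
      thus ?thesis by (simp add: abs_square_le_1)
    qed
    have "x \<le> (\<Sum>i\<in>I. cmod (\<Sum>j\<in>I. A i j * v j))" unfolding v(1) by (rule L2_set_le_sum) simp
    also have "\<dots> \<le> (\<Sum>i\<in>I. \<Sum>j\<in>I. cmod (A i j))"
    proof (rule sum_mono)
      fix i
      show "cmod (\<Sum>j\<in>I. A i j * v j) \<le> (\<Sum>j\<in>I. cmod (A i j))"
        by (rule sum_norm_le) (use vj in \<open>auto simp: norm_mult intro: mult_left_le\<close>)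
    qed
    finally show "x \<le> (\<Sum>i\<in>I. \<Sum>j\<in>I. cmod (A i j))" .
  qed
  define s where "s = L2_set (\<lambda>j. cmod (v j)) I"
  show ?thesis
  proof (cases "s = 0")
    case True
    hence "\<And>j. j \<in> I \<Longrightarrow> v j = 0" using assms(1) by (simp add: s_def L2_set_eq_0_iff)
    thus ?thesis using True by (simp add: s_def[symmetric] L2_set_def)
  next
    case False
    hence s: "s > 0" using L2_set_nonneg[of "\<lambda>j. cmod (v j)" I] unfolding s_def by linarith
    define w where "w j = v j / complex_of_real s" for j
    have "(\<Sum>j\<in>I. (cmod (w j))^2) = (\<Sum>j\<in>I. (cmod (v j))^2) / s^2"
      using s by (simp add: w_def norm_divide power_divide sum_divide_distrib)
    also have "\<dots> = 1" using s by (simp add: s_def L2_set_def sum_nonneg)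
    finally have "L2_set (\<lambda>i. cmod (\<Sum>j\<in>I. A i j * w j)) I \<in> X"
      unfolding X_def L2_set_def by fastforce
    hence "L2_set (\<lambda>i. cmod (\<Sum>j\<in>I. A i j * w j)) I \<le> Sup X" by (rule cSup_upper[OF _ bdd])
    also have "\<dots> \<le> \<delta>" using assms(2) by (simp add: opnorm_def X_def)
    finally have "s * L2_set (\<lambda>i. cmod (\<Sum>j\<in>I. A i j * w j)) I \<le> s * \<delta>" using s by simp
    also have "s * L2_set (\<lambda>i. cmod (\<Sum>j\<in>I. A i j * w j)) I = L2_set (\<lambda>i. cmod (\<Sum>j\<in>I. A i j * v j)) I"
    proof -
      have "s * cmod (\<Sum>j\<in>I. A i j * w j) = cmod (\<Sum>j\<in>I. A i j * v j)" for i
      proof -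
        have "(\<Sum>j\<in>I. A i j * v j) = complex_of_real s * (\<Sum>j\<in>I. A i j * w j)"
          using s by (simp add: w_def sum_distrib_left)
        thus ?thesis using s by (simp add: norm_mult)
      qed
      thus ?thesis using s by (simp add: L2_set_right_distrib)
    qed
    finally show ?thesis by (simp add: s_def mult.commute)
  qed
qed

lemma opnorm_bound_nonneg:
  assumes "finite I" "I \<noteq> {}" "opnorm I A \<le> \<delta>"
  shows "0 \<le> \<delta>"
proof -
  have "0 \<le> \<delta> * L2_set (\<lambda>j. cmod 1) I"
    by (rule order_trans[OF L2_set_nonneg opnorm_bound[OF assms(1,3), of "\<lambda>_. 1"]])
  moreover have "0 < L2_set (\<lambda>j. cmod 1) I" using assms(1,2) by (simp add: L2_set_def card_gt_0_iff)
  ultimately show ?thesis by (simp only: zero_le_mult_iff) auto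
qed

lemma tidx_nonempty: "tidx t \<noteq> {}"
  using Ex_list_of_length[of t] by (auto simp: tidx_def)

text \<open>For w = A^* v, the square of the norm of w is the pairing of v with A w, hence at most
  \<delta> times the product of the norms of v and w; divide by the norm of w.\<close>

lemma opnorm_adj_bound:
  assumes "finite I" "opnorm I A \<le> \<delta>"
  shows "L2_set (\<lambda>i. cmod (\<Sum>j\<in>I. cnj (A j i) * v j)) I \<le> \<delta> * L2_set (\<lambda>j. cmod (v j)) I"
proof -
  define w where "w i = (\<Sum>j\<in>I. cnj (A j i) * v j)" for i
  define s where "s = L2_set (\<lambda>i. cmod (w i)) I"
  have "complex_of_real (s\<^sup>2) = (\<Sum>i\<in>I. cnj (w i) * w i)"
    by (simp add: s_def L2_set_def sum_nonneg complex_norm_square mult.commute del: of_real_power)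
  also have "\<dots> = (\<Sum>i\<in>I. \<Sum>j\<in>I. cnj (v j) * (A j i * w i))"
    by (subst (1) w_def, simp only: cnj_sum complex_cnj_mult complex_cnj_cnj sum_distrib_right)
       (simp only: mult_ac)
  also have "\<dots> = (\<Sum>j\<in>I. cnj (v j) * (\<Sum>i\<in>I. A j i * w i))"
    by (subst sum.swap) (simp add: sum_distrib_left)
  finally have "s\<^sup>2 = cmod (\<Sum>j\<in>I. cnj (v j) * (\<Sum>i\<in>I. A j i * w i))"
    by (metis norm_of_real abs_of_nonneg zero_le_power2)
  also have "\<dots> \<le> (\<Sum>j\<in>I. \<bar>cmod (v j)\<bar> * \<bar>cmod (\<Sum>i\<in>I. A j i * w i)\<bar>)"
    by (rule sum_norm_le) (simp add: norm_mult)
  also have "\<dots> \<le> L2_set (\<lambda>j. cmod (v j)) I * L2_set (\<lambda>j. cmod (\<Sum>i\<in>I. A j i * w i)) I"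
    by (rule L2_set_mult_ineq)
  also have "\<dots> \<le> L2_set (\<lambda>j. cmod (v j)) I * (\<delta> * s)"
    unfolding s_def by (intro mult_left_mono opnorm_bound assms L2_set_nonneg)
  finally have "s * s \<le> (\<delta> * L2_set (\<lambda>j. cmod (v j)) I) * s" by (simp add: power2_eq_square mult_ac)
  moreover have "0 \<le> s" by (simp add: s_def)
  moreover have "0 \<le> \<delta> * L2_set (\<lambda>j. cmod (v j)) I"
    using opnorm_bound[OF assms, of v] by (rule order_trans[rotated]) simp
  ultimately have "s \<le> \<delta> * L2_set (\<lambda>j. cmod (v j)) I"
    by (cases "s = 0") auto
  thus ?thesis by (simp add: s_def w_def)
qed

text \<open>A spectral radius argument: growth of the powers of a positive operator controls its norm.\<close>

lemma power_growth_bound: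
  fixes a :: "nat \<Rightarrow> real"
  assumes nonneg: "\<And>k. a k \<ge> 0" and conv: "\<And>k. (a k)\<^sup>2 \<le> a 0 * a (2 * k)"
    and growth: "\<And>k. a k \<le> K * q ^ k" and "q \<ge> 0"
  shows "a 1 \<le> q * a 0"
proof (cases "a 0 = 0 \<or> q = 0")
  case True
  thus ?thesis
  proof
    assume "a 0 = 0" thus ?thesis using conv[of 1] by simp
  next
    assume "q = 0" thus ?thesis using growth[of 1] by simp
  qed
next
  case False
  hence pos: "a 0 > 0" "q > 0" using nonneg[of 0] \<open>q \<ge> 0\<close> by auto
  \<comment> \<open>Iterating \<open>conv\<close> along powers of two is repeated
    Cauchy-Schwarz.\<close>
  have it: "a 1 ^ (2 ^ j) \<le> a 0 ^ (2 ^ j - 1) * a (2 ^ j)" for j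
  proof (induction j)
    case (Suc j)
    have "a 1 ^ (2 ^ Suc j) = (a 1 ^ (2 ^ j))\<^sup>2" by (simp add: power_mult[symmetric] mult.commute)
    also have "\<dots> \<le> (a 0 ^ (2 ^ j - 1) * a (2 ^ j))\<^sup>2"
      using Suc.IH nonneg by (intro power_mono) auto
    also have "\<dots> = (a 0 ^ (2 ^ j - 1))\<^sup>2 * (a (2 ^ j))\<^sup>2" by (simp add: power_mult_distrib)
    also have "\<dots> \<le> (a 0 ^ (2 ^ j - 1))\<^sup>2 * (a 0 * a (2 * 2 ^ j))"
      using conv[of "2 ^ j"] by (intro mult_left_mono) auto
    also have "\<dots> = a 0 ^ (Suc ((2 ^ j - 1) * 2)) * a (2 ^ Suc j)" by (simp add: power_mult[symmetric] mult_ac)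
    also have "Suc ((2 ^ j - 1) * 2) = 2 ^ Suc j - (1::nat)"
    proof -
      obtain m where "(2::nat) ^ j = Suc m" by (cases "(2::nat) ^ j") auto
      thus ?thesis by simp
    qed
    finally show ?case .
  qed simp
  \<comment> \<open>The powers of this ratio along 2^j stay below a fixed multiple of
    \<open>K\<close>. A ratio above 1 would make them unbounded, so \<open>K\<close> drops
    out.\<close>
  define r where "r = a 1 / (q * a 0)"
  have bd: "r ^ (2 ^ j) \<le> K / a 0" for j
  proof -
    have "a 1 ^ (2 ^ j) \<le> a 0 ^ (2 ^ j - 1) * (K * q ^ (2 ^ j))"
      using it[of j] growth[of "2 ^ j"] pos by (meson mult_left_mono order_trans zero_le_power less_imp_le)
    also have "\<dots> = (q * a 0) ^ (2 ^ j) * (K / a 0)"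
    proof -
      have "a 0 ^ (2 ^ j) = a 0 * a 0 ^ (2 ^ j - 1)" by (metis power_eq_if power_not_zero zero_neq_numeral)
      thus ?thesis using pos by (simp add: power_mult_distrib field_simps)
    qed
    finally show ?thesis using pos by (simp add: r_def power_divide divide_le_eq mult.commute)
  qed
  have "r \<le> 1"
  proof (rule ccontr)
    assume "\<not> r \<le> 1"
    then obtain n where n: "K / a 0 < r ^ n" using real_arch_pow[of r "K / a 0"] by auto
    have "r ^ n \<le> r ^ (2 ^ n)" using \<open>\<not> r \<le> 1\<close> by (intro power_increasing) (auto simp: less_imp_le)
    thus False using n bd[of n] by simp
  qed
  thus ?thesis using pos by (simp add: r_def divide_le_eq)
qed

lemma measurable_cnj [measurable]:
  "f \<in> borel_measurable M \<Longrightarrow> (\<lambda>x. cnj (f x)) \<in> borel_measurable M"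
  by (rule measurable_compose[of f M borel cnj])
     (auto intro!: borel_measurable_continuous_onI continuous_on_cnj continuous_on_id)

lemma (in unitary_measure) integrable_tmat: "integrable M (\<lambda>U. tmat t U a b)"
  by (rule integrable_bounded[where B = 1]) (simp_all add: cmod_tmat_le)

lemma (in unitary_measure) cauchy_schwarz_integral:
  fixes f g :: "complex^'n^'n \<Rightarrow> complex"
  assumes [measurable]: "f \<in> borel_measurable borel" "g \<in> borel_measurable borel"
    and f: "\<And>U. unitary U \<Longrightarrow> cmod (f U) \<le> B" and g: "\<And>U. unitary U \<Longrightarrow> cmod (g U) \<le> C"
  shows "(cmod (\<integral>U. f U * cnj (g U) \<partial>M))\<^sup>2 \<le> (\<integral>U. (cmod (f U))\<^sup>2 \<partial>M) * (\<integral>U. (cmod (g U))\<^sup>2 \<partial>M)"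
proof -
  define a b c where "a = (\<integral>U. (cmod (f U))\<^sup>2 \<partial>M)" "b = (\<integral>U. cmod (f U) * cmod (g U) \<partial>M)"
    "c = (\<integral>U. (cmod (g U))\<^sup>2 \<partial>M)"
  have i1: "integrable M (\<lambda>U. (cmod (f U))\<^sup>2)"
    by (rule integrable_bounded[where B = "B\<^sup>2"]) (use f in \<open>auto intro: power_mono\<close>)
  have i2: "integrable M (\<lambda>U. (cmod (g U))\<^sup>2)"
    by (rule integrable_bounded[where B = "C\<^sup>2"]) (use g in \<open>auto intro: power_mono\<close>)
  have i3: "integrable M (\<lambda>U. cmod (f U) * cmod (g U))"
    by (rule integrable_bounded[where B = "B * C"])
       (use f g in \<open>auto intro!: mult_mono intro: order_trans[OF norm_ge_zero]\<close>)
  have quad: "0 \<le> s\<^sup>2 * a - 2 * s * b + c" for s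
  proof -
    have "0 \<le> (\<integral>U. (s * cmod (f U) - cmod (g U))\<^sup>2 \<partial>M)" by simp
    also have "\<dots> = (\<integral>U. s\<^sup>2 * (cmod (f U))\<^sup>2 - 2 * s * (cmod (f U) * cmod (g U)) + (cmod (g U))\<^sup>2 \<partial>M)"
      by (intro Bochner_Integration.integral_cong) (auto simp: power2_diff power_mult_distrib)
    also have "\<dots> = s\<^sup>2 * a - 2 * s * b + c"
      using i1 i2 i3 by (simp add: a_b_c_def)
    finally show ?thesis .
  qed
  have a0: "a \<ge> 0" and b0: "b \<ge> 0" by (simp_all add: a_b_c_def)
  have "b\<^sup>2 \<le> a * c"
  proof (cases "a = 0")
    case True
    have "b = 0"
    proof (rule ccontr)
      assume "b \<noteq> 0"
      \<comment> \<open>With \<open>a = 0\<close> the quadratic is affine in \<open>s\<close>, and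
        this \<open>s\<close> gives it the value -1.\<close>
      thus False using quad[of "(c + 1) / (2 * b)"] True by (simp add: field_simps)
    qed
    thus ?thesis using True by simp
  next
    case False
    hence "0 \<le> a * ((b/a)\<^sup>2 * a - 2 * (b/a) * b + c)" using quad[of "b/a"] a0 by simp
    also have "\<dots> = a * c - b\<^sup>2" using False by (simp add: field_simps power2_eq_square)
    finally show ?thesis by simp
  qed
  moreover have "cmod (\<integral>U. f U * cnj (g U) \<partial>M) \<le> b"
    unfolding a_b_c_def using integral_norm_bound[of M "\<lambda>U. f U * cnj (g U)"] by (simp add: norm_mult)
  ultimately show ?thesis unfolding a_b_c_def by (meson norm_ge_zero order_trans power_mono)
qed

text \<open>Left translation of the function \<open>ev t Y\<close> by \<open>V\<close> is right multiplication of its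
  coefficients by \<open>tmat t V\<close>, so convolution with \<open>\<nu>\<close> becomes multiplication by the moment
  operator.\<close>

definition ev :: "nat \<Rightarrow> 'n::finite tensor \<Rightarrow> complex^'n^'n \<Rightarrow> complex" where
  "ev t Y x = (\<Sum>a\<in>tidx t. \<Sum>c\<in>tidx t. Y a c * tmat t (cadj x) a c)"

text \<open>\<open>B\<close> acts on each row of \<open>Y\<close> as on a column vector (so by its
  transpose from the right), which lets \<open>opnorm\<close> bounds apply row by row.\<close>

definition rmul :: "nat \<Rightarrow> 'n::finite tensor \<Rightarrow> 'n tensor \<Rightarrow> 'n tensor" where
  "rmul t Y B = (\<lambda>a c. \<Sum>b\<in>tidx t. Y a b * B c b)"

lemma ev_rmul: "ev t (rmul t Y B) x =
    (\<Sum>c\<in>tidx t. \<Sum>b\<in>tidx t. B c b * (\<Sum>a\<in>tidx t. Y a b * tmat t (cadj x) a c))"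
proof -
  have "ev t (rmul t Y B) x =
      (\<Sum>a\<in>tidx t. \<Sum>c\<in>tidx t. \<Sum>b\<in>tidx t. B c b * (Y a b * tmat t (cadj x) a c))"
    by (simp add: ev_def rmul_def sum_distrib_right) (simp add: mult_ac)
  also have "\<dots> = (\<Sum>c\<in>tidx t. \<Sum>a\<in>tidx t. \<Sum>b\<in>tidx t. B c b * (Y a b * tmat t (cadj x) a c))"
    by (rule sum.swap)
  also have "\<dots> = (\<Sum>c\<in>tidx t. \<Sum>b\<in>tidx t. \<Sum>a\<in>tidx t. B c b * (Y a b * tmat t (cadj x) a c))"
    by (intro sum.cong refl sum.swap)
  finally show ?thesis by (simp add: sum_distrib_left)
qed

lemma ev_rmul_tmat: "ev t (rmul t Y (tmat t V)) x = ev t Y (cadj V ** x)"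
proof -
  have "ev t (rmul t Y (tmat t V)) x =
      (\<Sum>a\<in>tidx t. \<Sum>c\<in>tidx t. \<Sum>b\<in>tidx t. Y a b * (tmat t (cadj x) a c * tmat t V c b))"
    by (simp add: ev_def rmul_def sum_distrib_right) (simp add: mult_ac)
  also have "\<dots> = (\<Sum>a\<in>tidx t. \<Sum>b\<in>tidx t. \<Sum>c\<in>tidx t. Y a b * (tmat t (cadj x) a c * tmat t V c b))"
    by (intro sum.cong refl sum.swap)
  also have "\<dots> = ev t Y (cadj V ** x)"
    by (simp add: ev_def cadj_mult tmat_mult sum_distrib_left)
  finally show ?thesis .
qed

lemma measurable_ev [measurable]: "ev t Y \<in> borel_measurable borel"
  unfolding ev_def[abs_def]
  by (intro borel_measurable_sum borel_measurable_times borel_measurable_const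
      measurable_compose[OF measurable_cadj measurable_tmat])

lemma ev_bound: "unitary x \<Longrightarrow> cmod (ev t Y x) \<le> (\<Sum>a\<in>tidx t. \<Sum>c\<in>tidx t. cmod (Y a c))"
  unfolding ev_def
  by (intro sum_norm_le order_trans[OF norm_sum] sum_mono)
     (auto simp: norm_mult cmod_tmat_le intro!: mult_left_le)

section \<open>The contraction estimate in L2(\<mu>)\<close>

locale haar_pair = haar_measure \<mu> + N: unitary_measure \<nu>
  for \<mu> \<nu> :: "(complex^'n::finite^'n) measure"
begin

text \<open>The L2(\<mu>) inner product carried over to coefficients. It is degenerate in general,
  since the entries of \<open>tmat t\<close> satisfy linear relations on the unitary group.\<close>

definition ip :: "nat \<Rightarrow> 'n tensor \<Rightarrow>
    'n tensor \<Rightarrow> complex" where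
  "ip t Y Z = (\<integral>x. ev t Y x * cnj (ev t Z x) \<partial>\<mu>)"

definition dif :: "nat \<Rightarrow> 'n tensor" where
  "dif t a b = moment_op \<nu> t a b - moment_op \<mu> t a b"

abbreviation "adj B \<equiv> (\<lambda>a b. cnj (B b a))"

lemma ip_cnj: "ip t Z Y = cnj (ip t Y Z)"
  unfolding ip_def using Bochner_Integration.integral_cnj[of \<mu> "\<lambda>x. ev t Y x * cnj (ev t Z x)"] by (simp add: mult.commute)

lemma ip_self: "ip t Y Y = complex_of_real (\<integral>x. (cmod (ev t Y x))\<^sup>2 \<partial>\<mu>)"
  unfolding ip_def by (simp add: complex_norm_square[symmetric] del: of_real_power)

text \<open>Integrals against \<open>ev\<close> are linear functionals of the finitely many entries
  of \<open>B\<close>. An identity checked for \<open>B = tmat t V\<close> therefore integrates to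
  the moment operators without exchanging two integrals.\<close>

lemma integral_ev_rmul_linear:
  assumes b [measurable]: "b \<in> borel_measurable borel" and bC: "\<And>x. unitary x \<Longrightarrow> cmod (b x) \<le> C"
  shows "\<exists>w. \<forall>B. (\<integral>x. b x * ev t (rmul t Y B) x \<partial>\<mu>) = (\<Sum>c\<in>tidx t. \<Sum>d\<in>tidx t. B c d * w c d)"
proof -
  define h where "h c d x = b x * (\<Sum>a\<in>tidx t. Y a d * tmat t (cadj x) a c)" for c d x
  have [measurable]: "h c d \<in> borel_measurable borel" for c d
    unfolding h_def[abs_def]
    by (intro borel_measurable_sum borel_measurable_times borel_measurable_const b
      measurable_compose[OF measurable_cadj measurable_tmat])
  have int: "integrable \<mu> (h c d)" for c d
  proof (rule integrable_bounded)
    show "cmod (h c d x) \<le> C * (\<Sum>a\<in>tidx t. cmod (Y a d))" if "unitary x" for x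
      unfolding h_def norm_mult
      using that bC order_trans[OF norm_ge_zero bC[OF that]] by (intro mult_mono sum_norm_le norm_ge_zero)
        (auto simp: norm_mult cmod_tmat_le intro!: mult_left_le)
  qed measurable
  have "(\<integral>x. b x * ev t (rmul t Y B) x \<partial>\<mu>) = (\<Sum>c\<in>tidx t. \<Sum>d\<in>tidx t. B c d * integral\<^sup>L \<mu> (h c d))" for B
  proof -
    have "(\<integral>x. b x * ev t (rmul t Y B) x \<partial>\<mu>) = (\<integral>x. (\<Sum>c\<in>tidx t. \<Sum>d\<in>tidx t. B c d * h c d x) \<partial>\<mu>)"
      unfolding ev_rmul h_def by (simp add: sum_distrib_left mult_ac)
    also have "\<dots> = (\<Sum>c\<in>tidx t. \<Sum>d\<in>tidx t. B c d * integral\<^sup>L \<mu> (h c d))"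
      using int by (simp add: Bochner_Integration.integral_sum integrable_sum)
    finally show ?thesis .
  qed
  thus ?thesis by (intro exI[of _ "\<lambda>c d. integral\<^sup>L \<mu> (h c d)"]) simp
qed

lemma ip_rmul_linear: "\<exists>w. \<forall>B. ip t (rmul t Y B) Z = (\<Sum>c\<in>tidx t. \<Sum>d\<in>tidx t. B c d * w c d)"
proof -
  have "\<exists>w. \<forall>B. (\<integral>x. cnj (ev t Z x) * ev t (rmul t Y B) x \<partial>\<mu>) = (\<Sum>c\<in>tidx t. \<Sum>d\<in>tidx t. B c d * w c d)"
    by (rule integral_ev_rmul_linear) (auto intro: ev_bound)
  thus ?thesis by (simp add: ip_def mult.commute)
qed

text \<open>Substitute V^* x for x: left translation is unitary on L2(\<mu>) and its adjoint is the
  inverse translation.\<close>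

lemma ip_shift:
  assumes "unitary V"
  shows "ip t (rmul t Y (tmat t V)) Z = ip t Y (rmul t Z (adj (tmat t V)))"
proof -
  have a: "adj (tmat t V) = tmat t (cadj V)" by (simp add: fun_eq_iff tmat_cadj)
  have "ip t Y (rmul t Z (adj (tmat t V))) = (\<integral>x. ev t Y x * cnj (ev t Z (V ** x)) \<partial>\<mu>)"
    unfolding ip_def a ev_rmul_tmat by simp
  also have "\<dots> = (\<integral>x. ev t Y (cadj V ** x) * cnj (ev t Z (V ** (cadj V ** x))) \<partial>\<mu>)"
    by (rule integral_shift[symmetric])
       (use assms in \<open>auto intro!: measurable_compose[OF measurable_matrix_mult measurable_ev]\<close>)
  also have "\<dots> = ip t (rmul t Y (tmat t V)) Z"
    unfolding ip_def ev_rmul_tmat by (simp add: matrix_mul_assoc unitaryD(1)[OF assms])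
  finally show ?thesis by simp
qed

text \<open>The defect of the identity, \<open>L B\<close>, is linear in \<open>B\<close>, as the
  two conjugations in the second term cancel. It vanishes at every \<open>tmat t V\<close> by
  \<open>ip_shift\<close>, hence at both moment operators, which are averages of these, and so at
  their difference.\<close>

lemma ip_dif_adj: "ip t (rmul t Y (dif t)) Z = ip t Y (rmul t Z (adj (dif t)))"
proof -
  obtain w1 where w1: "\<And>B. ip t (rmul t Y B) Z = (\<Sum>c\<in>tidx t. \<Sum>b\<in>tidx t. B c b * w1 c b)"
    using ip_rmul_linear[of t Y Z] by blast
  obtain w2 where w2: "\<And>B. ip t (rmul t Z B) Y = (\<Sum>c\<in>tidx t. \<Sum>b\<in>tidx t. B c b * w2 c b)"
    using ip_rmul_linear[of t Z Y] by blast
  define L where "L B = (\<Sum>c\<in>tidx t. \<Sum>b\<in>tidx t. B c b * (w1 c b - cnj (w2 b c)))" for B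
  have L: "ip t (rmul t Y B) Z - ip t Y (rmul t Z (adj B)) = L B" for B
  proof -
    have "ip t Y (rmul t Z (adj B)) = (\<Sum>c\<in>tidx t. \<Sum>b\<in>tidx t. B b c * cnj (w2 c b))"
      by (subst ip_cnj) (simp add: w2)
    also have "\<dots> = (\<Sum>c\<in>tidx t. \<Sum>b\<in>tidx t. B c b * cnj (w2 b c))" by (rule sum.swap)
    finally show ?thesis by (simp add: w1 L_def sum_subtractf right_diff_distrib)
  qed
  have L0: "L (moment_op N' t) = 0" if "unitary_measure N'" for N'
  proof -
    interpret N': unitary_measure N' by fact
    have "L (moment_op N' t) = (\<integral>V. L (tmat t V) \<partial>N')"
      unfolding L_def moment_op_tmat using N'.integrable_tmat
      by (simp add: Bochner_Integration.integral_sum integrable_sum)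
    also have "\<dots> = (\<integral>V. 0 \<partial>N')"
    proof (rule N'.integral_cong_unitary)
      show "L (tmat t V) = 0" if "unitary V" for V using L[of "tmat t V"] ip_shift[OF that] by simp
    qed (auto simp: L_def)
    finally show ?thesis by simp
  qed
  have "L (dif t) = L (moment_op \<nu> t) - L (moment_op \<mu> t)"
    by (simp add: L_def dif_def left_diff_distrib sum_subtractf)
  thus ?thesis
    using L[of "dif t"] L0[OF unitary_measure_axioms] L0[OF N.unitary_measure_axioms] by simp
qed

text \<open>The positive operator D^* D, where D is multiplication by \<open>dif\<close>; its powers
  feed the spectral radius argument.\<close>

definition sq :: "nat \<Rightarrow> 'n tensor \<Rightarrow> 'n tensor" where
  "sq t Y = rmul t (rmul t Y (dif t)) (adj (dif t))"

lemma ip_adj_dif: "ip t (rmul t Y (adj (dif t))) Z = ip t Y (rmul t Z (dif t))"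
  by (metis ip_cnj ip_dif_adj)

lemma ip_sq: "ip t (sq t Y) Z = ip t Y (sq t Z)"
  by (simp add: sq_def ip_adj_dif ip_dif_adj)

lemma ip_sq_power: "ip t ((sq t ^^ k) Y) Z = ip t Y ((sq t ^^ k) Z)"
  by (induction k arbitrary: Y Z) (simp_all add: ip_sq funpow_swap1)

definition nsq where "nsq t Y = (\<integral>x. (cmod (ev t Y x))\<^sup>2 \<partial>\<mu>)"

lemma ip_cauchy_schwarz: "(cmod (ip t Y Z))\<^sup>2 \<le> nsq t Y * nsq t Z"
  unfolding ip_def nsq_def by (rule cauchy_schwarz_integral) (auto intro: ev_bound)

lemma row_sq_power_bound:
  assumes "opnorm (tidx t) (dif t) \<le> \<delta>"
  shows "L2_set (\<lambda>c. cmod ((sq t ^^ k) Y a c)) (tidx t) \<le> \<delta> ^ (2 * k) * L2_set (\<lambda>c. cmod (Y a c)) (tidx t)"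
proof (induction k)
  case (Suc k)
  have d: "0 \<le> \<delta>" by (rule opnorm_bound_nonneg[OF finite_tidx tidx_nonempty assms])
  let ?Y = "(sq t ^^ k) Y" and ?I = "tidx t :: ('n list \<times> 'n list) set"
  have "L2_set (\<lambda>c. cmod ((sq t ^^ Suc k) Y a c)) ?I
      = L2_set (\<lambda>c. cmod (\<Sum>b\<in>?I. cnj (dif t b c) * (\<Sum>e\<in>?I. dif t b e * ?Y a e))) ?I"
    by (simp add: sq_def rmul_def mult.commute)
  also have "\<dots> \<le> \<delta> * L2_set (\<lambda>b. cmod (\<Sum>e\<in>?I. dif t b e * ?Y a e)) ?I"
    by (rule opnorm_adj_bound) (use assms in auto)
  also have "\<dots> \<le> \<delta> * (\<delta> * L2_set (\<lambda>c. cmod (?Y a c)) ?I)"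
    by (intro mult_left_mono opnorm_bound assms finite_tidx d)
  also have "\<dots> \<le> \<delta> * (\<delta> * (\<delta> ^ (2 * k) * L2_set (\<lambda>c. cmod (Y a c)) ?I))"
    by (intro mult_left_mono Suc.IH d)
  finally show ?case by (simp add: mult_ac)
qed simp

text \<open>The price of comparing L2(\<mu>) with the Euclidean norms of the rows is
  \<open>K\<close>, which depends on \<open>Y\<close> and on the index set but not on
  \<open>k\<close>.\<close>

lemma nsq_sq_power_bound:
  assumes "opnorm (tidx t) (dif t) \<le> \<delta>"
  shows "\<exists>K. \<forall>k. nsq t ((sq t ^^ k) Y) \<le> K * (\<delta> ^ 4) ^ k"
proof -
  let ?I = "tidx t :: ('n list \<times> 'n list) set"
  define K where "K = (\<Sum>a\<in>?I. \<Sum>c\<in>?I. L2_set (\<lambda>c. cmod (Y a c)) ?I)"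
  have "nsq t ((sq t ^^ k) Y) \<le> K\<^sup>2 * (\<delta> ^ 4) ^ k" for k
  proof -
    have "cmod (ev t ((sq t ^^ k) Y) x) \<le> \<delta> ^ (2 * k) * K" if "unitary x" for x
    proof -
      have "cmod (ev t ((sq t ^^ k) Y) x) \<le> (\<Sum>a\<in>?I. \<Sum>c\<in>?I. cmod ((sq t ^^ k) Y a c))"
        by (rule ev_bound) fact
      also have "\<dots> \<le> (\<Sum>a\<in>?I. \<Sum>c\<in>?I. \<delta> ^ (2 * k) * L2_set (\<lambda>c. cmod (Y a c)) ?I)"
        by (intro sum_mono order_trans[OF member_le_L2_set row_sq_power_bound[OF assms]]) auto
      finally show ?thesis by (simp add: K_def sum_distrib_left mult_ac)
    qed
    hence "(cmod (ev t ((sq t ^^ k) Y) x))\<^sup>2 \<le> (\<delta> ^ (2 * k) * K)\<^sup>2" if "unitary x" for x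
      using that by (intro power_mono) auto
    hence "nsq t ((sq t ^^ k) Y) \<le> (\<integral>x. (\<delta> ^ (2 * k) * K)\<^sup>2 \<partial>\<mu>)"
      unfolding nsq_def
      by (intro integral_mono_AE integrable_bounded[where B = "(\<delta> ^ (2 * k) * K)\<^sup>2"] integrable_const)
         (use AE_unitary in auto)
    also have "\<dots> = K\<^sup>2 * (\<delta> ^ 4) ^ k"
      by (simp add: prob_space power_mult_distrib power_mult[symmetric] mult.commute)
    finally show ?thesis .
  qed
  thus ?thesis by blast
qed

text \<open>\<open>power_growth_bound\<close> removes \<open>K\<close> and bounds D^* D by
  \<delta>^2 in L2(\<mu>). Since the squared norm of D Y is the pairing of Y with D^* D Y,
  Cauchy-Schwarz bounds D by \<delta>.\<close>

lemma expander_contraction: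
  assumes "opnorm (tidx t) (dif t) \<le> \<delta>" "0 \<le> \<delta>"
  shows "nsq t (rmul t Y (dif t)) \<le> \<delta>\<^sup>2 * nsq t Y"
proof -
  have nn: "0 \<le> nsq t Z" for Z by (simp add: nsq_def)
  have ips: "cmod (ip t Z Z) = nsq t Z" for Z using nn[of Z] by (simp add: ip_self nsq_def)
  obtain K where K: "\<And>k. nsq t ((sq t ^^ k) Y) \<le> K * (\<delta> ^ 4) ^ k"
    using nsq_sq_power_bound[OF assms(1)] by blast
  have "nsq t ((sq t ^^ 1) Y) \<le> \<delta> ^ 4 * nsq t ((sq t ^^ 0) Y)"
  proof (rule power_growth_bound[where a = "\<lambda>k. nsq t ((sq t ^^ k) Y)" and K = K])
    show "(nsq t ((sq t ^^ k) Y))\<^sup>2 \<le> nsq t ((sq t ^^ 0) Y) * nsq t ((sq t ^^ (2 * k)) Y)" for k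
    proof -
      have "nsq t ((sq t ^^ k) Y) = cmod (ip t Y ((sq t ^^ (2 * k)) Y))"
        unfolding ips[symmetric] ip_sq_power by (simp add: mult_2 funpow_add)
      thus ?thesis using ip_cauchy_schwarz[of t Y "(sq t ^^ (2 * k)) Y"] by simp
    qed
  qed (use K nn assms in auto)
  hence 1: "nsq t (sq t Y) \<le> \<delta> ^ 4 * nsq t Y" by simp
  have "nsq t (rmul t Y (dif t)) = cmod (ip t Y (sq t Y))"
    unfolding ips[symmetric] ip_dif_adj sq_def ..
  hence "(nsq t (rmul t Y (dif t)))\<^sup>2 \<le> nsq t Y * nsq t (sq t Y)"
    using ip_cauchy_schwarz[of t Y "sq t Y"] by simp
  also have "\<dots> \<le> nsq t Y * (\<delta> ^ 4 * nsq t Y)" by (intro mult_left_mono 1 nn)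
  also have "\<dots> = (\<delta>\<^sup>2 * nsq t Y)\<^sup>2" by (simp add: power2_eq_square power4_eq_xxxx mult_ac)
  finally show ?thesis by (rule power2_le_imp_le) (use nn in simp)
qed

end

section \<open>Truncated power functions of the trace\<close>

text \<open>Up to equality on the unitary group, \<open>rep t\<close> is the span of the matrix entries of
  \<open>U\<^sup>\<otimes>\<^sup>t \<otimes> cnj U\<^sup>\<otimes>\<^sup>t\<close>.\<close>

inductive rep :: "nat \<Rightarrow> (complex^'n::finite^'n \<Rightarrow> complex) \<Rightarrow> bool" for t where
  base: "a \<in> tidx t \<Longrightarrow> b \<in> tidx t \<Longrightarrow> rep t (\<lambda>U. tmat t U a b)"
| add: "rep t f \<Longrightarrow> rep t g \<Longrightarrow> rep t (\<lambda>U. f U + g U)"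
| scale: "rep t f \<Longrightarrow> rep t (\<lambda>U. c * f U)"
| cong: "rep t f \<Longrightarrow> (\<And>U. unitary U \<Longrightarrow> f U = g U) \<Longrightarrow> rep t g"

lemma rep_coeff:
  assumes "rep t f"
  shows "\<exists>X. \<forall>U. unitary U \<longrightarrow> f U = (\<Sum>a\<in>tidx t. \<Sum>b\<in>tidx t. X a b * tmat t U a b)"
  using assms
proof induction
  case (base a b)
  define X where "X a' b' = (if a' = a then if b' = b then 1 else 0 else (0::complex))" for a' b'
  have row: "(\<Sum>b'\<in>tidx t. X a' b' * tmat t U a' b') = (if a' = a then tmat t U a b else 0)"
    for a' and U :: "complex^'a^'a"
  proof (cases "a' = a")
    case True
    have "(\<Sum>b'\<in>tidx t. X a' b' * tmat t U a' b') = (\<Sum>b'\<in>tidx t. if b' = b then tmat t U a' b' else 0)"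
      by (rule sum.cong[OF refl]) (simp add: X_def True)
    thus ?thesis using base True by (simp only: sum.delta[OF finite_tidx] if_True simp_thms)
  qed (simp add: X_def)
  have "(\<Sum>a'\<in>tidx t. \<Sum>b'\<in>tidx t. X a' b' * tmat t U a' b') = tmat t U a b" for U :: "complex^'a^'a"
    unfolding row sum.delta[OF finite_tidx] using base by (simp only: if_True)
  thus ?case by (intro exI[of _ X]) simp
next
  case (add f g)
  then obtain X Y where "\<forall>U. unitary U \<longrightarrow> f U = (\<Sum>a\<in>tidx t. \<Sum>b\<in>tidx t. X a b * tmat t U a b)"
    "\<forall>U. unitary U \<longrightarrow> g U = (\<Sum>a\<in>tidx t. \<Sum>b\<in>tidx t. Y a b * tmat t U a b)" by blast
  thus ?case
    by (intro exI[of _ "\<lambda>a b. X a b + Y a b"]) (simp add: distrib_right sum.distrib)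
next
  case (scale f c)
  then obtain X where "\<forall>U. unitary U \<longrightarrow> f U = (\<Sum>a\<in>tidx t. \<Sum>b\<in>tidx t. X a b * tmat t U a b)" by blast
  thus ?case
    by (intro exI[of _ "\<lambda>a b. c * X a b"]) (simp add: sum_distrib_left mult.assoc)
next
  case (cong f g)
  from cong.IH obtain X where "\<forall>U. unitary U \<longrightarrow> f U = (\<Sum>a\<in>tidx t. \<Sum>b\<in>tidx t. X a b * tmat t U a b)" ..
  thus ?case using cong.hyps(2) by (intro exI[of _ X]) simp
qed

lemma rep_zero: "rep t (\<lambda>U :: complex^'n::finite^'n. 0)"
proof -
  obtain w :: "'n list" where "length w = t" using Ex_list_of_length by blast
  hence "(w, w) \<in> tidx t" by (simp add: tidx_def)
  from rep.scale[OF rep.base[OF this this], of 0] show ?thesis by simp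
qed

lemma rep_one: "rep 0 (\<lambda>U :: complex^'n::finite^'n. 1)"
proof (rule rep.cong[OF rep.base])
  show "([], []) \<in> (tidx 0 :: ('n list \<times> 'n list) set)" "([], []) \<in> (tidx 0 :: ('n list \<times> 'n list) set)"
    by (simp_all add: tidx_def)
qed (simp add: tmat_def)

lemma rep_sum: "finite A \<Longrightarrow> (\<And>i. i \<in> A \<Longrightarrow> rep t (f i)) \<Longrightarrow> rep t (\<lambda>U. \<Sum>i\<in>A. f i U)"
  by (induction A rule: finite_induct) (auto intro: rep_zero rep.add)

lemma rep_mult_entries: "rep t f \<Longrightarrow> rep (Suc t) (\<lambda>U. U $ i $ j * cnj (U $ k $ l) * f U)"
proof (induction rule: rep.induct)
  case (base a b)
  have "rep (Suc t) (\<lambda>U. tmat (Suc t) U (i # fst a, k # snd a) (j # fst b, l # snd b))"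
    by (rule rep.base) (use base in \<open>auto simp: tidx_def\<close>)
  thus ?case
    by (rule rep.cong) (simp add: tmat_def prod.lessThan_Suc_shift mult_ac del: prod.lessThan_Suc)
next
  case (add f g)
  from rep.add[OF add.IH] show ?case by (simp add: distrib_left)
next
  case (scale f c)
  from rep.scale[OF scale.IH, of c] show ?case by (simp add: mult_ac)
next
  case (cong f g)
  from cong.IH show ?case by (rule rep.cong) (simp add: cong.hyps)
qed

text \<open>Multiply by the squared norm of a row, which is 1 on unitary matrices. The row
  \<open>i\<close> is arbitrary.\<close>

lemma rep_Suc: "rep t f \<Longrightarrow> rep (Suc t) f"
  for f :: "complex^'n::finite^'n \<Rightarrow> complex"
proof -
  assume f: "rep t f"
  fix i :: 'n
  have "rep (Suc t) (\<lambda>U. \<Sum>j\<in>UNIV. U $ i $ j * cnj (U $ i $ j) * f U)"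
    by (intro rep_sum rep_mult_entries f) simp
  thus "rep (Suc t) f"
    by (rule rep.cong) (simp add: sum_distrib_right[symmetric] row_norm_unitary)
qed

lemma rep_mono: "s \<le> t \<Longrightarrow> rep s f \<Longrightarrow> rep t f"
  by (induction t rule: dec_induct) (auto intro: rep_Suc)

section \<open>Even powers of the normalised trace and their Chebyshev truncation\<close>

definition trs :: "complex^'n::finite^'n \<Rightarrow> real" where
  "trs U = (cmod (trace U) / real CARD('n))\<^sup>2"

lemma trs_nonneg [simp]: "0 \<le> trs U" by (simp add: trs_def)

lemma trs_le_1: "unitary U \<Longrightarrow> trs U \<le> 1"
  unfolding trs_def using cmod_trace_unitary[of U] by (simp add: power_le_one_iff divide_le_eq)

lemma measurable_trs [measurable]: "trs \<in> borel_measurable borel"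
  unfolding trs_def[abs_def] trace_def
  by (intro borel_measurable_continuous_onI continuous_intros) simp

lemma (in unitary_measure) integrable_trs_power:
  assumes "A \<in> sets borel" "unitary V"
  shows "integrable M (\<lambda>U. indicat_real A U * trs (V ** U) ^ m)"
proof -
  have [measurable]: "(\<lambda>U. trs (V ** U)) \<in> borel_measurable borel"
    by (rule measurable_compose[OF measurable_matrix_mult measurable_trs])
  show ?thesis
    by (rule integrable_bounded[where B = 1])
       (use assms in \<open>auto simp: trs_le_1 power_le_one indicator_def unitary_mult\<close>)
qed

abbreviation (in unitary_measure) trs_on :: "(complex^'n^'n) set \<Rightarrow> complex^'n^'n \<Rightarrow> nat \<Rightarrow> real" where
  "trs_on A V m \<equiv> (\<integral>U. indicat_real A U * trs (V ** U) ^ m \<partial>M)"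

lemma rep_mult_trs: "rep t f \<Longrightarrow> rep (Suc t) (\<lambda>U. complex_of_real (trs U) * f U)"
  for f :: "complex^'n::finite^'n \<Rightarrow> complex"
proof -
  assume f: "rep t f"
  have "rep (Suc t) (\<lambda>U. complex_of_real (1 / (real CARD('n))\<^sup>2) *
      (\<Sum>i\<in>UNIV. \<Sum>k\<in>UNIV. U $ i $ i * cnj (U $ k $ k) * f U))"
    by (intro rep.scale rep_sum rep_mult_entries f) simp_all
  thus ?thesis
  proof (rule rep.cong)
    fix U :: "complex^'n^'n"
    have "complex_of_real ((cmod (trace U))\<^sup>2) = (\<Sum>i\<in>UNIV. \<Sum>k\<in>UNIV. U $ i $ i * cnj (U $ k $ k))"
      unfolding complex_norm_square trace_def cnj_sum sum_product ..
    thus "complex_of_real (1 / (real CARD('n))\<^sup>2) * (\<Sum>i\<in>UNIV. \<Sum>k\<in>UNIV. U $ i $ i * cnj (U $ k $ k) * f U)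
        = complex_of_real (trs U) * f U"
      by (simp add: trs_def power_divide sum_distrib_right[symmetric])
  qed
qed

text \<open>\<open>cheb k (x\<^sup>2)\<close> is the Chebyshev polynomial \<open>T\<close> of degree \<open>2 k\<close> at \<open>x\<close>. Since
  \<open>x\<^bsup>2 M\<^esup>\<close> is the average of \<open>T\<close> over the endpoint of a symmetric random walk of
  length \<open>2 M\<close>, truncating at degree \<open>2 t\<close> costs only a Gaussian tail.\<close>

fun cheb :: "nat \<Rightarrow> real \<Rightarrow> real" where
  "cheb 0 s = 1"
| "cheb (Suc 0) s = 2 * s - 1"
| "cheb (Suc (Suc k)) s = 2 * (2 * s - 1) * cheb (Suc k) s - cheb k s"

lemma cheb_cos: "cheb k ((cos \<theta>)\<^sup>2) = cos (2 * real k * \<theta>)"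
proof (induction k "(cos \<theta>)\<^sup>2" rule: cheb.induct)
  case (3 k)
  have "cos (2 * real (Suc (Suc k)) * \<theta>) + cos (2 * real k * \<theta>)
      = 2 * cos (2 * \<theta>) * cos (2 * real (Suc k) * \<theta>)"
    using cos_add[of "2 * real (Suc k) * \<theta>" "2 * \<theta>"] cos_diff[of "2 * real (Suc k) * \<theta>" "2 * \<theta>"]
    by (simp add: algebra_simps)
  thus ?case using 3 by (simp add: cos_double_cos del: of_nat_Suc)
qed (auto simp: cos_double_cos)

lemma rep_cheb: "rep k (\<lambda>U :: complex^'n::finite^'n. complex_of_real (cheb k (trs U)))"
proof (induction k rule: induct_nat_012)
  case 0 show ?case by (simp add: rep_one)
next
  case 1
  from rep.add[OF rep.scale[OF rep_mult_trs[OF rep_one], of 2] rep.scale[OF rep_Suc[OF rep_one], of "-1"]]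
  show ?case by simp
next
  case (ge2 k)
  from rep.add[OF rep.add[OF rep.scale[OF rep_mult_trs[OF ge2.IH(2)], of 4] rep.scale[OF rep_Suc[OF ge2.IH(2)], of "-2"]]
      rep.scale[OF rep_Suc[OF rep_Suc[OF ge2.IH(1)]], of "-1"]]
  show ?case by (rule rep.cong) (simp add: algebra_simps)
qed

text \<open>Term \<open>j\<close> is the walk with \<open>j\<close> upward steps out of
  \<open>2 * M\<close>, ending at 2 (j - M); the restriction on \<open>j\<close> keeps exactly the
  terms of degree at most 2 t.\<close>

definition trunc :: "nat \<Rightarrow> nat \<Rightarrow> real \<Rightarrow> real" where
  "trunc M t s = (\<Sum>j | j \<le> 2 * M \<and> nat \<bar>int M - int j\<bar> \<le> t.
     real ((2 * M) choose j) / 4 ^ M * cheb (nat \<bar>int M - int j\<bar>) s)"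

lemma rep_trunc: "rep t (\<lambda>U :: complex^'n::finite^'n. complex_of_real (trunc M t (trs U)))"
proof -
  have "rep t (\<lambda>U :: complex^'n^'n. \<Sum>j | j \<le> 2 * M \<and> nat \<bar>int M - int j\<bar> \<le> t.
     complex_of_real (real ((2 * M) choose j) / 4 ^ M) * complex_of_real (cheb (nat \<bar>int M - int j\<bar>) (trs U)))"
    by (intro rep_sum rep.scale rep_mono[OF _ rep_cheb]) auto
  thus ?thesis by (rule rep.cong) (simp add: trunc_def)
qed

text \<open>Expand (exp(i \<theta>) + exp(-i \<theta>))^(2 M) by the binomial theorem and take real
  parts.\<close>

lemma cos_power_expand:
  "((cos \<theta>)\<^sup>2) ^ M = (\<Sum>j\<le>2 * M. real ((2 * M) choose j) / 4 ^ M * cheb (nat \<bar>int M - int j\<bar>) ((cos \<theta>)\<^sup>2))"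
proof -
  have "complex_of_real (2 * cos \<theta>) ^ (2 * M) = (cis \<theta> + cis (- \<theta>)) ^ (2 * M)"
    by (rule arg_cong[of _ _ "\<lambda>z. z ^ (2 * M)"]) (simp add: complex_eq_iff)
  also have "\<dots> = (\<Sum>j\<le>2 * M. of_nat ((2 * M) choose j) * cis \<theta> ^ j * cis (- \<theta>) ^ (2 * M - j))"
    by (rule binomial_ring)
  finally have "Re (complex_of_real (2 * cos \<theta>) ^ (2 * M))
      = (\<Sum>j\<le>2 * M. Re (of_nat ((2 * M) choose j) * cis \<theta> ^ j * cis (- \<theta>) ^ (2 * M - j)))"
    by (simp only: Re_sum)
  also have "\<dots> = (\<Sum>j\<le>2 * M. real ((2 * M) choose j) * cheb (nat \<bar>int M - int j\<bar>) ((cos \<theta>)\<^sup>2))"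
  proof (rule sum.cong[OF refl])
    fix j assume "j \<in> {..2 * M}"
    hence j: "j \<le> 2 * M" by simp
    have "cis \<theta> ^ j * cis (- \<theta>) ^ (2 * M - j) = cis (2 * (real j - real M) * \<theta>)"
      using j by (simp add: Complex.DeMoivre cis_mult of_nat_diff algebra_simps)
    moreover have "cos (2 * (real j - real M) * \<theta>) = cheb (nat \<bar>int M - int j\<bar>) ((cos \<theta>)\<^sup>2)"
    proof (cases "j \<le> M")
      case True
      have "cos (2 * (real j - real M) * \<theta>) = cos (- (2 * (real j - real M) * \<theta>))" by (simp only: cos_minus)
      thus ?thesis using True by (simp add: cheb_cos nat_diff_distrib of_nat_diff algebra_simps)
    next
      case False
      thus ?thesis by (simp add: cheb_cos nat_diff_distrib of_nat_diff algebra_simps)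
    qed
    ultimately show "Re (of_nat ((2 * M) choose j) * cis \<theta> ^ j * cis (- \<theta>) ^ (2 * M - j))
        = real ((2 * M) choose j) * cheb (nat \<bar>int M - int j\<bar>) ((cos \<theta>)\<^sup>2)"
      by (simp add: mult.assoc)
  qed
  also have "Re (complex_of_real (2 * cos \<theta>) ^ (2 * M)) = 4 ^ M * ((cos \<theta>)\<^sup>2) ^ M"
    by (simp only: of_real_power[symmetric] Re_complex_of_real power_mult power_mult_distrib) simp
  finally show ?thesis by (simp add: sum_divide_distrib[symmetric] field_simps)
qed

lemma binomial_tail:
  assumes "M > 0"
  shows "(\<Sum>j | j \<le> 2 * M \<and> \<not> nat \<bar>int M - int j\<bar> \<le> t. real ((2 * M) choose j) / 4 ^ M)
    \<le> 2 * exp (- (real t)\<^sup>2 / real M)"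
proof -
  interpret binomial_distribution "2 * M" "1/2 :: real" by unfold_locales auto
  let ?S = "{j. j \<le> 2 * M \<and> \<not> nat \<bar>int M - int j\<bar> \<le> t}"
  have "(\<Sum>j\<in>?S. real ((2 * M) choose j) / 4 ^ M) = (\<Sum>j\<in>?S. pmf (binomial_pmf (2 * M) (1/2)) j)"
  proof (rule sum.cong[OF refl])
    fix j assume "j \<in> ?S"
    hence "(1/2 :: real) ^ j * (1 - 1/2) ^ (2 * M - j) = (1/2) ^ (2 * M)"
      by (simp add: power_add[symmetric])
    also have "\<dots> = 1 / 4 ^ M" by (simp add: power_mult power_divide)
    finally show "real ((2 * M) choose j) / 4 ^ M = pmf (binomial_pmf (2 * M) (1/2)) j" by (simp add: mult.assoc)
  qed
  also have "\<dots> = measure_pmf.prob (binomial_pmf (2 * M) (1/2)) ?S"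
    by (rule measure_measure_pmf_finite[symmetric]) simp
  also have "\<dots> \<le> measure_pmf.prob (binomial_pmf (2 * M) (1/2)) {j. \<bar>real j - real (2 * M) * (1/2)\<bar> \<ge> real t}"
    by (rule measure_pmf.finite_measure_mono) auto
  \<comment> \<open>Hoeffding's inequality for 2 M fair coin tosses deviating by t from their mean
    M.\<close>
  also have "\<dots> \<le> 2 * exp (- 2 * (real t)\<^sup>2 / real (2 * M))"
    by (rule prob_abs_ge) (use assms in auto)
  finally show ?thesis by simp
qed

lemma trunc_error:
  assumes "0 \<le> s" "s \<le> 1" "M > 0"
  shows "\<bar>s ^ M - trunc M t s\<bar> \<le> 2 * exp (- (real t)\<^sup>2 / real M)"
proof -
  define \<theta> where "\<theta> = arccos (sqrt s)"
  have s: "s = (cos \<theta>)\<^sup>2" unfolding \<theta>_def using assms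
    by (subst cos_arccos) (auto intro: order_trans[OF _ real_sqrt_ge_zero])
  let ?T = "\<lambda>j. real ((2 * M) choose j) / 4 ^ M * cheb (nat \<bar>int M - int j\<bar>) s"
  have "s ^ M = (\<Sum>j\<le>2 * M. ?T j)" unfolding s by (rule cos_power_expand)
  also have "{..2 * M} = {j. j \<le> 2 * M \<and> nat \<bar>int M - int j\<bar> \<le> t} \<union> {j. j \<le> 2 * M \<and> \<not> nat \<bar>int M - int j\<bar> \<le> t}"
    by auto
  also have "(\<Sum>j\<in>\<dots>. ?T j) = trunc M t s + (\<Sum>j | j \<le> 2 * M \<and> \<not> nat \<bar>int M - int j\<bar> \<le> t. ?T j)"
    unfolding trunc_def by (rule sum.union_disjoint) auto
  finally have "\<bar>s ^ M - trunc M t s\<bar> = \<bar>\<Sum>j | j \<le> 2 * M \<and> \<not> nat \<bar>int M - int j\<bar> \<le> t. ?T j\<bar>" by simp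
  also have "\<dots> \<le> (\<Sum>j | j \<le> 2 * M \<and> \<not> nat \<bar>int M - int j\<bar> \<le> t. real ((2 * M) choose j) / 4 ^ M)"
  proof (intro order_trans[OF sum_abs] sum_mono)
    fix j
    have "\<bar>?T j\<bar> = real ((2 * M) choose j) / 4 ^ M * \<bar>cheb (nat \<bar>int M - int j\<bar>) s\<bar>" by (simp add: abs_mult)
    also have "\<dots> \<le> real ((2 * M) choose j) / 4 ^ M * 1"
      by (intro mult_left_mono) (simp_all add: s cheb_cos)
    finally show "\<bar>?T j\<bar> \<le> real ((2 * M) choose j) / 4 ^ M" by simp
  qed
  also have "\<dots> \<le> 2 * exp (- (real t)\<^sup>2 / real M)" by (rule binomial_tail) fact
  finally show ?thesis .
qed

lemma measurable_trunc [measurable]: "trunc M t \<in> borel_measurable borel"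
proof -
  have "cheb k \<in> borel_measurable borel" for k
  proof (induction k rule: induct_nat_012)
    case 0
    have "cheb 0 = (\<lambda>s. 1)" by (simp add: fun_eq_iff)
    thus ?case by simp
  next
    case 1
    have "cheb (Suc 0) = (\<lambda>s. 2 * s - 1)" by (simp add: fun_eq_iff)
    thus ?case by simp
  next
    case (ge2 k)
    note [measurable] = ge2
    have "cheb (Suc (Suc k)) = (\<lambda>s. 2 * (2 * s - 1) * cheb (Suc k) s - cheb k s)" by (simp add: fun_eq_iff)
    thus ?case by simp
  qed
  note [measurable] = this
  thus ?thesis unfolding trunc_def[abs_def] by measurable
qed

section \<open>A lower bound for the moments of the trace\<close>

text \<open>Compare the coefficients of degree \<open>M\<close> in the product of the exponential
  series of the \<open>a p\<close>.\<close>

lemma multinomial_power: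
  fixes a :: "'p \<Rightarrow> complex"
  assumes "finite S"
  shows "(\<Sum>p\<in>S. a p) ^ M =
    (\<Sum>X\<in>multisets_of_size S M. complex_of_real (fact M / (\<Prod>p\<in>S. fact (count X p))) * (\<Prod>p\<in>S. a p ^ count X p))"
proof -
  have "(\<Prod>p\<in>S. fps_exp (a p)) = fps_exp (\<Sum>p\<in>S. a p)"
    using assms by (induction S rule: finite_induct) (simp_all add: fps_exp_add_mult)
  hence "fps_nth (fps_exp (\<Sum>p\<in>S. a p)) M = (\<Sum>X\<in>multisets_of_size S M. \<Prod>p\<in>S. fps_nth (fps_exp (a p)) (count X p))"
    using fps_prod_nth'[OF assms, of "\<lambda>p. fps_exp (a p)" M] by simp
  hence "(\<Sum>p\<in>S. a p) ^ M = fact M * (\<Sum>X\<in>multisets_of_size S M. \<Prod>p\<in>S. a p ^ count X p / fact (count X p))"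
    by (simp add: field_simps)
  thus ?thesis by (simp add: sum_distrib_left prod_dividef)
qed

text \<open>\<open>F (x\<^sup>* y)\<close> is a positive kernel of rank at most \<open>card K\<close> with diagonal 1. Its Gram
  operator has trace 1 and squared Hilbert-Schmidt norm equal to the integral of \<open>\<bar>F\<bar>\<^sup>2\<close>, so
  Cauchy-Schwarz applies.\<close>

lemma (in haar_measure) rank_bound:
  fixes e :: "'k \<Rightarrow> complex^'n^'n \<Rightarrow> complex" and F :: "complex^'n^'n \<Rightarrow> complex"
  assumes "finite K" and [measurable]: "\<And>k. e k \<in> borel_measurable borel" "F \<in> borel_measurable borel"
    and e: "\<And>k U. unitary U \<Longrightarrow> cmod (e k U) \<le> 1"
    and F: "\<And>x y. unitary x \<Longrightarrow> unitary y \<Longrightarrow>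
        F (cadj x ** y) = (\<Sum>k\<in>K. complex_of_real (w k) * cnj (e k x) * e k y)"
    and F1: "F (mat 1) = 1" and w: "\<And>k. w k \<ge> 0"
  shows "1 \<le> real (card K) * (\<integral>U. (cmod (F U))\<^sup>2 \<partial>M)"
proof -
  define G where "G k l = (\<integral>U. e k U * cnj (e l U) \<partial>M)" for k l
  have int: "integrable M (\<lambda>U. e k U * cnj (e l U))" for k l
    by (rule integrable_bounded[where B = 1])
       (use e in \<open>auto simp: norm_mult intro!: mult_le_one\<close>)
  have cnjG: "(\<integral>U. cnj (e k U) * e l U \<partial>M) = cnj (G k l)" for k l
    unfolding G_def using Bochner_Integration.integral_cnj[of M "\<lambda>U. e k U * cnj (e l U)"] by simp
  have int': "integrable M (\<lambda>U. cnj (e k U) * e l U)" for k l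
    using int[of l k] by (simp add: mult.commute)
  define J where "J = (\<integral>U. (cmod (F U))\<^sup>2 \<partial>M)"
  have tr: "(\<Sum>k\<in>K. complex_of_real (w k) * cnj (G k k)) = 1"
  proof -
    have "(\<Sum>k\<in>K. complex_of_real (w k) * cnj (G k k))
        = (\<integral>U. (\<Sum>k\<in>K. complex_of_real (w k) * (cnj (e k U) * e k U)) \<partial>M)"
      using int' by (simp add: Bochner_Integration.integral_sum cnjG)
    also have "\<dots> = (\<integral>U. 1 \<partial>M)"
      by (rule integral_cong_unitary) (use F[of x x for x] F1 in \<open>auto simp: unitaryD mult.assoc\<close>)
    finally show ?thesis by (simp add: prob_space)
  qed
  \<comment> \<open>By left invariance the integral over \<open>y\<close> does not depend on
    \<open>x\<close>. Averaging this formula over \<open>x\<close> then turns the mixed products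
    into squared moduli of \<open>G k l\<close>.\<close>
  have inner: "complex_of_real J = (\<Sum>k\<in>K. \<Sum>l\<in>K. complex_of_real (w k * w l) * (cnj (e k x) * e l x) * G k l)"
    if x: "unitary x" for x
  proof -
    have "complex_of_real J = (\<integral>y. complex_of_real ((cmod (F (cadj x ** y)))\<^sup>2) \<partial>M)"
      unfolding J_def integral_complex_of_real
      by (subst integral_shift[of "\<lambda>U. (cmod (F U))\<^sup>2" "cadj x", symmetric]) (use x in auto)
    also have "\<dots> = (\<integral>y. (\<Sum>k\<in>K. \<Sum>l\<in>K. complex_of_real (w k * w l) * (cnj (e k x) * e l x) * (e k y * cnj (e l y))) \<partial>M)"
    proof (rule integral_cong_unitary)
      have "(\<lambda>y. F (cadj x ** y)) \<in> borel_measurable borel"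
        by (rule measurable_compose[OF measurable_matrix_mult]) measurable
      thus "(\<lambda>y. complex_of_real ((cmod (F (cadj x ** y)))\<^sup>2)) \<in> borel_measurable borel" by simp
      fix y :: "complex^'n^'n" assume y: "unitary y"
      show "complex_of_real ((cmod (F (cadj x ** y)))\<^sup>2)
          = (\<Sum>k\<in>K. \<Sum>l\<in>K. complex_of_real (w k * w l) * (cnj (e k x) * e l x) * (e k y * cnj (e l y)))"
        unfolding complex_norm_square F[OF x y] cnj_sum sum_product
        by (intro sum.cong refl) (simp add: mult_ac)
    qed measurable
    also have "\<dots> = (\<Sum>k\<in>K. \<Sum>l\<in>K. complex_of_real (w k * w l) * (cnj (e k x) * e l x) * G k l)"
      using int by (simp add: Bochner_Integration.integral_sum integrable_sum G_def)
    finally show ?thesis .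
  qed
  have "complex_of_real J = (\<integral>x. complex_of_real J \<partial>M)" by (simp add: prob_space)
  also have "\<dots> = (\<integral>x. (\<Sum>k\<in>K. \<Sum>l\<in>K. complex_of_real (w k * w l) * G k l * (cnj (e k x) * e l x)) \<partial>M)"
    by (rule integral_cong_unitary) (use inner in \<open>auto simp: mult_ac\<close>)
  also have "\<dots> = (\<Sum>k\<in>K. \<Sum>l\<in>K. complex_of_real (w k * w l) * G k l * cnj (G k l))"
    using int' by (simp add: Bochner_Integration.integral_sum integrable_sum cnjG)
  also have "\<dots> = complex_of_real (\<Sum>k\<in>K. \<Sum>l\<in>K. (w k * w l) * (cmod (G k l))\<^sup>2)"
    by (simp add: complex_norm_square mult.assoc del: of_real_power)
  finally have J: "J = (\<Sum>k\<in>K. \<Sum>l\<in>K. (w k * w l) * (cmod (G k l))\<^sup>2)"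
    by (simp only: of_real_eq_iff)
  \<comment> \<open>Cauchy-Schwarz over \<open>K\<close> for the diagonal of \<open>G\<close>; the
    off-diagonal terms of \<open>J\<close> are nonnegative and may be dropped.\<close>
  have "1 = (cmod (\<Sum>k\<in>K. complex_of_real (w k) * cnj (G k k)))\<^sup>2" by (simp add: tr)
  also have "\<dots> \<le> (\<Sum>k\<in>K. w k * cmod (G k k))\<^sup>2"
    by (intro power_mono sum_norm_le) (simp_all add: norm_mult w)
  also have "\<dots> \<le> (\<Sum>k\<in>K. (w k * cmod (G k k))\<^sup>2) * card K"
    by (rule sum_squared_le_sum_of_squares)
  also have "\<dots> \<le> J * card K"
  proof (rule mult_right_mono)
    show "(\<Sum>k\<in>K. (w k * cmod (G k k))\<^sup>2) \<le> J"
      unfolding J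
    proof (rule sum_mono)
      fix k assume "k \<in> K"
      hence "(w k * w k) * (cmod (G k k))\<^sup>2 \<le> (\<Sum>l\<in>K. (w k * w l) * (cmod (G k l))\<^sup>2)"
        using assms(1) w by (intro member_le_sum) auto
      thus "(w k * cmod (G k k))\<^sup>2 \<le> (\<Sum>l\<in>K. (w k * w l) * (cmod (G k l))\<^sup>2)"
        by (simp add: power2_eq_square mult_ac)
    qed
  qed simp
  finally show ?thesis by (simp add: J_def mult.commute)
qed

text \<open>\<open>F (cadj x ** y)\<close> is a power of the normalised Hilbert-Schmidt inner
  product. Its multinomial expansion has nonnegative weights on the monomials of degree
  \<open>m\<close>, as \<open>rank_bound\<close> requires.\<close>

lemma (in haar_measure) trs_moment_lower:
  "1 \<le> real ((CARD('n)\<^sup>2 + m - 1) choose m) * (\<integral>U. trs U ^ m \<partial>M)"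
proof -
  let ?S = "UNIV :: ('n \<times> 'n) set"
  define e where "e X U = (\<Prod>p\<in>?S. (U $ fst p $ snd p) ^ count X p)" for X and U :: "complex^'n^'n"
  define w where "w X = (fact m / (\<Prod>p\<in>?S. fact (count X p))) / real CARD('n) ^ m" for X :: "('n \<times> 'n) multiset"
  define F :: "complex^'n^'n \<Rightarrow> complex" where "F U = (trace U / of_nat CARD('n)) ^ m" for U
  have "1 \<le> real (card (multisets_of_size ?S m)) * (\<integral>U. (cmod (F U))\<^sup>2 \<partial>M)"
  proof (rule rank_bound[where e = e and w = w])
    show "e X \<in> borel_measurable borel" for X
      unfolding e_def[abs_def] by (intro borel_measurable_continuous_onI continuous_intros)
    show "F \<in> borel_measurable borel"
      unfolding F_def[abs_def] trace_def by (intro borel_measurable_continuous_onI continuous_intros) simp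
    show "cmod (e X U) \<le> 1" if "unitary U" for X U
      unfolding e_def prod_norm[symmetric] norm_power
      by (intro prod_le_1) (auto simp: that cmod_entry_unitary power_le_one)
    show "F (mat 1) = 1" by (simp add: F_def trace_def mat_def)
    show "w X \<ge> 0" for X by (simp add: w_def prod_nonneg)
    show "F (cadj x ** y) = (\<Sum>X\<in>multisets_of_size ?S m. complex_of_real (w X) * cnj (e X x) * e X y)" for x y
    proof -
      have "trace (cadj x ** y) = (\<Sum>i\<in>UNIV. \<Sum>k\<in>UNIV. cnj (x $ i $ k) * y $ i $ k)"
        unfolding trace_def matrix_matrix_mult_def by (subst sum.swap) simp
      also have "\<dots> = (\<Sum>p\<in>?S. cnj (x $ fst p $ snd p) * y $ fst p $ snd p)"
        by (simp add: sum.cartesian_product case_prod_unfold)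
      finally have "F (cadj x ** y) = (\<Sum>p\<in>?S. cnj (x $ fst p $ snd p) * y $ fst p $ snd p) ^ m / of_nat CARD('n) ^ m"
        by (simp add: F_def power_divide)
      also have "\<dots> = (\<Sum>X\<in>multisets_of_size ?S m. complex_of_real (w X) * cnj (e X x) * e X y)"
        by (subst multinomial_power)
           (simp_all add: w_def e_def sum_divide_distrib power_mult_distrib prod.distrib mult_ac)
      finally show ?thesis .
    qed
  qed auto
  also have "(\<integral>U. (cmod (F U))\<^sup>2 \<partial>M) = (\<integral>U. trs U ^ m \<partial>M)"
    by (simp add: F_def trs_def norm_power norm_divide power_mult[symmetric] mult.commute)
  finally show ?thesis by (simp add: card_multisets_of_size power2_eq_square)
qed

text \<open>A single term of the binomial expansion of (p + (1 - p))^(N + m) is at most 1; take p =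
  N / (N + m), where that term is largest. The remaining factor (1 + N/m)^m is at most
  exp(N).\<close>

lemma binomial_le_exp:
  assumes "N > 0"
  shows "real ((N + m) choose N) \<le> (exp 1 * (1 + real m / real N)) ^ N"
proof (cases "m = 0")
  case True thus ?thesis by (simp add: one_le_power)
next
  case False
  define p where "p = real N / (real N + real m)"
  have p: "0 < p" "p < 1" "1 - p = real m / (real N + real m)"
    using assms False by (auto simp: p_def field_simps)
  have "real ((N + m) choose N) * p ^ N * (1 - p) ^ (N + m - N) \<le> (\<Sum>k\<le>N + m. of_nat ((N + m) choose k) * p ^ k * (1 - p) ^ (N + m - k))"
    using p by (intro member_le_sum) auto
  also have "\<dots> = (p + (1 - p)) ^ (N + m)" by (rule binomial_ring[symmetric])
  finally have le: "real ((N + m) choose N) * (p ^ N * (1 - p) ^ m) \<le> 1" by (simp add: mult.assoc)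
  have "real ((N + m) choose N) \<le> (1 / p) ^ N * (1 / (1 - p)) ^ m"
  proof -
    have "0 < p ^ N * (1 - p) ^ m" using p(1,2) by (intro mult_pos_pos zero_less_power) auto
    hence "real ((N + m) choose N) \<le> 1 / (p ^ N * (1 - p) ^ m)" using le by (simp only: pos_le_divide_eq)
    thus ?thesis by (simp only: power_divide power_one times_divide_times_eq mult_1)
  qed
  also have "1 / p = 1 + real m / real N" using assms by (simp add: p_def field_simps)
  finally have 1: "real ((N + m) choose N) \<le> (1 + real m / real N) ^ N * (1 / (1 - p)) ^ m" .
  have 2: "(1 / (1 - p)) ^ m \<le> exp 1 ^ N"
  proof -
    have "1 / (1 - p) = 1 + real N / real m" using False by (simp add: p(3) field_simps)
    also have "\<dots> \<le> exp (real N / real m)" by simp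
    finally have "(1 / (1 - p)) ^ m \<le> exp (real N / real m) ^ m" using p by (intro power_mono) auto
    also have "\<dots> = exp (real N)" using False by (simp add: exp_of_nat_mult[symmetric])
    finally show ?thesis by (simp add: exp_of_nat_mult[symmetric])
  qed
  have "real ((N + m) choose N) \<le> (1 + real m / real N) ^ N * exp 1 ^ N"
    by (rule order_trans[OF 1 mult_left_mono[OF 2]]) simp
  thus ?thesis by (simp only: power_mult_distrib mult.commute)
qed

text \<open>Exchanging \<open>m\<close> and \<open>N\<close> in the binomial coefficient fixes the
  exponent at d^2 - 1 however large \<open>m\<close> is.\<close>

lemma (in haar_measure) trs_moment_lower':
  assumes "CARD('n) \<ge> 2"
  defines "N \<equiv> CARD('n)\<^sup>2 - 1"
  shows "1 \<le> (exp 1 * (1 + real m / real N)) ^ N * (\<integral>U. trs U ^ m \<partial>M)"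
proof -
  have "CARD('n)\<^sup>2 \<ge> 2\<^sup>2" using assms(1) by (rule power_mono) simp
  hence N: "N > 0" "CARD('n)\<^sup>2 + m - 1 = N + m" by (auto simp: N_def)
  have "1 \<le> real ((N + m) choose m) * (\<integral>U. trs U ^ m \<partial>M)" using trs_moment_lower[of m] N by simp
  also have "real ((N + m) choose m) = real ((N + m) choose N)" by (simp add: binomial_symmetric[of m "N + m"])
  also have "\<dots> * (\<integral>U. trs U ^ m \<partial>M) \<le> (exp 1 * (1 + real m / real N)) ^ N * (\<integral>U. trs U ^ m \<partial>M)"
    by (intro mult_right_mono binomial_le_exp N) simp
  finally show ?thesis .
qed

section \<open>Volumes of balls\<close>

lemma (in haar_measure) prob_shift:
  assumes "A \<in> sets borel" "unitary V"
  shows "prob {U. V ** U \<in> A} = prob A"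
proof -
  have "prob A = measure (distr M borel (\<lambda>U. V ** U)) A" using left_inv[OF assms(2)] by simp
  also have "\<dots> = prob ((\<lambda>U. V ** U) -` A \<inter> space M)"
    by (rule measure_distr) (use assms in auto)
  also have "space M = UNIV" using sets_eq_imp_space_eq[OF sets_eq] by simp
  finally show ?thesis by (simp add: vimage_def)
qed

lemma (in unitary_measure) prob_le_sum_cover:
  assumes "finite T" "\<And>V. V \<in> T \<Longrightarrow> B V \<in> sets borel" "A \<in> sets borel"
    and "\<And>U. unitary U \<Longrightarrow> U \<in> A \<Longrightarrow> \<exists>V\<in>T. U \<in> B V" and "\<And>V. V \<in> T \<Longrightarrow> prob (B V) \<le> b"
  shows "prob A \<le> real (card T) * b"
proof -
  have "prob A \<le> prob (\<Union>V\<in>T. B V)"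
    by (rule finite_measure_mono_AE) (use AE_unitary assms in auto)
  also have "\<dots> \<le> (\<Sum>V\<in>T. prob (B V))"
    by (rule finite_measure_subadditive_finite) (use assms in auto)
  also have "\<dots> \<le> (\<Sum>V\<in>T. b)" by (intro sum_mono assms)
  finally show ?thesis by simp
qed

text \<open>Spectral-norm balls modulo phases, matching \<open>Dch\<close>. They are not cut down to
  unitary matrices, so that they are open.\<close>

definition pball :: "real \<Rightarrow> complex^'n::finite^'n \<Rightarrow> (complex^'n^'n) set" where
  "pball \<rho> V = {U. \<exists>z. cmod z = 1 \<and> nrm (V - mat z ** U) < \<rho>}"

lemma open_pball: "open (pball \<rho> V)"
proof -
  have "pball \<rho> V = (\<Union>z\<in>{z. cmod z = 1}. {U. nrm (V - mat z ** U) < \<rho>})" by (auto simp: pball_def)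
  also have "open \<dots>"
    by (intro open_UN ballI open_Collect_less continuous_on_compose2[OF continuous_on_nrm]
        continuous_intros) auto
  finally show ?thesis .
qed

lemma pball_sets [measurable]: "pball \<rho> V \<in> sets borel"
  by (simp add: open_pball)

lemma pball_shift:
  assumes "unitary V" shows "pball \<rho> V = {U. cadj V ** U \<in> pball \<rho> (mat 1)}"
proof -
  have "nrm (V - mat z ** U) = nrm (mat 1 - mat z ** (cadj V ** U))" for z U
  proof -
    have "mat z ** (cadj V ** U) = cadj V ** (mat z ** U)"
      by (metis mat_commute matrix_mul_assoc)
    hence "mat 1 - mat z ** (cadj V ** U) = cadj V ** (V - mat z ** U)"
      using assms by (simp add: matrix_mul_diff_distrib unitaryD)
    thus ?thesis using nrm_unitary_mult(1)[of "cadj V"] assms by simp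
  qed
  thus ?thesis by (auto simp: pball_def)
qed

lemma nrm_phase_swap:
  fixes U V :: "complex^'n::finite^'n"
  assumes "cmod z = 1"
  shows "nrm (U - mat (cnj z) ** V) = nrm (V - mat z ** U)"
proof -
  have "mat z ** (U - mat (cnj z) ** V) = mat z ** U - mat (z * cnj z) ** V"
    by (simp add: matrix_mul_diff_distrib matrix_mul_assoc mat_mult_mat)
  also have "z * cnj z = 1" using assms by (simp add: complex_norm_square[symmetric])
  finally have "nrm (mat z ** (U - mat (cnj z) ** V)) = nrm (mat z ** U - V)" by simp
  thus ?thesis using assms by (simp add: nrm_mat_mult nrm_minus_commute)
qed

text \<open>Multiplying by \<open>2 / \<rho>\<close> separated phases improves the exponent from \<open>d\<^sup>2\<close> to
  \<open>d\<^sup>2 - 1\<close>.\<close>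

lemma card_phase_separated:
  fixes S :: "(complex^'n::finite^'n) set"
  assumes S: "finite S" "\<And>U. U \<in> S \<Longrightarrow> unitary U"
    and sep: "\<And>U V z. U \<in> S \<Longrightarrow> V \<in> S \<Longrightarrow> U \<noteq> V \<Longrightarrow> cmod z = 1 \<Longrightarrow> \<rho> \<le> nrm (U - mat z ** V)"
    and \<rho>: "0 < \<rho>"
  shows "real (card S) * (2 / \<rho>) \<le> (9 * (1 + 4 / \<rho>)) ^ (CARD('n)\<^sup>2)"
proof -
  define m where "m = Suc (nat \<lfloor>2 / \<rho>\<rfloor>)"
  have m: "2 / \<rho> \<le> real m" unfolding m_def using \<rho> by linarith
  \<comment> \<open>Points on the unit circle with real parts spaced by \<rho>: they are
    \<rho>-separated because the real part is 1-Lipschitz, and floor(2 / \<rho>) + 1 of them fit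
    into [-1, 1].\<close>
  define a where "a k = -1 + \<rho> * real k" for k :: nat
  have a: "\<bar>a k\<bar> \<le> 1" if "k < m" for k
  proof -
    have "real k \<le> real (nat \<lfloor>2 / \<rho>\<rfloor>)" using that unfolding m_def by simp
    also have "\<dots> \<le> 2 / \<rho>" using \<rho> by (intro of_nat_floor) simp
    finally have "real k \<le> 2 / \<rho>" .
    hence "\<rho> * real k \<le> 2" using \<rho> by (simp add: field_simps)
    thus ?thesis using \<rho> by (simp add: a_def abs_le_iff)
  qed
  define z where "z k = Complex (a k) (sqrt (1 - (a k)\<^sup>2))" for k
  have z1: "cmod (z k) = 1" if "k < m" for k
    using a[OF that] by (simp add: z_def cmod_def abs_square_le_1)
  have zsep: "\<rho> \<le> cmod (z j - z k)" if "j \<noteq> k" for j k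
  proof -
    have "1 \<le> \<bar>real j - real k\<bar>" using that by linarith
    hence "\<rho> * 1 \<le> \<rho> * \<bar>real j - real k\<bar>" using \<rho> by (intro mult_left_mono) auto
    also have "\<dots> = \<bar>a j - a k\<bar>" using \<rho> by (simp add: a_def abs_mult right_diff_distrib[symmetric])
    also have "\<dots> \<le> cmod (z j - z k)" using abs_Re_le_cmod[of "z j - z k"] by (simp add: z_def)
    finally show ?thesis by simp
  qed
  define f where "f = (\<lambda>(k, U). mat (z k) ** (U :: complex^'n^'n))"
  let ?P = "{..<m} \<times> S"
  have fsep: "\<rho> \<le> nrm (f p - f q)" if pq: "p \<in> ?P" "q \<in> ?P" "p \<noteq> q" for p q
  proof -
    obtain j U k V where p: "p = (j, U)" "j < m" "U \<in> S" and q: "q = (k, V)" "k < m" "V \<in> S"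
      using pq by auto
    show ?thesis
    proof (cases "U = V")
      case True
      hence "j \<noteq> k" using pq(3) p q by auto
      have "f p - f q = mat (z j - z k) ** U"
        by (simp add: f_def p q True vec_eq_iff mat_mult_nth algebra_simps)
      moreover have "nrm U = 1"
      proof -
        have "nrm (mat 1 :: complex^'n^'n) = 1"
        proof -
          have "(1::real) \<le> nrm (mat 1 :: complex^'n^'n)"
            using cmod_entry_le_nrm[of "mat 1 :: complex^'n^'n" i i for i] by (simp add: mat_def)
          thus ?thesis using nrm_unitary_le[of "mat 1 :: complex^'n^'n"] by simp
        qed
        thus ?thesis using nrm_unitary_mult(1)[OF S(2)[OF p(3)], of "mat 1"] by simp
      qed
      ultimately show ?thesis using zsep[OF \<open>j \<noteq> k\<close>] by (simp add: nrm_mat_mult)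
    next
      case False
      have "cmod (cnj (z j) * z k) = 1" using z1 p q by (simp add: norm_mult)
      hence "\<rho> \<le> nrm (U - mat (cnj (z j) * z k) ** V)" by (rule sep[OF p(3) q(3) False])
      also have "\<dots> = nrm (mat (z j) ** (U - mat (cnj (z j) * z k) ** V))"
        using z1 p by (simp add: nrm_mat_mult)
      also have "mat (z j) ** (U - mat (cnj (z j) * z k) ** V) = f p - mat (z j * cnj (z j) * z k) ** V"
        by (simp add: matrix_mul_diff_distrib matrix_mul_assoc mat_mult_mat f_def p mult.assoc)
      also have "z j * cnj (z j) = 1" using z1 p by (simp add: complex_norm_square[symmetric])
      finally show ?thesis by (simp add: f_def q)
    qed
  qed
  have inj: "inj_on f ?P"
  proof (rule inj_onI, rule ccontr)
    fix p q assume "p \<in> ?P" "q \<in> ?P" "f p = f q" "p \<noteq> q"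
    from fsep[OF this(1,2,4)] this(3) show False using \<rho> by simp
  qed
  have "real (card (f ` ?P)) \<le> (9 * (1 + 4 / \<rho>)) ^ (CARD('n)\<^sup>2)"
  proof (rule card_separated_unitary)
    show "unitary W" if "W \<in> f ` ?P" for W
      using that z1 S(2) by (auto simp: f_def intro: unitary_mat_mult)
    show "\<rho> \<le> nrm (A - B)" if "A \<in> f ` ?P" "B \<in> f ` ?P" "A \<noteq> B" for A B
    proof -
      obtain p q where "p \<in> ?P" "q \<in> ?P" "A = f p" "B = f q" using \<open>A \<in> f ` ?P\<close> \<open>B \<in> f ` ?P\<close> by blast
      thus ?thesis using fsep[of p q] that(3) by auto
    qed
  qed (use S \<rho> in auto)
  hence "real m * real (card S) \<le> (9 * (1 + 4 / \<rho>)) ^ (CARD('n)\<^sup>2)"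
    unfolding card_image[OF inj] by (simp add: card_cartesian_product)
  moreover have "real (card S) * (2 / \<rho>) \<le> real (card S) * real m" using m by (intro mult_left_mono) auto
  ultimately show ?thesis by (simp add: mult.commute)
qed

text \<open>Balls about a maximal separated set cover the group and all have the same measure, so
  their number times that measure is at least 1.\<close>

lemma (in haar_measure) prob_pball_lower:
  assumes \<rho>: "0 < \<rho>" and W: "unitary W"
  shows "2 / \<rho> \<le> (9 * (1 + 4 / \<rho>)) ^ (CARD('n)\<^sup>2) * prob (pball \<rho> W)"
proof -
  define sep where "sep U V \<longleftrightarrow> (\<forall>z. cmod z = 1 \<longrightarrow> \<rho> \<le> nrm (U - mat z ** V))" for U V :: "complex^'n^'n"
  have sym: "sep V U" if "sep U V" for U V
    unfolding sep_def
  proof (intro allI impI)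
    fix z :: complex assume z: "cmod z = 1"
    hence "\<rho> \<le> nrm (U - mat (cnj z) ** V)" using that by (simp add: sep_def)
    thus "\<rho> \<le> nrm (V - mat z ** U)" using nrm_phase_swap[OF z, of U V] by simp
  qed
  let ?N = "(9 * (1 + 4 / \<rho>)) ^ (CARD('n)\<^sup>2)"
  have bound: "real (card T) * (2 / \<rho>) \<le> ?N" if "finite T" "T \<subseteq> {U. unitary U}" "pairwise sep T" for T
    using that \<rho> by (intro card_phase_separated) (auto simp: pairwise_def sep_def)
  have bound': "real (card T) \<le> ?N * \<rho> / 2" if "finite T" "T \<subseteq> {U. unitary U}" "pairwise sep T" for T
    using bound[OF that] \<rho> by (simp add: field_simps)
  obtain T where T: "finite T" "T \<subseteq> {U. unitary U}" "pairwise sep T"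
    "\<And>U. U \<in> {U. unitary U} \<Longrightarrow> U \<in> T \<or> (\<exists>V\<in>T. \<not> sep V U)"
    using maximal_separated[of "{U. unitary U}" sep, OF bound' sym] by blast
  have shift: "prob (pball \<rho> V) = prob (pball \<rho> (mat 1))" if "unitary V" for V
    unfolding pball_shift[OF that] by (rule prob_shift) (use that in auto)
  have "prob UNIV \<le> real (card T) * prob (pball \<rho> (mat 1))"
  proof (rule prob_le_sum_cover[where B = "pball \<rho>"])
    fix U :: "complex^'n^'n" assume U: "unitary U"
    show "\<exists>V\<in>T. U \<in> pball \<rho> V"
    proof (cases "\<exists>V\<in>T. \<not> sep V U")
      case True
      then obtain V z where "V \<in> T" "cmod z = 1" "nrm (V - mat z ** U) < \<rho>" by (auto simp: sep_def not_le)
      thus ?thesis unfolding pball_def by blast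
    next
      case False
      hence "U \<in> T" using T(4) U by auto
      moreover have "U \<in> pball \<rho> U"
        unfolding pball_def using \<rho> by (auto intro!: exI[of _ 1])
      ultimately show ?thesis by blast
    qed
  next
    show "prob (pball \<rho> V) \<le> prob (pball \<rho> (mat 1))" if "V \<in> T" for V
      using shift[of V] T(2) that by auto
  qed (use T(1) in auto)
  moreover have "prob UNIV = 1" using prob_space sets_eq_imp_space_eq[OF sets_eq] by simp
  ultimately have "1 * (2 / \<rho>) \<le> real (card T) * prob (pball \<rho> W) * (2 / \<rho>)"
    using \<rho> shift[OF W] by (intro mult_right_mono) auto
  also have "\<dots> = (real (card T) * (2 / \<rho>)) * prob (pball \<rho> W)" by simp
  also have "\<dots> \<le> ?N * prob (pball \<rho> W)" using bound[OF T(1-3)] by (intro mult_right_mono) auto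
  finally show ?thesis by simp
qed

text \<open>\<open>hsdist U\<close> is the square of the Hilbert-Schmidt distance from \<open>U\<close> to the phases.\<close>

definition hsdist :: "complex^'n::finite^'n \<Rightarrow> real" where
  "hsdist U = 2 * real CARD('n) - 2 * cmod (trace U)"

lemma measurable_hsdist [measurable]: "hsdist \<in> borel_measurable borel"
  unfolding hsdist_def[abs_def] trace_def
  by (intro borel_measurable_continuous_onI continuous_intros)

text \<open>The optimal phase brings each point into a Frobenius ball about the identity, and
  separation in \<open>hsdist\<close> survives any choice of phases. No chart is involved, so the
  bound depends on \<open>R / \<rho>\<close> alone and holds at all radii.\<close>

lemma card_hs_separated:
  fixes S :: "(complex^'n::finite^'n) set"
  assumes S: "finite S" "\<And>U. U \<in> S \<Longrightarrow> unitary U" "\<And>U. U \<in> S \<Longrightarrow> hsdist U \<le> R\<^sup>2"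
    and sep: "\<And>U V. U \<in> S \<Longrightarrow> V \<in> S \<Longrightarrow> U \<noteq> V \<Longrightarrow> \<rho>\<^sup>2 \<le> hsdist (cadj U ** V)"
    and "0 < \<rho>" "0 \<le> R"
  shows "real (card S) \<le> (1 + 2 * R / \<rho>) ^ (2 * CARD('n)\<^sup>2)"
proof -
  have "\<exists>z. cmod z = 1 \<and> norm (mat 1 - mat z ** U) \<le> R" if US: "U \<in> S" for U
  proof -
    obtain z where "cmod z = 1" "(norm (mat 1 - mat z ** U))\<^sup>2 = hsdist U"
      using norm_diff_phase_exists[OF unitary_mat1 S(2)[OF US]] by (auto simp: hsdist_def)
    thus ?thesis using S(3)[OF US] \<open>0 \<le> R\<close> by (metis power2_le_imp_le)
  qed
  then obtain z where z: "\<And>U. U \<in> S \<Longrightarrow> cmod (z U) = 1"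
    "\<And>U. U \<in> S \<Longrightarrow> norm (mat 1 - mat (z U) ** U) \<le> R" by metis
  define f where "f U = mat 1 - mat (z U) ** U" for U
  have fsep: "\<rho> \<le> norm (f U - f V)" if UV: "U \<in> S" "V \<in> S" "U \<noteq> V" for U V
  proof -
    have "cadj (mat (z V) ** V) ** (mat (z U) ** U) = mat (z U * cnj (z V)) ** (cadj V ** U)"
    proof -
      have "cadj (mat (z V) ** V) ** (mat (z U) ** U) = cadj V ** (mat (cnj (z V)) ** mat (z U)) ** U"
        by (simp only: cadj_mult cadj_mat matrix_mul_assoc)
      also have "\<dots> = cadj V ** mat (z U * cnj (z V)) ** U" by (simp only: mat_mult_mat mult.commute)
      finally show ?thesis by (simp only: mat_commute[of _ "cadj V", symmetric] matrix_mul_assoc)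
    qed
    hence "(norm (f U - f V))\<^sup>2 = 2 * real CARD('n) - 2 * Re (z U * cnj (z V) * trace (cadj V ** U))"
      using norm_diff_unitary[of "mat (z V) ** V" "mat (z U) ** U"] UV S(2) z(1)
      by (simp add: f_def unitary_mat_mult trace_mat_mult)
    moreover have "Re (z U * cnj (z V) * trace (cadj V ** U)) \<le> cmod (trace (cadj V ** U))"
      using complex_Re_le_cmod[of "z U * cnj (z V) * trace (cadj V ** U)"] UV z(1) by (simp add: norm_mult)
    ultimately have "\<rho>\<^sup>2 \<le> (norm (f U - f V))\<^sup>2"
      using sep[OF UV(2,1)] UV(3) by (simp add: hsdist_def)
    thus ?thesis by (rule power2_le_imp_le) simp
  qed
  have inj: "inj_on f S"
    using fsep \<open>0 < \<rho>\<close> by (fastforce intro: inj_onI)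
  have "real (card (f ` S)) \<le> (1 + 2 * R / \<rho>) ^ DIM(complex^'n^'n)"
  proof (rule packing_bound[where p = norm and C = 1 and C' = 1])
    show "\<rho> \<le> norm (x - y)" if "x \<in> f ` S" "y \<in> f ` S" "x \<noteq> y" for x y
      using that fsep by blast
  qed (use assms(1,5,6) z in \<open>auto simp: f_def norm_triangle_ineq\<close>)
  thus ?thesis unfolding card_image[OF inj] by (simp add: power2_eq_square mult_ac)
qed

text \<open>Cover the large ball by translates of the small one, centred at a maximal separated set.
  This compares balls without knowing their volumes.\<close>

lemma (in haar_measure) hs_doubling:
  assumes "0 < \<rho>" "0 \<le> R"
  shows "prob {U. hsdist U \<le> R\<^sup>2} \<le> (1 + 2 * R / \<rho>) ^ (2 * CARD('n)\<^sup>2) * prob {U. hsdist U \<le> \<rho>\<^sup>2}"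
proof -
  define sep where "sep U V \<longleftrightarrow> \<rho>\<^sup>2 < hsdist (cadj U ** V)" for U V :: "complex^'n^'n"
  have sym: "sep V U" if "sep U V" for U V
  proof -
    have "trace (cadj V ** U) = cnj (trace (cadj U ** V))"
      by (simp add: trace_def matrix_matrix_mult_def mult.commute)
    thus ?thesis using that by (simp add: sep_def hsdist_def)
  qed
  let ?N = "(1 + 2 * R / \<rho>) ^ (2 * CARD('n)\<^sup>2)" and ?X = "{U :: complex^'n^'n. unitary U \<and> hsdist U \<le> R\<^sup>2}"
  have bound: "real (card T) \<le> ?N" if "finite T" "T \<subseteq> ?X" "pairwise sep T" for T
    using that assms by (intro card_hs_separated) (auto simp: pairwise_def sep_def less_imp_le)
  obtain T where T: "finite T" "T \<subseteq> ?X" "pairwise sep T"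
    "\<And>U. U \<in> ?X \<Longrightarrow> U \<in> T \<or> (\<exists>V\<in>T. \<not> sep V U)"
    using maximal_separated[of ?X sep, OF bound sym] by blast
  let ?b = "prob {U. hsdist U \<le> \<rho>\<^sup>2}"
  have "prob {U. hsdist U \<le> R\<^sup>2} \<le> real (card T) * ?b"
  proof (rule prob_le_sum_cover[where B = "\<lambda>V. {U. cadj V ** U \<in> {U. hsdist U \<le> \<rho>\<^sup>2}}"])
    fix V assume "V \<in> T"
    hence V: "unitary V" using T by auto
    show "prob {U. cadj V ** U \<in> {U. hsdist U \<le> \<rho>\<^sup>2}} \<le> ?b"
      using prob_shift[of "{U. hsdist U \<le> \<rho>\<^sup>2}" "cadj V"] V by simp
    have "(\<lambda>U. hsdist (cadj V ** U)) \<in> borel_measurable borel"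
      by (rule measurable_compose[OF measurable_matrix_mult measurable_hsdist])
    thus "{U. cadj V ** U \<in> {U. hsdist U \<le> \<rho>\<^sup>2}} \<in> sets borel" by simp
  next
    fix U :: "complex^'n^'n" assume U: "unitary U" "U \<in> {U. hsdist U \<le> R\<^sup>2}"
    show "\<exists>V\<in>T. U \<in> {U. cadj V ** U \<in> {U. hsdist U \<le> \<rho>\<^sup>2}}"
    proof (cases "U \<in> T")
      case True
      have "hsdist (cadj U ** U) = 0" using U by (simp add: unitaryD hsdist_def trace_def mat_def)
      thus ?thesis using True by force
    next
      case False
      thus ?thesis using T(4)[of U] U by (auto simp: sep_def not_less)
    qed
  qed (use T in auto)
  also have "\<dots> \<le> ?N * ?b" using bound[OF T(1-3)] by (intro mult_right_mono) auto
  finally show ?thesis .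
qed

section \<open>A criterion for the support of an approximate expander\<close>

context haar_pair
begin

text \<open>The order of the \<mu>- and \<open>N'\<close>-integrals is exchanged through linearity
  in the moment operator, so no joint integrability is involved.\<close>

lemma ev_moment:
  assumes [measurable]: "b \<in> borel_measurable borel" and b: "\<And>x. cmod (b x) \<le> 1"
    and N: "unitary_measure N'"
  shows "(\<integral>x. b x * ev t (rmul t X (moment_op N' t)) x \<partial>\<mu>)
       = (\<integral>V. (\<integral>x. b x * ev t X (cadj V ** x) \<partial>\<mu>) \<partial>N')"
proof -
  interpret N': unitary_measure N' by fact
  obtain w where lin: "\<And>B. (\<integral>x. b x * ev t (rmul t X B) x \<partial>\<mu>) = (\<Sum>c\<in>tidx t. \<Sum>d\<in>tidx t. B c d * w c d)"
    using integral_ev_rmul_linear[OF assms(1) b] by blast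
  have "(\<integral>x. b x * ev t (rmul t X (moment_op N' t)) x \<partial>\<mu>)
      = (\<integral>V. (\<Sum>c\<in>tidx t. \<Sum>d\<in>tidx t. tmat t V c d * w c d) \<partial>N')"
    unfolding lin moment_op_tmat using N'.integrable_tmat by (simp add: Bochner_Integration.integral_sum integrable_sum)
  also have "\<dots> = (\<integral>V. (\<integral>x. b x * ev t X (cadj V ** x) \<partial>\<mu>) \<partial>N')"
    unfolding lin[symmetric] ev_rmul_tmat ..
  finally show ?thesis .
qed

lemma ev_moment_point:
  assumes "unitary_measure N'"
  shows "ev t (rmul t X (moment_op N' t)) x = (\<integral>V. ev t X (cadj V ** x) \<partial>N')"
proof -
  interpret N': unitary_measure N' by fact
  have "ev t (rmul t X (moment_op N' t)) x = (\<integral>V. ev t (rmul t X (tmat t V)) x \<partial>N')"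
    unfolding ev_rmul moment_op_tmat using N'.integrable_tmat by (simp add: Bochner_Integration.integral_sum integrable_sum)
  thus ?thesis by (simp add: ev_rmul_tmat)
qed

lemma trs_cadj: "trs (cadj U) = trs U"
proof -
  have "trace (cadj U) = cnj (trace U)" by (simp add: trace_def)
  thus ?thesis by (simp add: trs_def)
qed

text \<open>Test h = (\<nu> - \<mu>) * g on \<open>B\<close>. The tail and truncation bounds make
  the mean of \<nu> * g there at most J/4, while \<mu> * g is the constant mean of g, at least 7/8
  J. Hence the squared norm of h is at least (5/8 J)^2 times the measure of \<open>B\<close>,
  whereas the contraction bounds it by \<delta>^2 * 4/3 J. The resulting constant 256/75 is below
  4.\<close>

lemma expander_criterion:
  fixes B :: "(complex^'n^'n) set" and m t :: nat and \<delta> :: real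
  defines "J \<equiv> \<integral>U. trs U ^ m \<partial>\<mu>" and "e \<equiv> 2 * exp (- (real t)\<^sup>2 / real m)"
  assumes \<delta>: "opnorm (tidx t) (dif t) \<le> \<delta>" "0 \<le> \<delta>" and "m > 0" and e: "e \<le> J / 8"
    and [measurable]: "B \<in> sets borel"
    and tail: "AE V in \<nu>. trs_on B (cadj V) m \<le> prob B * J / 8"
  shows "prob B * J \<le> 4 * \<delta>\<^sup>2"
proof -
  define g where "g U = trunc m t (trs U)" for U :: "complex^'n^'n"
  have [measurable]: "g \<in> borel_measurable borel" unfolding g_def[abs_def] by measurable
  have err: "\<bar>trs U ^ m - g U\<bar> \<le> e" if "unitary U" for U
    unfolding g_def e_def by (rule trunc_error) (use that \<open>m > 0\<close> trs_le_1 in auto)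
  have e0: "0 \<le> e" by (simp add: e_def)
  have s1: "0 \<le> trs U ^ m" "trs U ^ m \<le> 1" if "unitary U" for U
    using trs_le_1[OF that] by (simp_all add: power_le_one)
  have gb: "\<bar>g U\<bar> \<le> 1 + e" if "unitary U" for U using err[OF that] s1[OF that] by linarith
  have intg: "integrable \<mu> g" by (rule integrable_bounded[where B = "1 + e"]) (use gb in auto)
  have intJ: "integrable \<mu> (\<lambda>U. trs U ^ m)" by (rule integrable_bounded[where B = 1]) (use s1 in auto)
  have J1: "0 \<le> J" "J \<le> 1"
  proof -
    show "0 \<le> J" unfolding J_def by (intro integral_nonneg_AE) (use AE_unitary s1 in auto)
    have "J \<le> (\<integral>U. 1 \<partial>\<mu>)" unfolding J_def
      by (intro integral_mono_AE intJ) (use AE_unitary s1 in auto)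
    thus "J \<le> 1" by (simp add: prob_space)
  qed
  obtain X where X: "\<And>U. unitary U \<Longrightarrow> complex_of_real (g U) = (\<Sum>a\<in>tidx t. \<Sum>b\<in>tidx t. X a b * tmat t U a b)"
    using rep_coeff[OF rep_trunc[of t m]] unfolding g_def by blast
  have evX: "ev t X x = complex_of_real (g x)" if "unitary x" for x
    using X[of "cadj x"] that by (simp add: ev_def g_def trs_cadj)
  \<comment> \<open>As \<open>trs x ^ m\<close> lies in [0, 1], its square is no larger than itself,
    so the bound is linear in \<open>J\<close> and one factor \<open>J\<close> cancels at the end.
    With e <= J/8 <= 1/8 the constant is 5/4 + 1/64 < 4/3.\<close>
  have nsqX: "nsq t X \<le> 4/3 * J"
  proof -
    have "nsq t X = (\<integral>x. (g x)\<^sup>2 \<partial>\<mu>)"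
      unfolding nsq_def by (rule integral_cong_unitary) (auto simp: evX)
    also have "\<dots> \<le> (\<integral>x. (1 + 2 * e) * trs x ^ m + e\<^sup>2 \<partial>\<mu>)"
    proof (rule integral_mono_AE)
      show "integrable \<mu> (\<lambda>x. (g x)\<^sup>2)"
        by (rule integrable_bounded[where B = "(1 + e)\<^sup>2"])
           (use gb e0 in \<open>auto simp: abs_le_square_iff[symmetric]\<close>)
      show "AE x in \<mu>. (g x)\<^sup>2 \<le> (1 + 2 * e) * trs x ^ m + e\<^sup>2"
        using AE_unitary
      proof eventually_elim
        case (elim x)
        let ?s = "trs x ^ m"
        have "(g x)\<^sup>2 \<le> (?s + e)\<^sup>2"
          using err[OF elim] s1[OF elim] e0 by (intro abs_le_square_iff[THEN iffD1]) linarith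
        also have "\<dots> = ?s * ?s + 2 * e * ?s + e\<^sup>2" by (simp add: power2_eq_square algebra_simps)
        also have "?s * ?s \<le> ?s * 1" using s1[OF elim] by (intro mult_left_mono) auto
        finally show ?case by (simp add: algebra_simps)
      qed
    qed (use intJ in auto)
    also have "\<dots> = (1 + 2 * e) * J + e\<^sup>2" using intJ by (simp add: J_def prob_space)
    also have "\<dots> \<le> (1 + 2 * (1/8)) * J + (1/8) * (J/8)"
      unfolding power2_eq_square using e e0 J1 by (intro add_mono mult_right_mono mult_mono) auto
    also have "\<dots> \<le> 4/3 * J" using J1 by simp
    finally show ?thesis .
  qed
  define h where "h x = ev t (rmul t X (dif t)) x" for x
  have hm [measurable]: "h \<in> borel_measurable borel" unfolding h_def[abs_def] by simp
  have dif_lin: "ev t (rmul t X (dif t)) x = ev t (rmul t X (moment_op \<nu> t)) x - ev t (rmul t X (moment_op \<mu> t)) x" for x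
    by (simp add: ev_rmul dif_def left_diff_distrib sum_subtractf)
  have m_int: "ev t (rmul t X (moment_op \<mu> t)) x = complex_of_real (integral\<^sup>L \<mu> g)" if x: "unitary x" for x
  proof -
    have "ev t (rmul t X (moment_op \<mu> t)) x = (\<integral>V. ev t X (cadj V ** x) \<partial>\<mu>)"
      by (rule ev_moment_point) unfold_locales
    also have "\<dots> = (\<integral>V. complex_of_real (g (cadj x ** V)) \<partial>\<mu>)"
    proof (rule integral_cong_unitary)
      have "(\<lambda>V. cadj V ** x) \<in> borel \<rightarrow>\<^sub>M borel"
        by (intro borel_measurable_continuous_onI continuous_on_matrix_mult continuous_on_cadj
            continuous_on_const continuous_on_id)
      from measurable_compose[OF this measurable_ev]
      show "(\<lambda>V. ev t X (cadj V ** x)) \<in> borel_measurable borel" .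
      have "(\<lambda>V. g (cadj x ** V)) \<in> borel_measurable borel"
        by (rule measurable_compose[OF measurable_matrix_mult]) measurable
      thus "(\<lambda>V. complex_of_real (g (cadj x ** V))) \<in> borel_measurable borel" by simp
      fix V :: "complex^'n^'n" assume "unitary V"
      hence "ev t X (cadj V ** x) = complex_of_real (g (cadj (cadj V ** x)))"
        using x by (simp add: evX unitary_mult g_def trs_cadj)
      thus "ev t X (cadj V ** x) = complex_of_real (g (cadj x ** V))" by (simp add: cadj_mult)
    qed
    also have "\<dots> = (\<integral>V. complex_of_real (g V) \<partial>\<mu>)"
      by (rule integral_shift[of "\<lambda>V. complex_of_real (g V)"]) (use x in auto)
    finally show ?thesis by simp
  qed
  have Jg: "J - e \<le> integral\<^sup>L \<mu> g"
  proof -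
    have "J - e = (\<integral>U. trs U ^ m - e \<partial>\<mu>)" using intJ by (simp add: J_def prob_space)
    also have "\<dots> \<le> integral\<^sup>L \<mu> g"
    proof (rule integral_mono_AE)
      show "AE x in \<mu>. trs x ^ m - e \<le> g x" using AE_unitary
        by eventually_elim (use err in force)
    qed (use intJ intg in auto)
    finally show ?thesis .
  qed
  define bI where "bI x = complex_of_real (indicat_real B x)" for x
  have [measurable]: "bI \<in> borel_measurable borel" unfolding bI_def[abs_def] by measurable
  have bI1: "cmod (bI x) \<le> 1" for x by (simp add: bI_def indicator_def)
  have intev: "integrable \<mu> (\<lambda>x. bI x * ev t Y x)" for Y
  proof (rule integrable_bounded)
    show "cmod (bI x * ev t Y x) \<le> 1 * (\<Sum>a\<in>tidx t. \<Sum>c\<in>tidx t. cmod (Y a c))" if "unitary x" for x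
      unfolding norm_mult using that bI1 by (intro mult_mono ev_bound) auto
  qed measurable
  have inner: "Re (\<integral>x. bI x * ev t X (cadj V ** x) \<partial>\<mu>) \<le> prob B * J / 8 + e * prob B"
    if V: "unitary V" and tl: "trs_on B (cadj V) m \<le> prob B * J / 8" for V
  proof -
    have mV [measurable]: "(\<lambda>x. g (cadj V ** x)) \<in> borel_measurable borel"
      by (rule measurable_compose[OF measurable_matrix_mult]) measurable
    have "(\<integral>x. bI x * ev t X (cadj V ** x) \<partial>\<mu>) = (\<integral>x. complex_of_real (indicat_real B x * g (cadj V ** x)) \<partial>\<mu>)"
    proof (rule integral_cong_unitary)
      show "(\<lambda>x. bI x * ev t X (cadj V ** x)) \<in> borel_measurable borel"
        by (intro borel_measurable_times measurable_compose[OF measurable_matrix_mult measurable_ev]) measurable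
    qed (use V in \<open>auto simp: bI_def evX unitary_mult\<close>)
    hence "Re (\<integral>x. bI x * ev t X (cadj V ** x) \<partial>\<mu>) = (\<integral>x. indicat_real B x * g (cadj V ** x) \<partial>\<mu>)"
      by (simp del: of_real_mult)
    also have "\<dots> \<le> (\<integral>x. indicat_real B x * trs (cadj V ** x) ^ m + e * indicat_real B x \<partial>\<mu>)"
    proof (rule integral_mono_AE)
      have u: "unitary (cadj V ** x)" if "unitary x" for x using that V by (simp add: unitary_mult)
      show "integrable \<mu> (\<lambda>x. indicat_real B x * g (cadj V ** x))"
        by (rule integrable_bounded[where B = "1 + e"]) (use gb[OF u] e0 in \<open>auto simp: indicator_def\<close>)
      show "integrable \<mu> (\<lambda>x. indicat_real B x * trs (cadj V ** x) ^ m + e * indicat_real B x)"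
        using V by (intro Bochner_Integration.integrable_add integrable_mult_right integrable_trs_power) auto
      show "AE x in \<mu>. indicat_real B x * g (cadj V ** x) \<le> indicat_real B x * trs (cadj V ** x) ^ m + e * indicat_real B x"
        using AE_unitary
      proof eventually_elim
        case (elim x)
        show ?case using err[OF u[OF elim]] by (auto simp: indicator_def)
      qed
    qed
    also have "\<dots> = trs_on B (cadj V) m + e * prob B"
      using integrable_trs_power[of B "cadj V" m] V by simp
    finally show ?thesis using tl by linarith
  qed
  have upper: "Re (\<integral>x. bI x * h x \<partial>\<mu>) \<le> - (5/8 * J * prob B)"
  proof -
    have "(\<integral>x. bI x * h x \<partial>\<mu>) = (\<integral>x. bI x * ev t (rmul t X (moment_op \<nu> t)) x \<partial>\<mu>)
        - (\<integral>x. bI x * ev t (rmul t X (moment_op \<mu> t)) x \<partial>\<mu>)"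
      unfolding h_def dif_lin using intev by (simp add: right_diff_distrib)
    also have "(\<integral>x. bI x * ev t (rmul t X (moment_op \<mu> t)) x \<partial>\<mu>)
        = (\<integral>x. complex_of_real (indicat_real B x * integral\<^sup>L \<mu> g) \<partial>\<mu>)"
      by (rule integral_cong_unitary) (auto simp: m_int bI_def)
    also have "\<dots> = complex_of_real (prob B * integral\<^sup>L \<mu> g)" by (simp del: of_real_mult)
    also have "(\<integral>x. bI x * ev t (rmul t X (moment_op \<nu> t)) x \<partial>\<mu>) = (\<integral>V. (\<integral>x. bI x * ev t X (cadj V ** x) \<partial>\<mu>) \<partial>\<nu>)"
      by (rule ev_moment) (use bI1 N.unitary_measure_axioms in auto)
    finally have eq: "Re (\<integral>x. bI x * h x \<partial>\<mu>) = Re (\<integral>V. (\<integral>x. bI x * ev t X (cadj V ** x) \<partial>\<mu>) \<partial>\<nu>) - prob B * integral\<^sup>L \<mu> g"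
      by simp
    have "Re (\<integral>V. (\<integral>x. bI x * ev t X (cadj V ** x) \<partial>\<mu>) \<partial>\<nu>) \<le> prob B * J / 8 + e * prob B"
    proof (cases "integrable \<nu> (\<lambda>V. \<integral>x. bI x * ev t X (cadj V ** x) \<partial>\<mu>)")
      case True
      have "Re (\<integral>V. (\<integral>x. bI x * ev t X (cadj V ** x) \<partial>\<mu>) \<partial>\<nu>) = (\<integral>V. Re (\<integral>x. bI x * ev t X (cadj V ** x) \<partial>\<mu>) \<partial>\<nu>)"
        using True by simp
      also have "\<dots> \<le> (\<integral>V. prob B * J / 8 + e * prob B \<partial>\<nu>)"
      proof (rule integral_mono_AE)
        show "AE V in \<nu>. Re (\<integral>x. bI x * ev t X (cadj V ** x) \<partial>\<mu>) \<le> prob B * J / 8 + e * prob B"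
          using tail N.AE_unitary by eventually_elim (rule inner)
      qed (use True in auto)
      finally show ?thesis by (simp add: N.prob_space)
    next
      case False
      \<comment> \<open>The Bochner integral of a non-integrable function is 0, and the bound is
        nonnegative.\<close>
      thus ?thesis using J1 e0 by (simp add: not_integrable_integral_eq)
    qed
    moreover have "prob B * (J - e) \<le> prob B * integral\<^sup>L \<mu> g" using Jg by (intro mult_left_mono) auto
    moreover have "e * prob B \<le> J / 8 * prob B" using e by (intro mult_right_mono) auto
    ultimately show ?thesis unfolding eq by (simp add: algebra_simps)
  qed
  have hb: "cmod (h x) \<le> (\<Sum>a\<in>tidx t. \<Sum>c\<in>tidx t. cmod (rmul t X (dif t) a c))" if "unitary x" for x
    unfolding h_def using that by (rule ev_bound)
  have "(5/8 * J)\<^sup>2 * prob B \<le> nsq t (rmul t X (dif t))"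
  proof -
    let ?a = "5/8 * J"
    \<comment> \<open>Cauchy-Schwarz on \<open>B\<close> in integrated form: the square of Re h +
      5/8 J is nonnegative, and this shift makes the bound sharp for the estimate
      \<open>upper\<close>.\<close>
    have alg: "y\<^sup>2 * p \<le> - 2 * y * R - y\<^sup>2 * p" if "0 \<le> y" "R \<le> - (y * p)" for y p R :: real
      using mult_left_mono[OF that(2,1)] by (simp add: power2_eq_square mult_ac)
    have "(5/8 * J)\<^sup>2 * prob B \<le> - 2 * ?a * Re (\<integral>x. bI x * h x \<partial>\<mu>) - ?a\<^sup>2 * prob B"
      by (rule alg[OF _ upper]) (use J1 in simp)
    also have "\<dots> = (\<integral>x. - 2 * ?a * Re (bI x * h x) - ?a\<^sup>2 * indicat_real B x \<partial>\<mu>)"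
    proof -
      have "integrable \<mu> (\<lambda>x. Re (bI x * h x))"
        using intev[of "rmul t X (dif t)"] unfolding h_def by (rule integrable_Re)
      moreover have "Re (\<integral>x. bI x * h x \<partial>\<mu>) = (\<integral>x. Re (bI x * h x) \<partial>\<mu>)"
        using intev[of "rmul t X (dif t)"] unfolding h_def by (rule integral_Re[symmetric])
      ultimately show ?thesis by (simp del: times_complex.sel)
    qed
    also have "\<dots> \<le> nsq t (rmul t X (dif t))"
      unfolding nsq_def
    proof (rule integral_mono_AE)
      show "integrable \<mu> (\<lambda>x. - 2 * ?a * Re (bI x * h x) - ?a\<^sup>2 * indicat_real B x)"
        using integrable_Re[OF intev[of "rmul t X (dif t)"]] unfolding h_def[symmetric]
        by (intro Bochner_Integration.integrable_diff integrable_mult_right) auto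
      show "integrable \<mu> (\<lambda>x. (cmod (ev t (rmul t X (dif t)) x))\<^sup>2)"
        by (rule integrable_bounded[where B = "(\<Sum>a\<in>tidx t. \<Sum>c\<in>tidx t. cmod (rmul t X (dif t) a c))\<^sup>2"])
           (auto intro!: power_mono ev_bound)
      show "AE x in \<mu>. - 2 * ?a * Re (bI x * h x) - ?a\<^sup>2 * indicat_real B x \<le> (cmod (ev t (rmul t X (dif t)) x))\<^sup>2"
      proof (rule AE_I2)
        fix x
        have "- 2 * ?a * Re (h x) - ?a\<^sup>2 \<le> (cmod (h x))\<^sup>2"
        proof -
          have "0 \<le> (Re (h x) + ?a)\<^sup>2" by simp
          hence "- 2 * ?a * Re (h x) - ?a\<^sup>2 \<le> (Re (h x))\<^sup>2" by (simp add: power2_eq_square algebra_simps)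
          also have "\<dots> \<le> (cmod (h x))\<^sup>2" by (simp add: cmod_power2)
          finally show ?thesis .
        qed
        thus "- 2 * ?a * Re (bI x * h x) - ?a\<^sup>2 * indicat_real B x \<le> (cmod (ev t (rmul t X (dif t)) x))\<^sup>2"
          by (auto simp: bI_def indicator_def h_def)
      qed
    qed
    finally show ?thesis .
  qed
  also have "\<dots> \<le> \<delta>\<^sup>2 * nsq t X" by (rule expander_contraction[OF \<delta>])
  also have "\<dots> \<le> \<delta>\<^sup>2 * (4/3 * J)" by (intro mult_left_mono nsqX) simp
  finally have "J * (25/64 * (prob B * J)) \<le> J * (4/3 * \<delta>\<^sup>2)" by (simp add: power2_eq_square algebra_simps)
  moreover have "J > 0"
  proof -
    have "0 < e" by (simp add: e_def)
    thus ?thesis using e by linarith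
  qed
  ultimately have "25/64 * (prob B * J) \<le> 4/3 * \<delta>\<^sup>2" by (metis mult_le_cancel_left_pos)
  moreover have "0 \<le> \<delta>\<^sup>2" by simp
  ultimately show ?thesis by linarith
qed

end

text \<open>Every point outside the support has a null neighbourhood from a countable base, so the
  complement lies in a countable union of null sets.\<close>

lemma AE_msupp:
  fixes M :: "'a::second_countable_topology measure"
  assumes "sets M = sets borel"
  shows "AE x in M. x \<in> msupp M"
proof -
  obtain \<B> :: "'a set set" where B: "countable \<B>" "topological_basis \<B>"
    using ex_countable_basis by blast
  define N where "N = (\<Union>S\<in>{S\<in>\<B>. emeasure M S = 0}. S)"
  have ms: "S \<in> sets M" if "S \<in> \<B>" for S
    using topological_basis_open[OF B(2) that] assms by simp
  have "N \<in> null_sets M"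
    unfolding N_def by (rule null_sets_UN') (use B(1) ms in \<open>auto intro: countable_subset\<close>)
  moreover have "x \<in> N" if x: "x \<notin> msupp M" for x
  proof -
    obtain S where S: "open S" "x \<in> S" "emeasure M S = 0"
      using x by (auto simp: msupp_def not_less)
    obtain S' where S': "S' \<in> \<B>" "x \<in> S'" "S' \<subseteq> S" using topological_basisE[OF B(2) S(1,2)] by blast
    hence "emeasure M S' = 0"
      using emeasure_mono[OF S'(3), of M] S assms by simp
    thus ?thesis using S' by (auto simp: N_def)
  qed
  ultimately show ?thesis by (auto intro: AE_I'[of N])
qed

section \<open>Tail estimates\<close>

lemma trs_hsdist: "trs U = (1 - hsdist U / (2 * real CARD('n)))\<^sup>2" for U :: "complex^'n::finite^'n"
  by (simp add: trs_def hsdist_def diff_divide_distrib)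

lemma hsdist_unitary:
  fixes U :: "complex^'n::finite^'n"
  assumes "unitary U" shows "0 \<le> hsdist U" "hsdist U \<le> 2 * real CARD('n)"
  using cmod_trace_unitary[OF assms] by (simp_all add: hsdist_def)

lemma trs_power_le:
  fixes U :: "complex^'n::finite^'n"
  assumes "unitary U" "c \<le> hsdist U"
  shows "trs U ^ m \<le> exp (- (real m * c / real CARD('n)))"
proof -
  let ?d = "real CARD('n)"
  have y: "0 \<le> 1 - hsdist U / (2 * ?d)"
    using hsdist_unitary[OF assms(1)] by simp
  have "1 - hsdist U / (2 * ?d) \<le> exp (- (hsdist U / (2 * ?d)))"
    using exp_ge_add_one_self[of "- (hsdist U / (2 * ?d))"] by simp
  also have "\<dots> \<le> exp (- (c / (2 * ?d)))" using assms(2) by (simp add: divide_right_mono)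
  finally have "(1 - hsdist U / (2 * ?d)) ^ (2 * m) \<le> exp (- (c / (2 * ?d))) ^ (2 * m)"
    using y by (intro power_mono) auto
  also have "\<dots> = exp (- (real m * c / ?d))"
    by (subst exp_of_nat_mult[symmetric]) (simp add: field_simps)
  finally show ?thesis by (simp add: trs_hsdist power_mult)
qed

text \<open>1 - y >= exp(-2 y) for y in [0, 1/2], because (1 - y)(1 + 2 y) >= 1 there.\<close>

lemma trs_power_ge:
  fixes U :: "complex^'n::finite^'n"
  assumes "unitary U" "hsdist U \<le> c" "c \<le> real CARD('n)"
  shows "exp (- (2 * real m * c / real CARD('n))) \<le> trs U ^ m"
proof -
  let ?d = "real CARD('n)" and ?y = "hsdist U / (2 * real CARD('n))"
  have y: "0 \<le> ?y" "?y \<le> 1/2" using hsdist_unitary[OF assms(1)] assms by (auto simp: field_simps)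
  have "exp (- (c / ?d)) \<le> exp (- (2 * ?y))" using assms(2) by (simp add: divide_right_mono)
  also have "\<dots> \<le> 1 - ?y"
  proof -
    have "1 \<le> (1 - x) * (1 + 2 * x)" if "0 \<le> x" "x \<le> 1/2" for x :: real
      using mult_right_mono[OF that(2), of "2 * x"] that(1) by (simp add: algebra_simps)
    from this[OF y] have "1 \<le> (1 - ?y) * (1 + 2 * ?y)" .
    also have "\<dots> \<le> (1 - ?y) * exp (2 * ?y)" using y by (intro mult_left_mono exp_ge_add_one_self) auto
    finally show ?thesis by (simp add: exp_minus field_simps)
  qed
  finally have "exp (- (c / ?d)) ^ (2 * m) \<le> (1 - ?y) ^ (2 * m)" by (intro power_mono) auto
  moreover have "exp (- (c / ?d)) ^ (2 * m) = exp (- (2 * real m * c / ?d))"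
    by (subst exp_of_nat_mult[symmetric]) (simp add: field_simps)
  ultimately show ?thesis by (simp add: trs_hsdist power_mult)
qed

context haar_measure
begin

lemma trs_moment_ball_lower:
  assumes "\<rho>\<^sup>2 \<le> real CARD('n)"
  shows "exp (- (2 * real m * \<rho>\<^sup>2 / real CARD('n))) * prob {U. hsdist U \<le> \<rho>\<^sup>2} \<le> (\<integral>U. trs U ^ m \<partial>M)"
proof -
  let ?c = "exp (- (2 * real m * \<rho>\<^sup>2 / real CARD('n)))" and ?S = "{U :: complex^'n^'n. hsdist U \<le> \<rho>\<^sup>2}"
  have [measurable]: "?S \<in> sets borel" by measurable
  have "?c * prob ?S = (\<integral>U. ?c * indicat_real ?S U \<partial>M)" by simp
  also have "\<dots> \<le> (\<integral>U. trs U ^ m \<partial>M)"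
  proof (rule integral_mono_AE)
    show "integrable M (\<lambda>U. trs U ^ m)"
      by (rule integrable_bounded[where B = 1]) (auto simp: trs_le_1 power_le_one)
    show "AE U in M. ?c * indicat_real ?S U \<le> trs U ^ m"
      using AE_unitary
      by eventually_elim (use trs_power_ge[OF _ _ assms] in \<open>auto simp: indicator_def\<close>)
  qed auto
  finally show ?thesis .
qed

text \<open>Decompose into annuli of width \<open>\<rho>\<close> and compare their volumes by doubling.\<close>

lemma trs_tail_annuli:
  assumes \<rho>: "0 < \<rho>" and n0: "real n0 * \<rho> \<le> r"
  shows "\<exists>K. (\<integral>U. indicat_real {U. r\<^sup>2 < hsdist U} U * trs U ^ m \<partial>M)
    \<le> (\<Sum>k\<in>{n0..K}. exp (- (real m * (real k * \<rho>)\<^sup>2 / real CARD('n)))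
          * (2 * real k + 3) ^ (2 * CARD('n)\<^sup>2)) * prob {U. hsdist U \<le> \<rho>\<^sup>2}"
proof -
  let ?d = "real CARD('n)"
  \<comment> \<open>\<open>hsdist\<close> is at most 2 d on unitary matrices, so no annulus beyond
    this index is needed.\<close>
  define K where "K = nat \<lceil>sqrt (2 * ?d) / \<rho>\<rceil>"
  define S where "S k = {U :: complex^'n^'n. hsdist U \<le> (real (Suc k) * \<rho>)\<^sup>2}" for k
  define c where "c k = exp (- (real m * (real k * \<rho>)\<^sup>2 / ?d))" for k
  have r: "0 \<le> r" using n0 \<rho> by (meson mult_nonneg_nonneg of_nat_0_le_iff order_trans less_imp_le)
  have Sm [measurable]: "S k \<in> sets borel" for k unfolding S_def by measurable
  have "(\<integral>U. indicat_real {U. r\<^sup>2 < hsdist U} U * trs U ^ m \<partial>M) \<le> (\<integral>U. (\<Sum>k\<in>{n0..K}. c k * indicat_real (S k) U) \<partial>M)"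
  proof (rule integral_mono_AE)
    have [measurable]: "{U :: complex^'n^'n. r\<^sup>2 < hsdist U} \<in> sets borel" by measurable
    show "integrable M (\<lambda>U. indicat_real {U. r\<^sup>2 < hsdist U} U * trs U ^ m)"
      by (rule integrable_bounded[where B = 1]) (auto simp: trs_le_1 power_le_one indicator_def)
    show "integrable M (\<lambda>U. \<Sum>k\<in>{n0..K}. c k * indicat_real (S k) U)"
      by (intro Bochner_Integration.integrable_sum integrable_mult_right) auto
    show "AE U in M. indicat_real {U. r\<^sup>2 < hsdist U} U * trs U ^ m \<le> (\<Sum>k\<in>{n0..K}. c k * indicat_real (S k) U)"
      using AE_unitary
    proof eventually_elim
      case (elim U)
      show ?case
      proof (cases "r\<^sup>2 < hsdist U")
        case False
        thus ?thesis by (auto simp: c_def intro!: sum_nonneg)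
      next
        case True
        define h where "h = sqrt (hsdist U)"
        have h: "h\<^sup>2 = hsdist U" "0 \<le> h" using hsdist_unitary[OF elim] by (auto simp: h_def)
        have rh: "r < h" using True h by (metis power2_less_imp_less)
        define k where "k = nat \<lfloor>h / \<rho>\<rfloor>"
        have k1: "real k \<le> h / \<rho>" unfolding k_def using h \<rho> by (intro of_nat_floor) simp
        have k2: "h / \<rho> < real (Suc k)" unfolding k_def using h \<rho> by (simp add: nat_add_distrib) linarith
        have k1': "real k * \<rho> \<le> h" and k2': "h \<le> real (Suc k) * \<rho>"
          using k1 k2 \<rho> by (simp_all add: field_simps del: of_nat_Suc)
        have "n0 < Suc k"
        proof -
          have "h < real (Suc k) * \<rho>" using k2 \<rho> by (simp only: pos_divide_less_eq)
          hence "real n0 * \<rho> < real (Suc k) * \<rho>" using n0 rh by linarith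
          hence "real n0 < real (Suc k)" using \<rho> by (simp only: mult_less_cancel_right_pos)
          thus ?thesis by (simp only: of_nat_less_iff)
        qed
        moreover have "k \<le> K"
        proof -
          have "h \<le> sqrt (2 * ?d)" unfolding h_def using hsdist_unitary[OF elim] by simp
          hence "h / \<rho> \<le> sqrt (2 * ?d) / \<rho>" using \<rho> by (intro divide_right_mono) auto
          thus ?thesis unfolding k_def K_def by (intro nat_mono) linarith
        qed
        ultimately have kK: "k \<in> {n0..K}" by auto
        have "trs U ^ m \<le> c k"
          unfolding c_def
        proof (rule trs_power_le[OF elim])
          show "(real k * \<rho>)\<^sup>2 \<le> hsdist U" unfolding h(1)[symmetric] using k1' \<rho> by (intro power_mono) auto
        qed
        moreover have "U \<in> S k" unfolding S_def mem_Collect_eq h(1)[symmetric] using k2' h(2) by (rule power_mono)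
        ultimately have "indicat_real {U. r\<^sup>2 < hsdist U} U * trs U ^ m \<le> c k * indicat_real (S k) U"
          using True by simp
        also have "\<dots> \<le> (\<Sum>k\<in>{n0..K}. c k * indicat_real (S k) U)"
          by (rule member_le_sum[OF kK]) (auto simp: c_def)
        finally show ?thesis .
      qed
    qed
  qed
  also have "\<dots> = (\<Sum>k\<in>{n0..K}. c k * prob (S k))"
    by (subst Bochner_Integration.integral_sum) auto
  also have "\<dots> \<le> (\<Sum>k\<in>{n0..K}. c k * ((2 * real k + 3) ^ (2 * CARD('n)\<^sup>2) * prob {U. hsdist U \<le> \<rho>\<^sup>2}))"
  proof (intro sum_mono mult_left_mono)
    fix k
    \<comment> \<open>Annulus \<open>k\<close> lies in the ball of radius (k + 1) \<rho>; this is
      its doubling factor.\<close>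
    have "1 + 2 * (real (Suc k) * \<rho>) / \<rho> = 2 * real k + 3" using \<rho> by (simp add: field_simps)
    thus "prob (S k) \<le> (2 * real k + 3) ^ (2 * CARD('n)\<^sup>2) * prob {U. hsdist U \<le> \<rho>\<^sup>2}"
      using hs_doubling[OF \<rho>, of "real (Suc k) * \<rho>"] \<rho> unfolding S_def by (simp add: add.commute)
  qed (simp add: c_def)
  finally show ?thesis by (intro exI[of _ K]) (simp add: c_def sum_distrib_right mult.assoc)
qed

text \<open>Since m \<rho>^2 >= d^3, annulus \<open>k\<close> has weight at most exp(- d^2 k^2). For
  k >= 6 this beats the volume ratio (2 k + 3)^(2 d^2) <= exp(d^2 k^2 / 2), leaving a geometric
  series. The \<rho>-ball has measure at most exp(2 c d^2) times the mean, which makes the estimate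
  relative to the mean.\<close>

lemma trs_tail_bound:
  assumes \<rho>: "0 < \<rho>" "\<rho>\<^sup>2 \<le> real CARD('n)" and n0: "real n0 * \<rho> \<le> r" "6 \<le> n0"
    and m: "real CARD('n) ^ 3 \<le> real m * \<rho>\<^sup>2" "real m * \<rho>\<^sup>2 \<le> c * real CARD('n) ^ 3"
  shows "(\<integral>U. indicat_real {U. r\<^sup>2 < hsdist U} U * trs U ^ m \<partial>M)
    \<le> 2 * exp (- ((real CARD('n))\<^sup>2 * ((real n0)\<^sup>2 / 2 - 2 * c))) * (\<integral>U. trs U ^ m \<partial>M)"
proof -
  let ?d = "real CARD('n)" and ?v = "prob {U. hsdist U \<le> \<rho>\<^sup>2}"
  have d: "1 \<le> ?d" by (simp add: Suc_leI)
  obtain K where K: "(\<integral>U. indicat_real {U. r\<^sup>2 < hsdist U} U * trs U ^ m \<partial>M)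
    \<le> (\<Sum>k\<in>{n0..K}. exp (- (real m * (real k * \<rho>)\<^sup>2 / ?d)) * (2 * real k + 3) ^ (2 * CARD('n)\<^sup>2)) * ?v"
    using trs_tail_annuli[OF \<rho>(1) n0(1)] by blast
  have trm: "exp (- (real m * (real k * \<rho>)\<^sup>2 / ?d)) * (2 * real k + 3) ^ (2 * CARD('n)\<^sup>2)
      \<le> exp (- (?d\<^sup>2 * (real n0)\<^sup>2 / 2)) * (1/2) ^ (k - n0)" if k: "n0 \<le> k" for k
  proof -
    have k3: "6 \<le> real k" using k n0(2) by simp
    have "?d\<^sup>2 * (real k)\<^sup>2 \<le> real m * (real k * \<rho>)\<^sup>2 / ?d"
    proof -
      have "?d\<^sup>2 \<le> real m * \<rho>\<^sup>2 / ?d" using m(1) d by (simp add: field_simps power2_eq_square power3_eq_cube)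
      from mult_right_mono[OF this, of "(real k)\<^sup>2"] show ?thesis by (simp add: power_mult_distrib mult_ac)
    qed
    hence "exp (- (real m * (real k * \<rho>)\<^sup>2 / ?d)) \<le> exp (- (?d\<^sup>2 * (real k)\<^sup>2))" by simp
    moreover have "(2 * real k + 3) ^ (2 * CARD('n)\<^sup>2) \<le> exp (?d\<^sup>2 * ((real k)\<^sup>2 / 2))"
    proof -
      have "2 * real k + 3 \<le> exp ((real k)\<^sup>2 / 4)"
      proof -
        \<comment> \<open>For k >= 6 both k <= x and x >= 6 hold, so 1 + x + x^2 / 2 >= 1 + 4 x >= 2
          k + 3.\<close>
        define x where "x = (real k)\<^sup>2 / 4"
        have kx: "real k \<le> x" using mult_right_mono[of 4 "real k" "real k"] k3 by (simp add: x_def power2_eq_square)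
        hence "6 * x \<le> x * x" using k3 by (intro mult_right_mono) auto
        hence "2 * real k + 3 \<le> 1 + x + x\<^sup>2 / 2" unfolding power2_eq_square using kx k3 by linarith
        also have "\<dots> \<le> exp x" using kx k3 by (intro exp_lower_Taylor_quadratic) simp
        finally show ?thesis by (simp add: x_def)
      qed
      hence "(2 * real k + 3) ^ (2 * CARD('n)\<^sup>2) \<le> exp ((real k)\<^sup>2 / 4) ^ (2 * CARD('n)\<^sup>2)"
        by (intro power_mono) auto
      also have "\<dots> = exp (?d\<^sup>2 * ((real k)\<^sup>2 / 2))"
        by (subst exp_of_nat_mult[symmetric]) (simp add: field_simps)
      finally show ?thesis .
    qed
    ultimately have "exp (- (real m * (real k * \<rho>)\<^sup>2 / ?d)) * (2 * real k + 3) ^ (2 * CARD('n)\<^sup>2)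
        \<le> exp (- (?d\<^sup>2 * (real k)\<^sup>2)) * exp (?d\<^sup>2 * ((real k)\<^sup>2 / 2))"
      by (intro mult_mono) auto
    also have "\<dots> = exp (- (?d\<^sup>2 * (real k)\<^sup>2 / 2))" by (simp add: exp_add[symmetric])
    also have "\<dots> \<le> exp (- (?d\<^sup>2 * (real n0)\<^sup>2 / 2) - real (k - n0))"
    proof -
      have "real (k - n0) \<le> ?d\<^sup>2 * ((real k)\<^sup>2 - (real n0)\<^sup>2) / 2"
      proof -
        have "2 * real (k - n0) \<le> (real k + real n0) * (real k - real n0)"
          unfolding of_nat_diff[OF k] using k k3 n0(2) by (intro mult_right_mono) auto
        also have "\<dots> = 1 * ((real k)\<^sup>2 - (real n0)\<^sup>2)" by (simp add: power2_eq_square algebra_simps)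
        also have "\<dots> \<le> ?d\<^sup>2 * ((real k)\<^sup>2 - (real n0)\<^sup>2)"
          using d k by (intro mult_right_mono) (auto simp: power_mono)
        finally show ?thesis by simp
      qed
      thus ?thesis by (simp add: algebra_simps diff_divide_distrib)
    qed
    also have "\<dots> = exp (- (?d\<^sup>2 * (real n0)\<^sup>2 / 2)) * exp (-1) ^ (k - n0)"
      unfolding exp_of_nat_mult[symmetric] exp_add[symmetric] by simp
    also have "\<dots> \<le> exp (- (?d\<^sup>2 * (real n0)\<^sup>2 / 2)) * (1/2) ^ (k - n0)"
    proof -
      have "(2::real) \<le> exp 1" using exp_ge_add_one_self[of 1] by simp
      hence "exp (-1) \<le> (1/2 :: real)" by (simp add: exp_minus field_simps)
      thus ?thesis by (intro mult_left_mono power_mono) auto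
    qed
    finally show ?thesis .
  qed
  have geo: "(\<Sum>k\<in>{n0..K}. (1/2 :: real) ^ (k - n0)) \<le> 2"
  proof -
    have "(\<Sum>k\<in>{n0..K}. (1/2 :: real) ^ (k - n0)) \<le> (\<Sum>j\<le>K. (1/2) ^ j)"
    proof (rule sum_le_included[where i = "\<lambda>j. j + n0"])
      show "\<forall>k\<in>{n0..K}. \<exists>j\<in>{..K}. j + n0 = k \<and> (1/2 :: real) ^ (k - n0) \<le> (1/2) ^ j"
        by (intro ballI bexI[where x = "k - n0" for k]) auto
    qed auto
    also have "\<dots> \<le> (\<Sum>j. (1/2) ^ j)" by (rule sum_le_suminf) (auto simp: summable_geometric)
    also have "\<dots> = 2" using suminf_geometric[of "1/2 :: real"] by simp
    finally show ?thesis .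
  qed
  have v: "?v \<le> exp (2 * c * ?d\<^sup>2) * (\<integral>U. trs U ^ m \<partial>M)"
  proof -
    have "real m * \<rho>\<^sup>2 / ?d \<le> c * ?d\<^sup>2" using m(2) d by (simp add: field_simps power2_eq_square power3_eq_cube)
    hence "0 \<le> 2 * c * ?d\<^sup>2 + - (2 * real m * \<rho>\<^sup>2 / ?d)" by simp
    hence "1 * ?v \<le> exp (2 * c * ?d\<^sup>2 + - (2 * real m * \<rho>\<^sup>2 / ?d)) * ?v"
      by (intro mult_right_mono) auto
    hence "?v \<le> exp (2 * c * ?d\<^sup>2) * (exp (- (2 * real m * \<rho>\<^sup>2 / ?d)) * ?v)"
      by (simp only: exp_add mult.assoc mult_1)
    also have "\<dots> \<le> exp (2 * c * ?d\<^sup>2) * (\<integral>U. trs U ^ m \<partial>M)"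
      by (intro mult_left_mono trs_moment_ball_lower \<rho>) simp
    finally show ?thesis .
  qed
  have "(\<integral>U. indicat_real {U. r\<^sup>2 < hsdist U} U * trs U ^ m \<partial>M)
      \<le> (\<Sum>k\<in>{n0..K}. exp (- (?d\<^sup>2 * (real n0)\<^sup>2 / 2)) * (1/2) ^ (k - n0)) * ?v"
    by (rule order_trans[OF K]) (intro mult_right_mono sum_mono trm, auto)
  also have "\<dots> \<le> (exp (- (?d\<^sup>2 * (real n0)\<^sup>2 / 2)) * 2) * ?v"
    unfolding sum_distrib_left[symmetric] by (intro mult_right_mono mult_left_mono geo) auto
  also have "\<dots> \<le> (exp (- (?d\<^sup>2 * (real n0)\<^sup>2 / 2)) * 2) * (exp (2 * c * ?d\<^sup>2) * (\<integral>U. trs U ^ m \<partial>M))"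
    by (intro mult_left_mono v) auto
  also have "\<dots> = 2 * exp (- (?d\<^sup>2 * ((real n0)\<^sup>2 / 2 - 2 * c))) * (\<integral>U. trs U ^ m \<partial>M)"
    by (simp add: exp_add[symmetric] exp_diff algebra_simps exp_minus field_simps)
  finally show ?thesis .
qed

end

section \<open>Numerical estimates\<close>

lemma exp_1_bounds: "5/2 \<le> exp (1::real)" "exp (1::real) \<le> 272/100"
  using exp_lower_Taylor_quadratic[of "1::real"] e_less_272 by simp_all

lemma exp_nat_lower: "(5/2) ^ k \<le> exp (real k)"
proof -
  have "(5/2) ^ k \<le> exp (1::real) ^ k" by (intro power_mono exp_1_bounds) simp
  thus ?thesis by (simp add: exp_of_nat_mult[symmetric])
qed

lemma ln_le_nat:
  assumes "0 < x" "x \<le> (5/2) ^ k" shows "ln x \<le> real k"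
proof -
  have "x \<le> exp (real k)" using assms(2) exp_nat_lower[of k] by linarith
  hence "ln x \<le> ln (exp (real k))" using assms(1) by (subst ln_le_cancel_iff) auto
  thus ?thesis by simp
qed

text \<open>Reduces an upper bound for exp at a rational to a comparison of rational powers, which
  the simplifier evaluates.\<close>

lemma exp_fraction_upper:
  assumes "(272/100) ^ a \<le> x ^ b" "0 \<le> x" "b > 0"
  shows "exp (real a / real b) \<le> x"
proof -
  have "exp (real a / real b) ^ b = exp (1::real) ^ a"
    using assms(3) by (simp add: exp_of_nat_mult[symmetric])
  also have "\<dots> \<le> (272/100) ^ a" by (intro power_mono exp_1_bounds) simp
  finally have "exp (real a / real b) ^ b \<le> x ^ b" using assms(1) by linarith
  thus ?thesis using assms by (simp add: power_mono_iff)
qed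

lemma pi_bounds: "157/50 \<le> pi" "pi \<le> 63/20"
  using pi_approx by simp_all

text \<open>Here 30 pi = 6 C. The separate ln 2 cancels against \<epsilon> < 2 and yields q >=
  19/5.\<close>

lemma ln_30_pi_bounds: "19/5 + ln 2 \<le> ln (30 * pi)" "ln (30 * pi) \<le> 5"
proof -
  have "exp (real 19 / real 5) \<le> 47" by (rule exp_fraction_upper) (simp_all add: power_divide)
  also have "47 \<le> 15 * pi" using pi_bounds by simp
  finally have "19/5 \<le> ln (15 * pi)" by (subst ln_ge_iff) auto
  moreover have "ln (30 * pi) = ln 2 + ln (15 * pi)" by (subst ln_mult_pos[symmetric]) auto
  ultimately show "19/5 + ln 2 \<le> ln (30 * pi)" by simp
  have "ln (30 * pi) \<le> real 5" using pi_bounds by (intro ln_le_nat) (simp_all add: power_divide)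
  thus "ln (30 * pi) \<le> 5" by simp
qed

section \<open>Inequalities between \<open>tau\<close>, the degree \<open>m\<close> and the
  dimension\<close>

locale net_params =
  fixes \<epsilon> :: real and d :: nat
  assumes eps: "0 < \<epsilon>" "\<epsilon> < 2" and d2: "2 \<le> d"
begin

text \<open>\<open>q\<close> is the square of the quantity \<open>L\<close> occurring in \<^const>\<open>tau\<close>.\<close>

definition "q = ln (6 * Cconst / \<epsilon>)"
definition "\<tau> = tau \<epsilon> d"
definition "c0 = ln (30 * pi)"
text \<open>A lower bound for the second factor of \<open>\<tau>\<close> squared, with ln (sqrt q)
  replaced by 3/5 and sqrt q / 32 dropped. Estimates then compare the logarithmic quantities
  \<open>q\<close> and \<open>z\<close> through their product.\<close>

definition "z = ln (real d) - ln \<epsilon> + 3/5"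

lemma dpos: "0 < real d" "2 \<le> real d" using d2 by simp_all

lemma q_eq: "q = c0 - ln \<epsilon>"
proof -
  have "6 * Cconst = 30 * pi" by (simp add: Cconst_def)
  thus ?thesis unfolding q_def c0_def using eps by (simp only:) (simp add: ln_div)
qed

lemma ln_eps: "ln \<epsilon> \<le> ln 2" using eps by simp

lemma ln_d: "ln 2 \<le> ln (real d)" using dpos by simp

lemma ln2: "1/2 \<le> ln (2::real)" using ln_add_one_self_le_self2[of "-1/2"] ln_inverse[of 2] by simp

lemma q_ge: "19/5 \<le> q"
  using q_eq ln_30_pi_bounds(1) ln_eps unfolding c0_def by linarith

lemma c0_bounds: "19/5 \<le> c0" "c0 \<le> 5"
  using ln_30_pi_bounds ln2 unfolding c0_def by linarith+

lemma sqrt_q: "(sqrt q)\<^sup>2 = q" "19/10 \<le> sqrt q" "0 < sqrt q"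
proof -
  show "(sqrt q)\<^sup>2 = q" "0 < sqrt q" using q_ge by simp_all
  show "19/10 \<le> sqrt q" by (rule real_le_rsqrt) (use q_ge in \<open>simp add: power2_eq_square\<close>)
qed

lemma ln_sqrt_q: "3/5 \<le> ln (sqrt q)"
proof -
  have "exp (real 6 / real 5) \<le> 19/5" by (rule exp_fraction_upper) (simp_all add: power_divide)
  hence "exp (6/5) \<le> q" using q_ge by simp
  hence "6/5 \<le> ln q" using q_ge by (subst ln_ge_iff) auto
  thus ?thesis using q_ge by (simp add: ln_sqrt)
qed

lemma tau_sq: "\<tau>\<^sup>2 = q * (sqrt q / 32 + (ln (real d) - ln \<epsilon> + ln (sqrt q)))" "0 \<le> \<tau>"
proof -
  have "ln (real d / \<epsilon> * sqrt q) = ln (real d) - ln \<epsilon> + ln (sqrt q)"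
    using dpos eps sqrt_q by (subst ln_mult_pos) (auto simp: ln_div)
  hence t: "\<tau> = sqrt q * sqrt (sqrt q / 32 + (ln (real d) - ln \<epsilon> + ln (sqrt q)))"
    by (simp add: \<tau>_def tau_def Let_def q_def)
  moreover have nn: "0 \<le> sqrt q / 32 + (ln (real d) - ln \<epsilon> + ln (sqrt q))"
    using sqrt_q ln_sqrt_q ln_d ln_eps by simp
  ultimately show "\<tau>\<^sup>2 = q * (sqrt q / 32 + (ln (real d) - ln \<epsilon> + ln (sqrt q)))" 
    using q_ge by (simp add: power_mult_distrib)
  show "0 \<le> \<tau>" unfolding t using nn q_ge by simp
qed

lemma z_q: "z = ln (real d) + q - c0 + 3/5"
  by (simp add: z_def q_eq)

lemma tau_ge_z: "q * z \<le> \<tau>\<^sup>2"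
  unfolding tau_sq z_def using q_ge sqrt_q ln_sqrt_q by (intro mult_left_mono) auto

lemma z_ge: "q / 8 \<le> z"
  using z_q q_eq c0_bounds ln_d ln_eps ln2 by linarith

lemma tau_ge: "3/2 \<le> \<tau>"
proof -
  have "(3/2)\<^sup>2 \<le> (19/5) * (3/5 :: real)" by (simp add: power2_eq_square)
  also have "\<dots> \<le> q * z" using q_ge ln_d ln_eps by (intro mult_mono) (auto simp: z_def)
  also have "\<dots> \<le> \<tau>\<^sup>2" by (rule tau_ge_z)
  finally show ?thesis by (rule power2_le_imp_le) (rule tau_sq)
qed

lemma dim_ge: "3/4 * (real d)\<^sup>2 \<le> real (d\<^sup>2 - 1)" "0 < real (d\<^sup>2 - 1)" "real (d\<^sup>2 - 1) = (real d)\<^sup>2 - 1"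
proof -
  have "4 \<le> d\<^sup>2" using power_mono[OF d2, of 2] by simp
  moreover have "4 \<le> (real d)\<^sup>2" using power_mono[OF dpos(2), of 2] by simp
  ultimately show "3/4 * (real d)\<^sup>2 \<le> real (d\<^sup>2 - 1)" "0 < real (d\<^sup>2 - 1)" "real (d\<^sup>2 - 1) = (real d)\<^sup>2 - 1"
    by (auto simp: of_nat_diff)
qed

text \<open>The left side is the logarithm of 16 divided by the lower bound for the mean. As exp 1 *
  w >= 16, the one dimension between d^2 - 1 and d^2 absorbs ln 16.\<close>

lemma entropy_bound:
  assumes u: "1 \<le> u" "u \<le> w" and w: "15/2 \<le> w" and E: "(1 + ln w) * (real d)\<^sup>2 \<le> E"
  shows "ln 16 + real (d\<^sup>2 - 1) * (1 + ln u) \<le> E"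
proof -
  have "(16::real) \<le> exp 1 * w"
    using mult_mono[OF exp_1_bounds(1) w] by simp
  hence "ln 16 \<le> ln (exp 1 * w)" using w by simp
  also have "\<dots> = 1 + ln w" using w by (simp add: ln_mult)
  finally have "ln 16 \<le> 1 + ln w" .
  moreover have "real (d\<^sup>2 - 1) * (1 + ln u) \<le> real (d\<^sup>2 - 1) * (1 + ln w)"
    using u by (intro mult_left_mono) auto
  moreover have "real (d\<^sup>2 - 1) * (1 + ln w) = (1 + ln w) * (real d)\<^sup>2 - (1 + ln w)"
    unfolding dim_ge(3) by (simp add: algebra_simps)
  ultimately show ?thesis using E by linarith
qed

text \<open>The degree \<open>m\<close> is chosen so that the pointwise tail of \<open>trs ^ m\<close> and the truncation
  error both beat its mean. This fails when \<open>ln d\<close> is much larger than \<open>q\<close>; then a smaller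
  \<open>m\<close> suffices because the tail is measured in the mean.\<close>

lemma moderate_dim:
  fixes m t :: nat
  assumes a: "ln (real d) \<le> 7 * q" and t: "5 * real d powr (5/2) / \<epsilon> * \<tau> \<le> real t"
    and m: "m = nat \<lceil>6 * real d ^ 3 * \<tau> / \<epsilon>\<^sup>2\<rceil>"
  shows "0 < m"
    and "ln 16 + real (d\<^sup>2 - 1) * (1 + ln (1 + real m / real (d\<^sup>2 - 1))) \<le> (real t)\<^sup>2 / real m"
    and "ln 16 + real (d\<^sup>2 - 1) * (1 + ln (1 + real m / real (d\<^sup>2 - 1))) \<le> real m * (5/6 * \<epsilon>)\<^sup>2 / real d"
    and "(1 + real m / real (d\<^sup>2 - 1)) * \<epsilon>\<^sup>2 \<le> 6 * q * (real d)\<^sup>2"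
proof -
  let ?d = "real d"
  \<comment> \<open>The factor 6 in \<open>m\<close> balances the two rates: t^2 / m is at least
    75/19 \<tau> d^2 and m (5/6 \<epsilon>)^2 / d at least 25/6 \<tau> d^2, both above the common
    target 39/10 \<tau> d^2. Rounding up raises 6 to at most 19/3, since d^2 y >= 3.\<close>
  define y where "y = ?d * \<tau> / \<epsilon>\<^sup>2"
  have e2: "0 < \<epsilon>\<^sup>2" "\<epsilon>\<^sup>2 \<le> 4" using eps power_mono[of \<epsilon> 2 2] by auto
  have y: "3/4 \<le> y"
  proof -
    have "3 \<le> ?d * \<tau>" using mult_mono[OF dpos(2) tau_ge] by simp
    thus ?thesis unfolding y_def using e2 by (simp add: field_simps)
  qed
  have yd: "6 * ?d ^ 3 * \<tau> / \<epsilon>\<^sup>2 = 6 * (?d\<^sup>2 * y)" by (simp add: y_def power2_eq_square power3_eq_cube)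
  have d4: "4 \<le> ?d\<^sup>2" using power_mono[OF dpos(2), of 2] by simp
  have dy: "3 \<le> ?d\<^sup>2 * y" using mult_mono[OF d4 y] by simp
  have m1: "6 * (?d\<^sup>2 * y) \<le> real m" unfolding m yd by linarith
  have m2: "real m \<le> 19/3 * (?d\<^sup>2 * y)" unfolding m yd using dy by linarith
  have mpos: "0 < real m" using m1 dy by linarith
  thus "0 < m" by simp
  define u where "u = 1 + real m / real (d\<^sup>2 - 1)"
  have u1: "1 \<le> u" by (simp add: u_def)
  have u2: "u \<le> 10 * y"
  proof -
    have "real m / real (d\<^sup>2 - 1) \<le> (19/3 * (?d\<^sup>2 * y)) / (3/4 * ?d\<^sup>2)"
      using m2 dim_ge d4 y dpos d2 by (intro frac_le) auto
    also have "\<dots> = 76/9 * y" using dpos by (simp add: field_simps)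
    finally show ?thesis using y by (simp add: u_def)
  qed
  have key: "1 + ln (10 * y) \<le> 39/10 * \<tau>"
  proof -
    have zq: "z + q \<le> 16/5 * \<tau>"
    proof (rule power2_le_imp_le)
      \<comment> \<open>The ratio z / q lies in [1/8, 8], the upper end being the case assumption on
        ln d. So (z + q)^2 / (q z) is at most its value 81/8 at the ends.\<close>
      have "0 \<le> (8 * z - q) * (8 * q - z)"
        using z_ge z_q a c0_bounds by (intro mult_nonneg_nonneg) linarith+
      hence "(z + q)\<^sup>2 \<le> 81/8 * (q * z)" by (simp add: power2_eq_square algebra_simps)
      also have "\<dots> \<le> 256/25 * \<tau>\<^sup>2" using tau_ge_z zero_le_power2[of \<tau>] by linarith
      finally show "(z + q)\<^sup>2 \<le> (16/5 * \<tau>)\<^sup>2" by (simp add: power_mult_distrib power_divide)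
    qed (use tau_ge in simp)
    have "ln (10 * y) = ln 10 + ln ?d + ln \<tau> - 2 * ln \<epsilon>"
      unfolding y_def using dpos tau_ge eps by (simp add: ln_mult ln_div ln_realpow)
    moreover have "ln (10::real) \<le> 3"
      using ln_le_nat[of 10 3] by (simp add: power_divide)
    moreover have "ln \<tau> \<le> \<tau> / 2"
    proof -
      have "ln (\<tau> / 2) \<le> \<tau> / 2 - 1" using tau_ge by (intro ln_le_minus_one) simp
      moreover have "ln (\<tau> / 2) = ln \<tau> - ln 2" using tau_ge by (simp add: ln_div)
      moreover have "ln 2 \<le> (1::real)" using ln_le_minus_one[of 2] by simp
      ultimately show ?thesis by linarith
    qed
    ultimately show ?thesis using zq z_q q_eq c0_bounds tau_ge by linarith
  qed
  hence E: "(1 + ln (10 * y)) * ?d\<^sup>2 \<le> 39/10 * \<tau> * ?d\<^sup>2" by (intro mult_right_mono) auto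
  have "39/10 * \<tau> * ?d\<^sup>2 \<le> (real t)\<^sup>2 / real m"
  proof -
    have "(5 * ?d powr (5/2) / \<epsilon> * \<tau>)\<^sup>2 = 25 * ?d ^ 5 * \<tau>\<^sup>2 / \<epsilon>\<^sup>2"
      using dpos by (simp add: power_mult_distrib power_divide powr_power)
    also have "\<dots> = 25 * ?d\<^sup>2 * \<tau> * (?d\<^sup>2 * y)" by (simp add: y_def power2_eq_square eval_nat_numeral)
    finally have "25 * ?d\<^sup>2 * \<tau> * (?d\<^sup>2 * y) \<le> (real t)\<^sup>2"
      using power_mono[OF t, of 2] dpos eps tau_ge by simp
    moreover have "39/10 * \<tau> * ?d\<^sup>2 * real m \<le> 25 * ?d\<^sup>2 * \<tau> * (?d\<^sup>2 * y)"
    proof -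
      have "39/10 * (\<tau> * ?d\<^sup>2) * real m \<le> 39/10 * (\<tau> * ?d\<^sup>2) * (19/3 * (?d\<^sup>2 * y))"
        using m2 tau_ge by (intro mult_left_mono) auto
      also have "\<dots> = 247/10 * ((\<tau> * ?d\<^sup>2) * (?d\<^sup>2 * y))" by simp
      also have "\<dots> \<le> 25 * ((\<tau> * ?d\<^sup>2) * (?d\<^sup>2 * y))"
        using tau_ge y by (intro mult_right_mono) auto
      finally show ?thesis by (simp add: mult_ac)
    qed
    ultimately show ?thesis using mpos by (simp add: pos_le_divide_eq)
  qed
  thus "ln 16 + real (d\<^sup>2 - 1) * (1 + ln (1 + real m / real (d\<^sup>2 - 1))) \<le> (real t)\<^sup>2 / real m"
    using entropy_bound[OF u1 u2 _ order_refl] E y unfolding u_def by linarith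
  have "39/10 * \<tau> * ?d\<^sup>2 \<le> real m * (5/6 * \<epsilon>)\<^sup>2 / ?d"
  proof -
    have "39/10 * \<tau> * ?d\<^sup>2 \<le> 25/6 * \<tau> * ?d\<^sup>2" using tau_ge by (intro mult_right_mono) auto
    also have "\<dots> = 6 * (?d\<^sup>2 * y) * (5/6 * \<epsilon>)\<^sup>2 / ?d"
      using dpos eps by (simp add: y_def power2_eq_square field_simps)
    also have "\<dots> \<le> real m * (5/6 * \<epsilon>)\<^sup>2 / ?d"
      using m1 dpos by (intro divide_right_mono mult_right_mono) auto
    finally show ?thesis .
  qed
  thus "ln 16 + real (d\<^sup>2 - 1) * (1 + ln (1 + real m / real (d\<^sup>2 - 1))) \<le> real m * (5/6 * \<epsilon>)\<^sup>2 / real d"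
    using entropy_bound[OF u1 u2 _ order_refl] E y unfolding u_def by linarith
  have "5 * \<tau> \<le> 3 * q * ?d"
  \<comment> \<open>This is 10 d \<tau> <= 6 q d^2 up to a common factor; the left side bounds u
    \<epsilon>^2.\<close>
  proof (rule power2_le_imp_le)
    have "sqrt q \<le> q" using q_ge sqrt_q mult_left_mono[of 1 "sqrt q" "sqrt q"] by (simp add: power2_eq_square)
    moreover have "ln (sqrt q) \<le> q / 8 + 1/5"
    proof -
      have "ln (q / 4) \<le> q / 4 - 1" using q_ge by (intro ln_le_minus_one) simp
      moreover have "ln (q / 4) = ln q - 2 * ln 2" using q_ge ln_realpow[of 2 2] by (simp add: ln_div)
      moreover have "ln 2 \<le> (7/10 :: real)"
      proof -
        have "ln (2::real) \<le> 25/36" by (rule ln2_le_25_over_36)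
        thus ?thesis by simp
      qed
      ultimately show ?thesis using q_ge by (simp add: ln_sqrt)
    qed
    moreover have "ln ?d \<le> ?d - 1" using dpos by (intro ln_le_minus_one) auto
    moreover have "- ln \<epsilon> = q - c0" using q_eq by simp
    ultimately have "sqrt q / 32 + (ln ?d - ln \<epsilon> + ln (sqrt q)) \<le> q / 32 + ((?d - 1) + (q - c0) + (q / 8 + 1/5))"
      by linarith
    hence "25 * (sqrt q / 32 + (ln ?d - ln \<epsilon> + ln (sqrt q))) \<le> 36 * q + 25 * (?d - 2)"
      using c0_bounds q_ge by (simp add: field_simps)
    also have "\<dots> \<le> 9 * q * ?d\<^sup>2"
    proof -
      have "25 * (?d - 2) \<le> 36 * q * (?d - 2)" using q_ge dpos by (intro mult_right_mono) auto
      moreover have "9 * q * (4 * ?d - 4) \<le> 9 * q * ?d\<^sup>2"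
        using q_ge zero_le_power2[of "?d - 2"] by (intro mult_left_mono) (auto simp: power2_eq_square algebra_simps)
      ultimately show ?thesis by (simp add: algebra_simps)
    qed
    finally have "q * (25 * (sqrt q / 32 + (ln ?d - ln \<epsilon> + ln (sqrt q)))) \<le> q * (9 * q * ?d\<^sup>2)"
      using q_ge by (intro mult_left_mono) auto
    thus "(5 * \<tau>)\<^sup>2 \<le> (3 * q * ?d)\<^sup>2" by (simp add: power_mult_distrib tau_sq power2_eq_square[of q] mult_ac)
  qed (use q_ge in simp)
  hence "2 * ?d * (5 * \<tau>) \<le> 2 * ?d * (3 * q * ?d)" by (intro mult_left_mono) auto
  moreover have "u * \<epsilon>\<^sup>2 \<le> 10 * y * \<epsilon>\<^sup>2" using u2 by (intro mult_right_mono) auto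
  moreover have "10 * y * \<epsilon>\<^sup>2 = 10 * ?d * \<tau>" using eps by (simp add: y_def)
  moreover have "2 * ?d * (5 * \<tau>) = 10 * ?d * \<tau>" "2 * ?d * (3 * q * ?d) = 6 * q * ?d\<^sup>2"
    by (simp_all add: power2_eq_square)
  ultimately show "(1 + real m / real (d\<^sup>2 - 1)) * \<epsilon>\<^sup>2 \<le> 6 * q * (real d)\<^sup>2"
    unfolding u_def by linarith
qed

text \<open>Here \<open>m\<close> carries \<open>q\<close> in place of \<tau>, so that \<rho> =
  \<epsilon> / (4 sqrt q) satisfies m \<rho>^2 = d^3 up to rounding, the scale required by
  \<open>trs_tail_bound\<close>. The smaller \<open>m\<close> leaves t^2 / m at least 25/17 z
  d^2.\<close>

lemma large_dim:
  fixes m t :: nat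
  assumes a: "7 * q < ln (real d)" and t: "5 * real d powr (5/2) / \<epsilon> * \<tau> \<le> real t"
    and m: "m = nat \<lceil>16 * real d ^ 3 * q / \<epsilon>\<^sup>2\<rceil>"
  shows "0 < m"
    and "ln 16 + real (d\<^sup>2 - 1) * (1 + ln (1 + real m / real (d\<^sup>2 - 1))) \<le> (real t)\<^sup>2 / real m"
    and "(1 + real m / real (d\<^sup>2 - 1)) * \<epsilon>\<^sup>2 \<le> 6 * q * (real d)\<^sup>2"
    and "real d ^ 3 \<le> real m * (\<epsilon> / (4 * sqrt q))\<^sup>2" "real m * (\<epsilon> / (4 * sqrt q))\<^sup>2 \<le> 17/16 * real d ^ 3"
proof -
  let ?d = "real d"
  define y where "y = ?d * q / \<epsilon>\<^sup>2"
  have e2: "0 < \<epsilon>\<^sup>2" "\<epsilon>\<^sup>2 \<le> 4" using eps power_mono[of \<epsilon> 2 2] by auto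
  have y: "19/10 \<le> y"
  proof -
    have "38/5 \<le> ?d * q" using mult_mono[OF dpos(2) q_ge] by simp
    thus ?thesis unfolding y_def using e2 by (simp add: field_simps)
  qed
  have yd: "16 * ?d ^ 3 * q / \<epsilon>\<^sup>2 = 16 * (?d\<^sup>2 * y)" by (simp add: y_def power2_eq_square power3_eq_cube)
  have d4: "4 \<le> ?d\<^sup>2" using power_mono[OF dpos(2), of 2] by simp
  have dy: "1 \<le> ?d\<^sup>2 * y" using mult_mono[OF d4 y] by simp
  have m1: "16 * (?d\<^sup>2 * y) \<le> real m" unfolding m yd by linarith
  have m2: "real m \<le> 17 * (?d\<^sup>2 * y)" unfolding m yd using dy by linarith
  have mpos: "0 < real m" using m1 dy by linarith
  thus "0 < m" by simp
  define u where "u = 1 + real m / real (d\<^sup>2 - 1)"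
  have u1: "1 \<le> u" by (simp add: u_def)
  have u2: "u \<le> 24 * y"
  proof -
    have "real m / real (d\<^sup>2 - 1) \<le> (17 * (?d\<^sup>2 * y)) / (3/4 * ?d\<^sup>2)"
      using m2 dim_ge d4 y dpos d2 by (intro frac_le) auto
    also have "\<dots> = 68/3 * y" using dpos by (simp add: field_simps)
    finally show ?thesis using y by (simp add: u_def)
  qed
  \<comment> \<open>The right side exceeds ln d by a further 8/17 ln d > 56/17 q, which pays for - 2
    ln \<epsilon> and ln q.\<close>
  have key: "1 + ln (24 * y) \<le> 25/17 * z"
  proof -
    have "ln (24 * y) = ln 24 + ln ?d + ln q - 2 * ln \<epsilon>"
      unfolding y_def using dpos q_ge eps by (simp add: ln_mult ln_div ln_realpow)
    moreover have "ln (24::real) \<le> 4"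
      using ln_le_nat[of 24 4] by (simp add: power_divide)
    moreover have "ln q \<le> q - 1" using q_ge by (intro ln_le_minus_one) simp
    ultimately show ?thesis using z_q q_eq c0_bounds a q_ge by linarith
  qed
  hence E: "(1 + ln (24 * y)) * ?d\<^sup>2 \<le> 25/17 * z * ?d\<^sup>2" by (intro mult_right_mono) auto
  have "25/17 * z * ?d\<^sup>2 \<le> (real t)\<^sup>2 / real m"
  proof -
    have "(5 * ?d powr (5/2) / \<epsilon> * \<tau>)\<^sup>2 = 25 * ?d ^ 5 * \<tau>\<^sup>2 / \<epsilon>\<^sup>2"
      using dpos by (simp add: power_mult_distrib power_divide powr_power)
    moreover have "25 * ?d ^ 5 * (q * z) / \<epsilon>\<^sup>2 \<le> 25 * ?d ^ 5 * \<tau>\<^sup>2 / \<epsilon>\<^sup>2"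
      using tau_ge_z by (intro divide_right_mono mult_left_mono) auto
    moreover have "25 * ?d ^ 5 * (q * z) / \<epsilon>\<^sup>2 = 25 * ?d\<^sup>2 * z * (?d\<^sup>2 * y)" 
      by (simp add: y_def power2_eq_square eval_nat_numeral)
    ultimately have "25 * ?d\<^sup>2 * z * (?d\<^sup>2 * y) \<le> (real t)\<^sup>2"
      using power_mono[OF t, of 2] dpos eps tau_ge by simp
    moreover have "25/17 * z * ?d\<^sup>2 * real m \<le> 25 * ?d\<^sup>2 * z * (?d\<^sup>2 * y)"
    proof -
      have "25/17 * (z * ?d\<^sup>2) * real m \<le> 25/17 * (z * ?d\<^sup>2) * (17 * (?d\<^sup>2 * y))"
        using m2 z_ge q_ge by (intro mult_left_mono mult_nonneg_nonneg) auto
      thus ?thesis by (simp add: mult_ac)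
    qed
    ultimately have "25/17 * z * ?d\<^sup>2 * real m \<le> (real t)\<^sup>2" by linarith
    thus ?thesis using mpos by (simp only: pos_le_divide_eq)
  qed
  thus "ln 16 + real (d\<^sup>2 - 1) * (1 + ln (1 + real m / real (d\<^sup>2 - 1))) \<le> (real t)\<^sup>2 / real m"
    using entropy_bound[OF u1 u2 _ order_refl] E y unfolding u_def by linarith
  have "4 \<le> ?d" using ln_le_minus_one[of ?d] dpos a q_ge by linarith
  hence "6 * q * ?d * 4 \<le> 6 * q * ?d * ?d" using q_ge by (intro mult_left_mono) auto
  moreover have "u * \<epsilon>\<^sup>2 \<le> 24 * y * \<epsilon>\<^sup>2" using u2 by (intro mult_right_mono) auto
  moreover have "24 * y * \<epsilon>\<^sup>2 = 24 * ?d * q" using eps by (simp add: y_def)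
  moreover have "6 * q * ?d * 4 = 24 * ?d * q" "6 * q * ?d * ?d = 6 * q * ?d\<^sup>2"
    by (simp_all add: power2_eq_square)
  ultimately show "(1 + real m / real (d\<^sup>2 - 1)) * \<epsilon>\<^sup>2 \<le> 6 * q * (real d)\<^sup>2"
    unfolding u_def by linarith
  have r: "(\<epsilon> / (4 * sqrt q))\<^sup>2 = \<epsilon>\<^sup>2 / (16 * q)" by (simp add: power_divide power_mult_distrib sqrt_q)
  have yq: "?d\<^sup>2 * y * (\<epsilon>\<^sup>2 / (16 * q)) = ?d ^ 3 / 16"
    using eps q_ge by (simp add: y_def power2_eq_square power3_eq_cube)
  show "real d ^ 3 \<le> real m * (\<epsilon> / (4 * sqrt q))\<^sup>2"
    using mult_right_mono[OF m1, of "\<epsilon>\<^sup>2 / (16 * q)"] yq q_ge unfolding r by (simp add: mult.assoc)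
  show "real m * (\<epsilon> / (4 * sqrt q))\<^sup>2 \<le> 17/16 * real d ^ 3"
  proof -
    have "real m * (\<epsilon>\<^sup>2 / (16 * q)) \<le> 17 * (?d\<^sup>2 * y) * (\<epsilon>\<^sup>2 / (16 * q))"
      using m2 q_ge by (intro mult_right_mono) auto
    also have "\<dots> = 17 * (?d\<^sup>2 * y * (\<epsilon>\<^sup>2 / (16 * q)))" by simp
    finally show ?thesis unfolding r yq by simp
  qed
qed

end

section \<open>The support is a net\<close>

text \<open>Consequently a point far from the support in \<open>Dch\<close> is far in
  \<open>nrm\<close> for every phase. \<open>Arg2pi\<close> supplies the angle in the half-open
  range of the infimum.\<close>

lemma Dch_le_nrm:
  fixes W V :: "complex^'n::finite^'n"
  assumes "cmod w = 1"
  shows "Dch W V \<le> nrm (W - mat w ** V)"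
proof -
  obtain \<phi> where \<phi>: "\<phi> \<in> {0..<2 * pi}" "w = exp (\<i> * complex_of_real \<phi>)"
    using Arg2pi[of w] assms by (intro that[of "Arg2pi w"]) (auto simp: is_Arg_def)
  have nn: "0 \<le> opnorm UNIV A" for A :: "'n \<Rightarrow> 'n \<Rightarrow> complex"
    by (rule opnorm_bound_nonneg[OF _ _ order_refl]) simp_all
  have "Dch W V \<le> opnorm UNIV (\<lambda>i j. W $ i $ j - exp (\<i> * complex_of_real \<phi>) * V $ i $ j)"
    unfolding Dch_def by (rule cINF_lower) (use \<phi> nn in \<open>auto intro!: bdd_belowI[of _ 0]\<close>)
  also have "\<dots> = opnorm UNIV (\<lambda>i j. (W - mat w ** V) $ i $ j)" by (simp add: \<phi>(2) mat_mult_nth)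
  also have "\<dots> \<le> nrm (W - mat w ** V)" by (rule opnorm_le_nrm)
  finally show ?thesis .
qed

text \<open>Triangle inequality modulo phases, with \<open>w * cnj y\<close> as the relative phase,
  followed by spectral norm <= Frobenius norm. This carries a spectral gap over to the
  trace.\<close>

lemma far_hsdist:
  fixes W V x :: "complex^'n::finite^'n"
  assumes V: "unitary V" and x: "unitary x" "x \<in> pball \<kappa> W"
    and far: "\<And>w. cmod w = 1 \<Longrightarrow> \<epsilon> < nrm (W - mat w ** V)" and "\<kappa> \<le> \<epsilon>"
  shows "(\<epsilon> - \<kappa>)\<^sup>2 < hsdist (cadj V ** x)"
proof -
  obtain w where w: "cmod w = 1" "nrm (W - mat w ** x) < \<kappa>" using x(2) by (auto simp: pball_def)
  obtain y where y: "cmod y = 1" "(norm (V - mat y ** x))\<^sup>2 = hsdist (cadj V ** x)"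
    using norm_diff_phase_exists[OF V x(1)] by (auto simp: hsdist_def)
  have wy: "cmod (w * cnj y) = 1" using w y by (simp add: norm_mult)
  have "mat (w * cnj y) ** (mat y ** x - V) = mat (w * (cnj y * y)) ** x - mat (w * cnj y) ** V"
    by (simp add: matrix_mul_diff_distrib matrix_mul_assoc mat_mult_mat mult.assoc)
  also have "cnj y * y = 1" using y(1) by (simp add: complex_norm_square[symmetric] mult.commute)
  finally have "nrm (mat w ** x - mat (w * cnj y) ** V) = nrm (mat y ** x - V)"
    using nrm_mat_mult[of "w * cnj y" "mat y ** x - V"] wy by simp
  hence "nrm (W - mat (w * cnj y) ** V) \<le> nrm (W - mat w ** x) + nrm (V - mat y ** x)"
    using nrm_triangle_diff[of W "mat (w * cnj y) ** V" "mat w ** x"] by (simp add: nrm_minus_commute)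
  moreover have "nrm (V - mat y ** x) \<le> norm (V - mat y ** x)" by (rule nrm_le_norm)
  ultimately have "\<epsilon> - \<kappa> < norm (V - mat y ** x)" using far[OF wy] w(2) by linarith
  hence "(\<epsilon> - \<kappa>)\<^sup>2 < (norm (V - mat y ** x))\<^sup>2" using \<open>\<kappa> \<le> \<epsilon>\<close> by (intro power_strict_mono) auto
  thus ?thesis by (simp add: y(2))
qed

context haar_measure
begin

text \<open>Keeps the factor \<open>prob (pball \<kappa> W)\<close>, so a pointwise bound on
  \<open>trs\<close> suffices; this serves moderate dimensions.\<close>

lemma tail_pointwise:
  fixes V W :: "complex^'n^'n"
  assumes V: "unitary V" and far: "\<And>w. cmod w = 1 \<Longrightarrow> \<epsilon> < nrm (W - mat w ** V)" and "\<kappa> \<le> \<epsilon>"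
  shows "trs_on (pball \<kappa> W) (cadj V) m
    \<le> prob (pball \<kappa> W) * exp (- (real m * (\<epsilon> - \<kappa>)\<^sup>2 / real CARD('n)))"
proof -
  let ?c = "exp (- (real m * (\<epsilon> - \<kappa>)\<^sup>2 / real CARD('n)))"
  have "trs_on (pball \<kappa> W) (cadj V) m \<le> (\<integral>x. ?c * indicat_real (pball \<kappa> W) x \<partial>M)"
  proof (rule integral_mono_AE)
    show "integrable M (\<lambda>x. indicat_real (pball \<kappa> W) x * trs (cadj V ** x) ^ m)"
      by (rule integrable_trs_power) (use V in auto)
    show "AE x in M. indicat_real (pball \<kappa> W) x * trs (cadj V ** x) ^ m \<le> ?c * indicat_real (pball \<kappa> W) x"
      using AE_unitary
    proof eventually_elim
      case (elim x)
      show ?case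
        using trs_power_le[of "cadj V ** x" "(\<epsilon> - \<kappa>)\<^sup>2" m] far_hsdist[OF V elim _ far \<open>\<kappa> \<le> \<epsilon>\<close>] V elim
        by (auto simp: indicator_def unitary_mult less_imp_le)
    qed
  qed auto
  thus ?thesis by (simp add: mult.commute)
qed

text \<open>Enlarges the ball to the whole far region and translates V to the identity. The measure
  of the ball is lost as a factor, but the tail can be compared with the mean; this serves large
  dimensions.\<close>

lemma tail_global:
  fixes V W :: "complex^'n^'n"
  assumes V: "unitary V" and far: "\<And>w. cmod w = 1 \<Longrightarrow> \<epsilon> < nrm (W - mat w ** V)" and "\<kappa> \<le> \<epsilon>"
  shows "trs_on (pball \<kappa> W) (cadj V) m
    \<le> (\<integral>U. indicat_real {U. (\<epsilon> - \<kappa>)\<^sup>2 < hsdist U} U * trs U ^ m \<partial>M)"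
proof -
  let ?f = "\<lambda>U. indicat_real {U :: complex^'n^'n. (\<epsilon> - \<kappa>)\<^sup>2 < hsdist U} U * trs U ^ m"
  have [measurable]: "{U :: complex^'n^'n. (\<epsilon> - \<kappa>)\<^sup>2 < hsdist U} \<in> sets borel" by measurable
  have fm: "?f \<in> borel_measurable borel" by measurable
  have "trs_on (pball \<kappa> W) (cadj V) m \<le> (\<integral>x. ?f (cadj V ** x) \<partial>M)"
  proof (rule integral_mono_AE)
    show "integrable M (\<lambda>x. indicat_real (pball \<kappa> W) x * trs (cadj V ** x) ^ m)"
      by (rule integrable_trs_power) (use V in auto)
    show "integrable M (\<lambda>x. ?f (cadj V ** x))"
    proof (rule integrable_bounded[where B = 1])
      show "(\<lambda>x. ?f (cadj V ** x)) \<in> borel_measurable borel"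
        by (rule measurable_compose[OF measurable_matrix_mult fm])
    qed (use V in \<open>auto simp: trs_le_1 power_le_one indicator_def unitary_mult\<close>)
    show "AE x in M. indicat_real (pball \<kappa> W) x * trs (cadj V ** x) ^ m \<le> ?f (cadj V ** x)"
      using AE_unitary
    proof eventually_elim
      case (elim x)
      show ?case
        using far_hsdist[OF V elim _ far \<open>\<kappa> \<le> \<epsilon>\<close>] by (auto simp: indicator_def)
    qed
  qed
  also have "\<dots> = (\<integral>x. ?f x \<partial>M)" by (rule integral_shift[OF fm]) (use V in simp)
  finally show ?thesis .
qed

lemma prob_pball_lower':
  assumes "0 < \<epsilon>" "\<epsilon> < 2" "unitary W"
  shows "12 / \<epsilon> * (\<epsilon> / 234) ^ (CARD('n)\<^sup>2) \<le> prob (pball (\<epsilon> / 6) W)"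
proof -
  let ?k = "CARD('n)\<^sup>2" and ?p = "prob (pball (\<epsilon> / 6) W)"
  have "12 / \<epsilon> \<le> (9 * (1 + 4 / (\<epsilon> / 6))) ^ ?k * ?p"
    using prob_pball_lower[of "\<epsilon> / 6" W] assms by simp
  \<comment> \<open>234 = 9 * 26, from 1 + 24 / \<epsilon> <= 26 / \<epsilon> for \<epsilon> <
    2.\<close>
  also have "\<dots> \<le> (234 / \<epsilon>) ^ ?k * ?p"
    using assms by (intro mult_right_mono power_mono) (auto simp: field_simps)
  finally have "12 / \<epsilon> * (\<epsilon> / 234) ^ ?k \<le> (234 / \<epsilon>) ^ ?k * ?p * (\<epsilon> / 234) ^ ?k"
    using assms by (intro mult_right_mono) auto
  also have "\<dots> = (234 / \<epsilon> * (\<epsilon> / 234)) ^ ?k * ?p" by (simp only: power_mult_distrib mult_ac)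
  also have "234 / \<epsilon> * (\<epsilon> / 234) = 1" using assms by simp
  finally show ?thesis by simp
qed

end

text \<open>The powers match because Q^2 e u <= \<epsilon> / 234 (with e = exp 1), and the factor 12
  / \<epsilon> in the ball volume cancels the \<epsilon> of the surplus power d^2 = n + 1. So the
  product of ball volume and mean is at least 12/234 Q^(2n), against 4 \<delta>^2 <= Q^(2n) /
  256.\<close>

lemma (in haar_pair) support_criterion:
  fixes W :: "complex^'n^'n" and m t :: nat and \<epsilon> \<delta> :: real
  defines "n \<equiv> CARD('n)\<^sup>2 - 1" and "J \<equiv> \<integral>U. trs U ^ m \<partial>\<mu>" and "u \<equiv> 1 + real m / real (CARD('n)\<^sup>2 - 1)"
    and "q \<equiv> ln (6 * Cconst / \<epsilon>)"
  assumes d2: "2 \<le> CARD('n)" and eps: "0 < \<epsilon>" "\<epsilon> < 2" and W: "unitary W"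
    and op: "opnorm (tidx t) (dif t) \<le> \<delta>"
    and \<delta>: "\<delta> \<le> 1/32 * (\<epsilon> powr (3/2) / (4 * Cconst * sqrt q * real CARD('n))) ^ n"
    and "0 < m" and q: "0 < q"
    and c2: "ln 16 + real n * (1 + ln u) \<le> (real t)\<^sup>2 / real m"
    and c3: "u * \<epsilon>\<^sup>2 \<le> 6 * q * (real CARD('n))\<^sup>2"
    and tail: "AE V in \<nu>. trs_on (pball (\<epsilon> / 6) W) (cadj V) m \<le> prob (pball (\<epsilon> / 6) W) * J / 8"
  shows False
proof -
  let ?d = "real CARD('n)" and ?p = "prob (pball (\<epsilon> / 6) W)"
  define Q where "Q = \<epsilon> powr (3/2) / (4 * Cconst * sqrt q * ?d)"
  have d: "2 \<le> ?d" using d2 by simp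
  have \<delta>0: "0 \<le> \<delta>" by (rule opnorm_bound_nonneg[OF finite_tidx tidx_nonempty op])
  have u1: "1 \<le> u" by (simp add: u_def)
  have Jlow: "1 \<le> (exp 1 * u) ^ n * J"
    using trs_moment_lower'[OF d2, of m] by (simp add: n_def u_def J_def)
  have eu: "(exp 1 * u) ^ n = exp (real n * (1 + ln u))"
    using u1 by (simp add: exp_of_nat_mult exp_add)
  have J0: "0 < J"
  proof (rule ccontr)
    assume "\<not> 0 < J"
    hence "(exp 1 * u) ^ n * J \<le> 0" using u1 by (intro mult_nonneg_nonpos) auto
    thus False using Jlow by simp
  qed
  have crit: "?p * J \<le> 4 * \<delta>\<^sup>2"
    unfolding J_def
  proof (rule expander_criterion[OF op \<delta>0 \<open>0 < m\<close>])
    have "16 * exp (- (real t)\<^sup>2 / real m) * (exp 1 * u) ^ n = exp (ln 16 + real n * (1 + ln u) - (real t)\<^sup>2 / real m)"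
      unfolding eu exp_diff exp_add by (simp add: exp_minus field_simps)
    also have "\<dots> \<le> 1" using c2 by simp
    also have "\<dots> \<le> (exp 1 * u) ^ n * J" by (rule Jlow)
    finally have "(exp 1 * u) ^ n * (16 * exp (- (real t)\<^sup>2 / real m)) \<le> (exp 1 * u) ^ n * J"
      by (simp add: mult.commute)
    hence "16 * exp (- (real t)\<^sup>2 / real m) \<le> J" by (rule mult_left_le_imp_le) (use u1 in simp)
    thus "2 * exp (- (real t)\<^sup>2 / real m) \<le> (\<integral>U. trs U ^ m \<partial>\<mu>) / 8" unfolding J_def by simp
  qed (use tail in \<open>auto simp: J_def\<close>)
  have Q2: "Q\<^sup>2 = \<epsilon> ^ 3 / (16 * Cconst\<^sup>2 * q * ?d\<^sup>2)"
  proof -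
    have "(\<epsilon> powr (3/2))\<^sup>2 = \<epsilon> ^ 3" using eps by (simp add: powr_power)
    thus ?thesis using q by (simp add: Q_def power_divide power_mult_distrib)
  qed
  have Q0: "0 < Q" unfolding Q_def Cconst_def using eps q d by (intro divide_pos_pos mult_pos_pos) auto
  have QB: "Q\<^sup>2 * (exp 1 * u) \<le> \<epsilon> / 234"
  proof -
    have "234 * (exp 1 * u) * \<epsilon>\<^sup>2 \<le> 234 * (272/100) * (6 * q * ?d\<^sup>2)"
    proof -
      have "exp 1 * (u * \<epsilon>\<^sup>2) \<le> 272/100 * (6 * q * ?d\<^sup>2)"
        using u1 by (intro mult_mono exp_1_bounds c3) auto
      thus ?thesis by (simp add: mult_ac)
    qed
    also have "\<dots> \<le> 16 * Cconst\<^sup>2 * (q * ?d\<^sup>2)"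
    proof -
      have "(157/50)\<^sup>2 \<le> pi\<^sup>2" using pi_bounds by (intro power_mono) auto
      \<comment> \<open>3818.88 against 400 pi^2 > 3943: the value C = 5 pi is used here with little
        slack.\<close>
      hence "234 * (272/100) * 6 \<le> 16 * Cconst\<^sup>2" by (simp add: Cconst_def power_mult_distrib power2_eq_square)
      from mult_right_mono[OF this, of "q * ?d\<^sup>2"] show ?thesis using q by (simp add: mult_ac)
    qed
    finally have "234 * (exp 1 * u) * \<epsilon>\<^sup>2 * \<epsilon> \<le> 16 * Cconst\<^sup>2 * (q * ?d\<^sup>2) * \<epsilon>"
      using eps by (intro mult_right_mono) auto
    hence "234 * (exp 1 * u) * \<epsilon> ^ 3 \<le> \<epsilon> * (16 * Cconst\<^sup>2 * q * ?d\<^sup>2)"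
      by (simp add: power2_eq_square power3_eq_cube mult_ac)
    moreover have "0 < 16 * Cconst\<^sup>2 * q * ?d\<^sup>2" using q d by (simp add: Cconst_def)
    ultimately show ?thesis unfolding Q2 by (simp add: field_simps)
  qed
  have n: "CARD('n)\<^sup>2 = Suc n" using power_mono[OF d2, of 2] by (simp add: n_def)
  have "12/234 * (Q\<^sup>2) ^ n \<le> ?p * J"
  proof -
    have "(Q\<^sup>2) ^ n * (exp 1 * u) ^ n \<le> (\<epsilon> / 234) ^ n"
      unfolding power_mult_distrib[symmetric] using QB u1 by (intro power_mono) auto
    hence "12/234 * ((Q\<^sup>2) ^ n * (exp 1 * u) ^ n) \<le> 12/234 * (\<epsilon> / 234) ^ n"
      by (rule mult_left_mono) simp
    also have "\<dots> = 12 / \<epsilon> * (\<epsilon> / 234) ^ (CARD('n)\<^sup>2)" unfolding n using eps by simp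
    also have "\<dots> \<le> ?p" by (rule prob_pball_lower'[OF eps W])
    finally have "12/234 * ((Q\<^sup>2) ^ n * (exp 1 * u) ^ n) * J \<le> ?p * J" using J0 by (intro mult_right_mono) auto
    moreover have "12/234 * (Q\<^sup>2) ^ n * 1 \<le> 12/234 * (Q\<^sup>2) ^ n * ((exp 1 * u) ^ n * J)"
      by (intro mult_left_mono Jlow) auto
    ultimately show ?thesis by (simp add: mult_ac)
  qed
  also have "\<dots> \<le> 4 * \<delta>\<^sup>2" by (rule crit)
  also have "\<dots> \<le> 4 * (1/32 * Q ^ n)\<^sup>2"
    using \<delta> \<delta>0 unfolding Q_def by (intro mult_left_mono power_mono) auto
  also have "\<dots> = 1/256 * (Q\<^sup>2) ^ n" by (simp add: power_mult_distrib power_divide power_mult[symmetric] mult.commute)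
  finally have "(Q\<^sup>2) ^ n \<le> 0" by simp
  moreover have "0 < (Q\<^sup>2) ^ n" using Q0 by simp
  ultimately show False by simp
qed

theorem theorem3:
  fixes \<mu> \<nu> :: "(complex^'n::finite^'n) measure"
    and \<epsilon> \<delta> :: real and t :: nat
  defines "d \<equiv> CARD('n)"
  assumes d2: "d \<ge> 2"
    and eps: "\<epsilon> > 0"
    and haar: "haar_unitary \<mu>"
    and nu: "prob_on_unitaries \<nu>"
    and exp: "approx_expander \<mu> \<nu> \<delta> t"
    and t_bound: "real t \<ge> 5 * real d powr (5/2) / \<epsilon> * tau \<epsilon> d"
    and delta_bound: "\<delta> \<le> 1/32 * (\<epsilon> powr (3/2) /
          (4 * Cconst * sqrt (ln (6 * Cconst / \<epsilon>)) * real d)) ^ (d^2 - 1)"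
  shows "\<forall>W. unitary W \<longrightarrow> (\<exists>V\<in>msupp \<nu>. Dch W V \<le> \<epsilon>)"
proof (intro allI impI, rule ccontr)
  fix W :: "complex^'n^'n" assume W: "unitary W" and no: "\<not> (\<exists>V\<in>msupp \<nu>. Dch W V \<le> \<epsilon>)"
  interpret haar_pair \<mu> \<nu>
    using haar_measureI[OF haar] unitary_measureI[OF nu] by (simp add: haar_pair_def)
  have far: "\<epsilon> < nrm (W - mat w ** V)" if "V \<in> msupp \<nu>" "cmod w = 1" for V w
    using no that Dch_le_nrm[of w W V] by (meson not_le order_trans)
  have supp: "AE V in \<nu>. V \<in> msupp \<nu>" by (rule AE_msupp) simp
  have AEV: "AE V in \<nu>. unitary V \<and> V \<in> msupp \<nu>" using N.AE_unitary supp by eventually_elim simp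
  \<comment> \<open>Unitary matrices are at distance at most 2, and the support contains a unitary
    matrix because \<nu> is carried by both sets.\<close>
  have "\<epsilon> < 2"
  proof -
    have "\<exists>V. unitary V \<and> V \<in> msupp \<nu>"
    proof (rule ccontr)
      assume "\<not> ?thesis"
      hence "\<And>V. unitary V \<and> V \<in> msupp \<nu> \<Longrightarrow> False" by blast
      hence "AE V in \<nu>. False" by (rule eventually_mono[OF AEV])
      thus False using N.AE_False by simp
    qed
    then obtain V where V: "unitary V" "V \<in> msupp \<nu>" by blast
    have "nrm (W - mat 1 ** V) \<le> 2"
      using nrm_triangle[of W "- V"] nrm_unitary_le[OF W] nrm_unitary_le[OF V(1)] by simp
    thus ?thesis using far[OF V(2), of 1] by simp
  qed
  interpret P: net_params \<epsilon> d by unfold_locales (use eps \<open>\<epsilon> < 2\<close> d2 in auto)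
  have op: "opnorm (tidx t) (dif t) \<le> \<delta>" using exp by (simp add: approx_expander_def dif_def[abs_def])
  have t_bound': "5 * real d powr (5/2) / \<epsilon> * P.\<tau> \<le> real t" using t_bound by (simp add: P.\<tau>_def)
  have r: "\<epsilon> - \<epsilon> / 6 = 5/6 * \<epsilon>" by simp
  let ?p = "prob (pball (\<epsilon> / 6) W)"
  note criterion = support_criterion[OF d2[unfolded d_def] eps \<open>\<epsilon> < 2\<close> W op delta_bound[unfolded d_def]]
  show False
  proof (cases "ln (real d) \<le> 7 * P.q")
    case True
    define m where "m = nat \<lceil>6 * real d ^ 3 * P.\<tau> / \<epsilon>\<^sup>2\<rceil>"
    note md = P.moderate_dim[OF True t_bound' m_def]
    define u where "u = 1 + real m / real (d\<^sup>2 - 1)"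
    define J where "J = (\<integral>U. trs U ^ m \<partial>\<mu>)"
    have u1: "1 \<le> u" by (simp add: u_def)
    have Jlow: "1 \<le> exp (real (d\<^sup>2 - 1) * (1 + ln u)) * J"
    proof -
      have "exp (real (d\<^sup>2 - 1) * (1 + ln u)) = (exp 1 * u) ^ (d\<^sup>2 - 1)"
        using u1 by (simp only: exp_of_nat_mult exp_add exp_ln)
      thus ?thesis using trs_moment_lower'[of m] d2 by (simp add: u_def J_def d_def)
    qed
    have small: "exp (- (real m * (\<epsilon> - \<epsilon> / 6)\<^sup>2 / real d)) \<le> J / 8"
    proof -
      have "16 * exp (- (real m * (5/6 * \<epsilon>)\<^sup>2 / real d)) = exp (ln 16 - real m * (5/6 * \<epsilon>)\<^sup>2 / real d)"
        by (simp add: exp_diff exp_minus field_simps)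
      also have "\<dots> \<le> exp (- (real (d\<^sup>2 - 1) * (1 + ln u)))" using md(3) unfolding u_def by simp
      also have "\<dots> \<le> J"
      proof -
        have "1 / exp x \<le> J" if "1 \<le> exp x * J" for x :: real
          using that by (simp add: divide_le_eq mult.commute)
        from this[OF Jlow] show ?thesis by (simp only: exp_minus inverse_eq_divide)
      qed
      finally show ?thesis unfolding r using exp_ge_zero[of "- (real m * (5/6 * \<epsilon>)\<^sup>2 / real d)"] by linarith
    qed
    show False
    proof (rule criterion[of m])
      show "AE V in \<nu>. trs_on (pball (\<epsilon> / 6) W) (cadj V) m
          \<le> ?p * (\<integral>U. trs U ^ m \<partial>\<mu>) / 8"
        using AEV
      proof eventually_elim
        case (elim V)
        have "trs_on (pball (\<epsilon> / 6) W) (cadj V) m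
            \<le> ?p * exp (- (real m * (\<epsilon> - \<epsilon> / 6)\<^sup>2 / real d))"
          unfolding d_def by (rule tail_pointwise) (use elim far eps in auto)
        also have "\<dots> \<le> ?p * (J / 8)" by (intro mult_left_mono small) simp
        finally show ?case by (simp add: J_def)
      qed
    qed (use md P.q_ge in \<open>auto simp: d_def P.q_def\<close>)
  next
    case False
    hence a: "7 * P.q < ln (real d)" by simp
    define m where "m = nat \<lceil>16 * real d ^ 3 * P.q / \<epsilon>\<^sup>2\<rceil>"
    note ld = P.large_dim[OF a t_bound' m_def]
    define \<rho> where "\<rho> = \<epsilon> / (4 * sqrt P.q)"
    \<comment> \<open>10/3 * 1/4 = 5/6, so the annuli from \<open>n0\<close> on cover the region
      beyond 5/6 \<epsilon>; sqrt q >= 19/10 makes n0 at least 6.\<close>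
    define n0 where "n0 = nat \<lfloor>10/3 * sqrt P.q\<rfloor>"
    define J where "J = (\<integral>U. trs U ^ m \<partial>\<mu>)"
    have n0: "10/3 * sqrt P.q - 1 \<le> real n0" "real n0 \<le> 10/3 * sqrt P.q" "6 \<le> n0"
      unfolding n0_def using P.sqrt_q by linarith+
    have tl: "(\<integral>U. indicat_real {U. (\<epsilon> - \<epsilon> / 6)\<^sup>2 < hsdist U} U * trs U ^ m \<partial>\<mu>)
        \<le> 2 * exp (- ((real CARD('n))\<^sup>2 * ((real n0)\<^sup>2 / 2 - 2 * (17/16)))) * J"
      unfolding J_def
    proof (rule trs_tail_bound)
      show "0 < \<rho>" using eps P.sqrt_q by (simp add: \<rho>_def)
      have "\<rho> \<le> 1"
        unfolding \<rho>_def using eps \<open>\<epsilon> < 2\<close> P.sqrt_q by (simp add: divide_le_eq)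
      hence "\<rho>\<^sup>2 \<le> 1" using \<open>0 < \<rho>\<close> by (simp add: power_le_one)
      thus "\<rho>\<^sup>2 \<le> real CARD('n)" using d2 by (simp add: d_def)
      have "real n0 * \<rho> \<le> 10/3 * sqrt P.q * \<rho>" using n0(2) \<open>0 < \<rho>\<close> by (intro mult_right_mono) auto
      also have "\<dots> = \<epsilon> - \<epsilon> / 6" using P.sqrt_q by (simp add: \<rho>_def)
      finally show "real n0 * \<rho> \<le> \<epsilon> - \<epsilon> / 6" .
      show "real CARD('n) ^ 3 \<le> real m * \<rho>\<^sup>2" "real m * \<rho>\<^sup>2 \<le> 17/16 * real CARD('n) ^ 3"
        using ld(4,5) by (simp_all add: \<rho>_def d_def)
    qed (rule n0)
    \<comment> \<open>The exponent from n0 is at least q + 4 per unit of d^2, whereas the ball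
      volume costs only ln(234 / \<epsilon>) <= q + 1. The surplus times d^2 >= 4 covers ln
      16.\<close>
    have main: "16 * exp (- ((real d)\<^sup>2 * ((real n0)\<^sup>2 / 2 - 2 * (17/16)))) \<le> ?p"
    proof -
      have "(10/3 * sqrt P.q - 1)\<^sup>2 \<le> (real n0)\<^sup>2" using n0 P.sqrt_q by (intro power_mono) auto
      moreover have "(10/3 * sqrt P.q - 1)\<^sup>2 = 100/9 * P.q - 20/3 * sqrt P.q + 1"
        using P.sqrt_q(1) by (simp add: power2_eq_square algebra_simps)
      moreover have "19/10 * sqrt P.q \<le> P.q"
        using mult_right_mono[OF P.sqrt_q(2), of "sqrt P.q"] P.sqrt_q by (simp add: power2_eq_square)
      ultimately have n0q: "P.q + 4 \<le> (real n0)\<^sup>2 / 2 - 2 * (17/16)" using P.q_ge by linarith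
      have ln234: "ln 234 \<le> P.c0 + 1"
      proof -
        have "234 \<le> 30 * (157/50) * (5/2 :: real)" by simp
        also have "\<dots> \<le> 30 * pi * exp 1" using pi_bounds exp_1_bounds by (intro mult_mono) auto
        finally have "ln 234 \<le> ln (30 * pi * exp 1)" by (subst ln_le_cancel_iff) auto
        thus ?thesis by (simp add: P.c0_def ln_mult)
      qed
      have e16: "exp (ln 16 - x) = 16 * exp (- x)" for x :: real
        by (simp add: exp_diff exp_minus field_simps)
      have d4: "4 \<le> (real d)\<^sup>2" using power_mono[of 2 "real d" 2] d2 by simp
      have "ln (16::real) \<le> 4"
        using ln_le_nat[of 16 4] by (simp add: power_divide)
      also have "(4::real) \<le> (real d)\<^sup>2 * 1" using d4 by simp
      also have "\<dots> \<le> (real d)\<^sup>2 * ((real n0)\<^sup>2 / 2 - 2 * (17/16) - (ln 234 - ln \<epsilon>))"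
        using n0q ln234 P.q_eq by (intro mult_left_mono) auto
      finally have "ln 16 - (real d)\<^sup>2 * ((real n0)\<^sup>2 / 2 - 2 * (17/16)) \<le> (real d)\<^sup>2 * (ln \<epsilon> - ln 234)"
        by (simp add: algebra_simps)
      hence "exp (ln 16 - (real d)\<^sup>2 * ((real n0)\<^sup>2 / 2 - 2 * (17/16))) \<le> exp ((real d)\<^sup>2 * (ln \<epsilon> - ln 234))" by simp
      also have "exp (ln 16 - (real d)\<^sup>2 * ((real n0)\<^sup>2 / 2 - 2 * (17/16))) = 16 * exp (- ((real d)\<^sup>2 * ((real n0)\<^sup>2 / 2 - 2 * (17/16))))"
        by (rule e16)
      also have "exp ((real d)\<^sup>2 * (ln \<epsilon> - ln 234)) = (\<epsilon> / 234) ^ (d\<^sup>2)"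
      proof -
        have "exp ((real d)\<^sup>2 * (ln \<epsilon> - ln 234)) = exp (real (d\<^sup>2) * ln (\<epsilon> / 234))" using eps by (simp add: ln_div)
        thus ?thesis using eps by (simp only: exp_of_nat_mult) simp
      qed
      also have "(\<epsilon> / 234) ^ (d\<^sup>2) \<le> 12 / \<epsilon> * (\<epsilon> / 234) ^ (d\<^sup>2)"
      proof -
        have "1 \<le> 12 / \<epsilon>" using eps \<open>\<epsilon> < 2\<close> by (simp add: le_divide_eq)
        from mult_right_mono[OF this, of "(\<epsilon> / 234) ^ (d\<^sup>2)"] show ?thesis using eps by simp
      qed
      also have "\<dots> \<le> ?p" unfolding d_def by (rule prob_pball_lower'[OF eps \<open>\<epsilon> < 2\<close> W])
      finally show ?thesis .
    qed
    have J0: "0 \<le> J" unfolding J_def by simp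
    show False
    proof (rule criterion[of m])
      show "AE V in \<nu>. trs_on (pball (\<epsilon> / 6) W) (cadj V) m
          \<le> ?p * (\<integral>U. trs U ^ m \<partial>\<mu>) / 8"
        using AEV
      proof eventually_elim
        case (elim V)
        have "trs_on (pball (\<epsilon> / 6) W) (cadj V) m
            \<le> (\<integral>U. indicat_real {U. (\<epsilon> - \<epsilon> / 6)\<^sup>2 < hsdist U} U * trs U ^ m \<partial>\<mu>)"
          by (rule tail_global) (use elim far eps in auto)
        also note tl
        also have "2 * exp (- ((real CARD('n))\<^sup>2 * ((real n0)\<^sup>2 / 2 - 2 * (17/16)))) * J \<le> ?p / 8 * J"
          using main J0 unfolding d_def by (intro mult_right_mono) linarith+
        finally show ?case by (simp add: J_def)
      qed
    qed (use ld P.q_ge in \<open>auto simp: d_def P.q_def\<close>)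
  qed
qed

end
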